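(* The property of being $\mathbb{Q}$-normal is $\mathcal T$-stable (in the class of all tropical fans). The property of being normal is $\mathcal T$-stable in the class of unitary tropical fans.
   Context: **Fans.** $N$ is a free abelian group of finite rank, $N_{\mathbb R}=N\otimes\mathbb R$. A rational fan $\Sigma$ in $N_{\mathbb R}$ is a non-empty finite collection of strongly convex rational polyhedral cones, closed under taking faces, any two of which meet in a common face; $|\Sigma|$ is its support, $\Sigma_k$ the set of its $k$-dimensional cones, $\underline 0=\{0\}$; facets are maximal cones. For a cone $\sigma$, $N_\sigma=N\cap\mathrm{span}(\sigma)$ and $N^\sigma=N/N_\sigma$. If $\tau$ is a codimension one face of $\sigma$, $\mathfrak n_{\sigma/\tau}\in N_\sigma$ denotes any vector lying on the same side of $\mathrm{span}(\tau)$ as $\sigma$ with $N_\tau+\mathbb Z\,\mathfrak n_{\sigma/\tau}=N_\sigma$, and $e^\tau_\sigma$ is its image in $N^\tau$. The star fan $\Sigma^\sigma$ is the fan in $N^\sigma_{\mathbb R}$ formed by the images $\eta^\sigma$ of the cones $\eta\in\Sigma$ containing $\sigma$. **Tropical fans.** For $K\in\{\mathbb Z,\mathbb Q\}$, $\mathrm{MW}_p(\Sigma,K)$ is the group of Minkowski weights: maps $w\colon\Sigma_p\to K$ with $\sum_{\sigma\supset\tau,\,\sigma\in\Sigma_p}w(\sigma)e^\tau_\sigma=0$ in $N^\tau\otimes K$ for all $\tau\in\Sigma_{p-1}$; $\mathrm{MW}_p(\Sigma)=\mathrm{MW}_p(\Sigma,\mathbb Z)$. A tropical fan $(\Sigma,\omega_\Sigma)$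 of dimension $d$ is a rational fan of pure dimension $d$ with an orientation, i.e. an element $\omega_\Sigma\in\mathrm{MW}_d(\Sigma)$ taking only non-zero values. Star fans carry the induced orientation $\omega_{\Sigma^\sigma}(\eta^\sigma)=\omega_\Sigma(\eta)$; products carry $\omega(\sigma\times\sigma')=\omega_\Sigma(\sigma)\omega_{\Sigma'}(\sigma')$. Tropical fans are considered up to isomorphism (integral linear isomorphisms of the lattices $N\cap\mathrm{span}|\Sigma|$ matching cones and orientations). A tropical fan is unitary if $\omega_\Sigma$ only takes values $\pm1$. **Normality.** A tropical fan $\Sigma$ of dimension $d$ is normal if $\mathrm{MW}_1(\Sigma^\tau)=\mathbb Z\,\omega_{\Sigma^\tau}$ for every $\tau\in\Sigma_{d-1}$, and $\mathbb Q$-normal if $\mathrm{MW}_1(\Sigma^\tau,\mathbb Q)=\mathbb Q\,\omega_{\Sigma^\tau}$ for every $\tau\in\Sigma_{d-1}$. **Meromorphic functions, divisors, tropical modifications.** A meromorphic function $f$ on $\Sigma$ is a continuous function $|\Sigma|\to\mathbb R$ whose restriction to each cone $\sigma$ is given by an integral linear form $f_\sigma\in\mathrm{Hom}(N_\sigma,\mathbb Z)$. For $\tau\in\Sigma_{d-1}$, $\mathrm{ord}_\tau(f)=-\sum_{\sigma\supset\tau}\omega_\Sigma(\sigma)f_\sigma(\mathfrak n_{\sigma/\tau})+f_\tau\bigl(\sum_{\sigma\supset\tau}\omega_\Sigma(\sigma)\mathfrak n_{\sigma/\tau}\bigr)$ (sums over $\sigma\in\Sigma_d$), and $\mathrm{div}(f)\in\mathrm{MW}_{d-1}(\Sigma)$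 is $\tau\mapsto\mathrm{ord}_\tau(f)$. When not identically zero, $\mathrm{div}(f)$ is identified with the tropical fan $\Delta$ consisting of all $\tau\in\Sigma_{d-1}$ with $\mathrm{ord}_\tau(f)\ne0$ and their faces, oriented by $\mathrm{ord}(f)$; when zero, $\mathrm{div}(f)$ is called trivial and $\Delta=\varnothing$. The tropical modification $\mathrm{TM}_f(\Sigma)$ is the tropical fan in $(N\times\mathbb Z)_{\mathbb R}$ with cones $\sigma_o=\{(x,f(x)):x\in\sigma\}$ for $\sigma\in\Sigma$ and $\delta_\uparrow=\delta_o+\mathbb R_{\ge0}(0,1)$ for $\delta\in\Delta$, with orientation $\sigma_o\mapsto\omega_\Sigma(\sigma)$ ($\sigma\in\Sigma_d$), $\delta_\uparrow\mapsto\mathrm{ord}_\delta(f)$ ($\delta\in\Delta_{d-1}$). **Blow-ups.** For $\sigma\in\Sigma$ and a rational ray $\rho$ in the relative interior of $\sigma$, the blow-up (stellar subdivision) $\Sigma_{(\rho)}$ is obtained by removing all cones containing $\sigma$ and adding the cones $\tau+\rho$ for $\tau$ a face, not containing $\sigma$, of some $\eta\in\Sigma$ with $\eta\supseteq\sigma$; each facet gets the weight of the facet of $\Sigma$ containing it. $\Sigma$ is then the blow-down of $\Sigma_{(\rho)}$ along $\rho$. **$\mathcal T$-stability.** Let $\mathscr C$ be a class of tropical fans. A subclass $\mathscr S\subseteq\mathscr C$ is $\mathcal T$-stable in $\mathscr C$ if: (i) if $\Sigma,\Sigma'\in\mathscr S$ and $\Sigma\times\Sigma'\in\mathscr C$,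 then $\Sigma\times\Sigma'\in\mathscr S$; (ii) if $\Sigma\in\mathscr S$, $f$ is meromorphic on $\Sigma$ with $\mathrm{div}(f)$ trivial or in $\mathscr S$, and $\mathrm{TM}_f(\Sigma)\in\mathscr C$, then $\mathrm{TM}_f(\Sigma)\in\mathscr S$; (iii) if $\Sigma\in\mathscr C$, $\sigma\in\Sigma$, $\rho$ is a rational ray in the relative interior of $\sigma$, $\Sigma^\sigma\in\mathscr S$ and $\Sigma_{(\rho)}\in\mathscr C$, then $\Sigma\in\mathscr S\Leftrightarrow\Sigma_{(\rho)}\in\mathscr S$. A property is $\mathcal T$-stable in $\mathscr C$ if the subclass of elements of $\mathscr C$ having it is; "$\mathcal T$-stable" alone means in the class of all tropical fans. *)

theory Defs
  imports "HOL-Analysis.Analysis" "HOL-Analysis.Finite_Function_Topology"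
begin

section \<open>Lattices, cones and quotients\<close>

text \<open>
  A lattice (free abelian group of finite rank) \<open>N\<close> is given as the group of integral combinations
  of a finite linearly independent set in a real vector space \<open>'a\<close>; then \<open>N \<otimes> \<real>\<close> is \<open>span N\<close>.
  The ambient space \<open>'a\<close> may be larger than \<open>span N\<close>.
\<close>

definition is_lattice :: "'a::real_vector set \<Rightarrow> bool" where
  "is_lattice N \<longleftrightarrow> (\<exists>B. finite B \<and> independent B \<and>
     N = {(\<Sum>b\<in>B. real_of_int (c b) *\<^sub>R b) | c. True})"

definition rational_cone :: "'a::real_vector set \<Rightarrow> 'a set \<Rightarrow> bool" where
  "rational_cone N \<sigma> \<longleftrightarrow> (\<exists>G. finite G \<and> G \<subseteq> N \<and> \<sigma> = convex_cone hull G)"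

definition strongly_convex :: "'a::real_vector set \<Rightarrow> bool" where
  "strongly_convex \<sigma> \<longleftrightarrow> (\<forall>x. x \<in> \<sigma> \<and> - x \<in> \<sigma> \<longrightarrow> x = 0)"

text \<open>The library's \<open>face_of\<close> also admits the empty set.\<close>

definition cone_face :: "'a::real_vector set \<Rightarrow> 'a set \<Rightarrow> bool" where
  "cone_face \<tau> \<sigma> \<longleftrightarrow> \<tau> face_of \<sigma> \<and> \<tau> \<noteq> {}"

definition sublat :: "'a::real_vector set \<Rightarrow> 'a set \<Rightarrow> 'a set" where
  "sublat N \<sigma> = N \<inter> span \<sigma>"

text \<open>
  The quotient of \<open>'a\<close> by a subspace \<open>W\<close> is realised inside \<open>'a\<close>, as the image of some linear
  endomorphism with kernel \<open>W\<close>. For a cone \<open>\<sigma>\<close>, this map for \<open>W = span \<sigma>\<close> sends \<open>N\<close> onto a copy of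
  \<open>N / (N \<inter> span \<sigma>)\<close>.
\<close>

definition quot_map :: "'a::real_vector set \<Rightarrow> 'a \<Rightarrow> 'a" where
  "quot_map W = (SOME \<pi>. linear \<pi> \<and> {x. \<pi> x = 0} = W)"

lemma quot_map:
  fixes W :: "'a::real_vector set"
  assumes "subspace W"
  shows "linear (quot_map W)" "quot_map W x = 0 \<longleftrightarrow> x \<in> W"
proof -
  have "linear (\<lambda>x::'a. x)" "inj_on (\<lambda>x::'a. x) W"
    by (auto intro: linear_id[unfolded id_def])
  then obtain g where g: "range g \<subseteq> W" "linear g" "\<forall>v\<in>W. g v = v"
    using linear_exists_left_inverse_on[of "\<lambda>x. x" W] assms by blast
  then have "linear (\<lambda>x. x - g x) \<and> {x. x - g x = 0} = W"
    by (auto intro!: linear_compose_sub linear_id[unfolded id_def])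
  then have "\<exists>\<pi> :: 'a \<Rightarrow> 'a. linear \<pi> \<and> {x. \<pi> x = 0} = W" by blast
  then have "linear (quot_map W) \<and> {x. quot_map W x = 0} = W"
    unfolding quot_map_def by (rule someI_ex)
  then show "linear (quot_map W)" "quot_map W x = 0 \<longleftrightarrow> x \<in> W" by auto
qed

text \<open>
  For a codimension one face \<open>\<tau>\<close> of \<open>\<sigma>\<close>, the set \<open>\<sigma> + span \<tau>\<close> is the closed half-space of \<open>span \<sigma>\<close>
  that is bounded by \<open>span \<tau>\<close> and contains \<open>\<sigma>\<close>.
\<close>

definition is_normal_vector :: "'a::real_vector set \<Rightarrow> 'a set \<Rightarrow> 'a set \<Rightarrow> 'a \<Rightarrow> bool" where
  "is_normal_vector N \<sigma> \<tau> v \<longleftrightarrow>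
     v \<in> sublat N \<sigma> \<and> v \<in> {x + y | x y. x \<in> \<sigma> \<and> y \<in> span \<tau>} \<and>
     {u + real_of_int k *\<^sub>R v | u k. u \<in> sublat N \<tau>} = sublat N \<sigma>"

definition normal_vector :: "'a::real_vector set \<Rightarrow> 'a set \<Rightarrow> 'a set \<Rightarrow> 'a" where
  "normal_vector N \<sigma> \<tau> = (SOME v. is_normal_vector N \<sigma> \<tau> v)"


section \<open>Tropical fans\<close>

text \<open>
  Only the weights of top-dimensional cones are meaningful. Weights, integral or rational, are
  real numbers lying in the subsets \<open>\<int>\<close> or \<open>\<rat>\<close>.
\<close>

record 'a wfan =
  Lat :: "'a set"
  Cones :: "'a set set"
  wt :: "'a set \<Rightarrow> real"

definition rational_fan :: "'a::real_vector wfan \<Rightarrow> bool" where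
  "rational_fan F \<longleftrightarrow> is_lattice (Lat F) \<and> finite (Cones F) \<and> Cones F \<noteq> {} \<and>
     (\<forall>\<sigma>\<in>Cones F. rational_cone (Lat F) \<sigma> \<and> strongly_convex \<sigma>) \<and>
     (\<forall>\<sigma>\<in>Cones F. \<forall>\<tau>. cone_face \<tau> \<sigma> \<longrightarrow> \<tau> \<in> Cones F) \<and>
     (\<forall>\<sigma>\<in>Cones F. \<forall>\<tau>\<in>Cones F. cone_face (\<sigma> \<inter> \<tau>) \<sigma> \<and> cone_face (\<sigma> \<inter> \<tau>) \<tau>)"

definition support :: "'a wfan \<Rightarrow> 'a set" where
  "support F = \<Union> (Cones F)"

definition fdim :: "'a::real_vector wfan \<Rightarrow> nat" where
  "fdim F = Max (dim ` Cones F)"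

definition cones_dim :: "'a::real_vector wfan \<Rightarrow> nat \<Rightarrow> 'a set set" where
  "cones_dim F k = {\<sigma> \<in> Cones F. dim \<sigma> = k}"

definition codim1 :: "'a::real_vector wfan \<Rightarrow> 'a set set" where
  "codim1 F = {\<tau> \<in> Cones F. dim \<tau> + 1 = fdim F}"

definition facets :: "'a wfan \<Rightarrow> 'a set set" where
  "facets F = {\<sigma> \<in> Cones F. \<forall>\<eta>\<in>Cones F. \<sigma> \<subseteq> \<eta> \<longrightarrow> \<eta> = \<sigma>}"

text \<open>
  Minkowski weights with coefficients in \<open>K\<close> (\<open>\<int>\<close> or \<open>\<rat>\<close>). The condition takes place in the real
  vector space \<open>span N / span \<tau>\<close>, which contains \<open>N\<^sup>\<tau> \<otimes> K\<close>. The side condition on \<open>dim \<tau>\<close> is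
  written so that it is void for \<open>p = 0\<close>.
\<close>

definition MW :: "'a::real_vector wfan \<Rightarrow> nat \<Rightarrow> real set \<Rightarrow> ('a set \<Rightarrow> real) set" where
  "MW F p K = {w \<in> cones_dim F p \<rightarrow>\<^sub>E K. \<forall>\<tau>\<in>Cones F. dim \<tau> + 1 = p \<longrightarrow>
     (\<Sum>\<sigma> | \<sigma> \<in> cones_dim F p \<and> \<tau> \<subseteq> \<sigma>.
        w \<sigma> *\<^sub>R quot_map (span \<tau>) (normal_vector (Lat F) \<sigma> \<tau>)) = 0}"

definition tropical_fan :: "'a::real_vector wfan \<Rightarrow> bool" where
  "tropical_fan F \<longleftrightarrow> rational_fan F \<and> (\<forall>\<sigma>\<in>facets F. dim \<sigma> = fdim F) \<and>
     restrict (wt F) (cones_dim F (fdim F)) \<in> MW F (fdim F) \<int> \<and>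
     (\<forall>\<sigma>\<in>cones_dim F (fdim F). wt F \<sigma> \<noteq> 0)"

definition unitary_fan :: "'a::real_vector wfan \<Rightarrow> bool" where
  "unitary_fan F \<longleftrightarrow> tropical_fan F \<and> (\<forall>\<sigma>\<in>cones_dim F (fdim F). wt F \<sigma> = 1 \<or> wt F \<sigma> = - 1)"

text \<open>
  Isomorphisms. A linear map between the real spans extends to the ambient spaces, so it is no
  restriction to let \<open>\<phi>\<close> be defined everywhere.
\<close>

definition fan_iso :: "'a::real_vector wfan \<Rightarrow> 'b::real_vector wfan \<Rightarrow> bool" where
  "fan_iso F G \<longleftrightarrow> (\<exists>\<phi>. linear \<phi> \<and> inj_on \<phi> (span (support F)) \<and>
     \<phi> ` sublat (Lat F) (support F) = sublat (Lat G) (support G) \<and>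
     (\<lambda>\<sigma>. \<phi> ` \<sigma>) ` Cones F = Cones G \<and>
     (\<forall>\<sigma>\<in>cones_dim F (fdim F). wt G (\<phi> ` \<sigma>) = wt F \<sigma>))"

definition star_fan :: "'a::real_vector wfan \<Rightarrow> 'a set \<Rightarrow> 'a wfan" where
  "star_fan F \<sigma> =
     \<lparr> Lat = quot_map (span \<sigma>) ` Lat F,
       Cones = {quot_map (span \<sigma>) ` \<eta> | \<eta>. \<eta> \<in> Cones F \<and> \<sigma> \<subseteq> \<eta>},
       wt = (\<lambda>\<kappa>. wt F (the_inv_into {\<eta> \<in> Cones F. \<sigma> \<subseteq> \<eta>} (\<lambda>\<eta>. quot_map (span \<sigma>) ` \<eta>) \<kappa>)) \<rparr>"

definition prod_fan :: "'a wfan \<Rightarrow> 'b wfan \<Rightarrow> ('a \<times> 'b) wfan" where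
  "prod_fan F G =
     \<lparr> Lat = Lat F \<times> Lat G,
       Cones = {\<sigma> \<times> \<sigma>' | \<sigma> \<sigma>'. \<sigma> \<in> Cones F \<and> \<sigma>' \<in> Cones G},
       wt = (\<lambda>\<kappa>. wt F (fst ` \<kappa>) * wt G (snd ` \<kappa>)) \<rparr>"


section \<open>Normality\<close>

definition normal_over :: "real set \<Rightarrow> 'a::real_vector wfan \<Rightarrow> bool" where
  "normal_over K F \<longleftrightarrow> (\<forall>\<tau>\<in>codim1 F.
     MW (star_fan F \<tau>) 1 K =
       {restrict (\<lambda>\<sigma>. k * wt (star_fan F \<tau>) \<sigma>) (cones_dim (star_fan F \<tau>) 1) | k. k \<in> K})"

definition normal_fan :: "'a::real_vector wfan \<Rightarrow> bool" where
  "normal_fan F \<longleftrightarrow> normal_over \<int> F"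

definition Q_normal_fan :: "'a::real_vector wfan \<Rightarrow> bool" where
  "Q_normal_fan F \<longleftrightarrow> normal_over \<rat> F"


section \<open>Meromorphic functions, divisors and tropical modifications\<close>

definition meromorphic_fun :: "'a::real_normed_vector wfan \<Rightarrow> ('a \<Rightarrow> real) \<Rightarrow> bool" where
  "meromorphic_fun F f \<longleftrightarrow> continuous_on (support F) f \<and>
     (\<forall>\<sigma>\<in>Cones F. \<exists>g. linear g \<and> (\<forall>x\<in>\<sigma>. f x = g x) \<and> g ` sublat (Lat F) \<sigma> \<subseteq> \<int>)"

text \<open>The form \<open>f\<^sub>\<sigma>\<close>; it is determined by \<open>f\<close> on \<open>span \<sigma>\<close> only.\<close>

definition lin_form :: "('a::real_vector \<Rightarrow> real) \<Rightarrow> 'a set \<Rightarrow> 'a \<Rightarrow> real" where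
  "lin_form f \<sigma> = (SOME g. linear g \<and> (\<forall>x\<in>\<sigma>. f x = g x))"

definition ord_at :: "'a::real_vector wfan \<Rightarrow> ('a \<Rightarrow> real) \<Rightarrow> 'a set \<Rightarrow> real" where
  "ord_at F f \<tau> =
     - (\<Sum>\<sigma> | \<sigma> \<in> cones_dim F (fdim F) \<and> \<tau> \<subseteq> \<sigma>.
          wt F \<sigma> * lin_form f \<sigma> (normal_vector (Lat F) \<sigma> \<tau>))
     + lin_form f \<tau> (\<Sum>\<sigma> | \<sigma> \<in> cones_dim F (fdim F) \<and> \<tau> \<subseteq> \<sigma>.
          wt F \<sigma> *\<^sub>R normal_vector (Lat F) \<sigma> \<tau>)"

text \<open>The fan \<open>\<Delta>\<close>. It has no cones when the divisor is zero, and is then not a fan.\<close>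

definition div_fan :: "'a::real_vector wfan \<Rightarrow> ('a \<Rightarrow> real) \<Rightarrow> 'a wfan" where
  "div_fan F f =
     \<lparr> Lat = Lat F,
       Cones = {\<delta>. \<exists>\<tau>\<in>codim1 F. ord_at F f \<tau> \<noteq> 0 \<and> cone_face \<delta> \<tau>},
       wt = ord_at F f \<rparr>"

definition div_trivial :: "'a::real_vector wfan \<Rightarrow> ('a \<Rightarrow> real) \<Rightarrow> bool" where
  "div_trivial F f \<longleftrightarrow> (\<forall>\<tau>\<in>codim1 F. ord_at F f \<tau> = 0)"

definition graph_cone :: "('a \<Rightarrow> real) \<Rightarrow> 'a set \<Rightarrow> ('a \<times> real) set" where
  "graph_cone f \<sigma> = (\<lambda>x. (x, f x)) ` \<sigma>"

definition up_cone :: "('a \<Rightarrow> real) \<Rightarrow> 'a set \<Rightarrow> ('a \<times> real) set" where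
  "up_cone f \<delta> = {(x, f x + t) | x t. x \<in> \<delta> \<and> t \<ge> 0}"

text \<open>
  The first projection recovers \<open>\<sigma>\<close> from \<open>graph_cone f \<sigma>\<close> and \<open>\<delta>\<close> from \<open>up_cone f \<delta>\<close>; a
  top-dimensional cone of the modification is of the former kind if and only if its projection is
  top-dimensional in \<open>F\<close>.
\<close>

definition trop_mod :: "'a::real_vector wfan \<Rightarrow> ('a \<Rightarrow> real) \<Rightarrow> ('a \<times> real) wfan" where
  "trop_mod F f =
     \<lparr> Lat = Lat F \<times> \<int>,
       Cones = graph_cone f ` Cones F \<union> up_cone f ` Cones (div_fan F f),
       wt = (\<lambda>\<kappa>. if fst ` \<kappa> \<in> cones_dim F (fdim F) then wt F (fst ` \<kappa>)
                 else ord_at F f (fst ` \<kappa>)) \<rparr>"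


section \<open>Blow-ups\<close>

definition rational_ray_in :: "'a::real_normed_vector wfan \<Rightarrow> 'a set \<Rightarrow> 'a set \<Rightarrow> bool" where
  "rational_ray_in F \<sigma> \<rho> \<longleftrightarrow>
     (\<exists>v\<in>Lat F. v \<noteq> 0 \<and> \<rho> = convex_cone hull {v}) \<and> \<rho> - {0} \<subseteq> rel_interior \<sigma>"

definition blow_up :: "'a::real_vector wfan \<Rightarrow> 'a set \<Rightarrow> 'a set \<Rightarrow> 'a wfan" where
  "blow_up F \<sigma> \<rho> =
     \<lparr> Lat = Lat F,
       Cones = {\<eta> \<in> Cones F. \<not> \<sigma> \<subseteq> \<eta>} \<union>
               {{x + y | x y. x \<in> \<tau> \<and> y \<in> \<rho>} | \<tau> \<eta>.
                  \<eta> \<in> Cones F \<and> \<sigma> \<subseteq> \<eta> \<and> cone_face \<tau> \<eta> \<and> \<not> \<sigma> \<subseteq> \<tau>},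
       wt = (\<lambda>\<kappa>. wt F (THE \<eta>. \<eta> \<in> facets F \<and> \<kappa> \<subseteq> \<eta>)) \<rparr>"


section \<open>T-stability\<close>

text \<open>
  Tropical fans are considered up to isomorphism, so a class of tropical fans is an
  isomorphism-closed set of tropical fans in the space \<open>\<real>\<^sup>\<infinity>\<close> of finitely supported sequences, where
  every tropical fan (in a lattice of any rank) has an isomorphic copy. Products and modifications
  live in \<open>\<real>\<^sup>\<infinity> \<times> \<real>\<^sup>\<infinity>\<close> and \<open>\<real>\<^sup>\<infinity> \<times> \<real>\<close>; they belong to a class when their isomorphic copies in
  \<open>\<real>\<^sup>\<infinity>\<close> do.
\<close>

type_synonym tfan = "(nat \<Rightarrow>\<^sub>0 real) wfan"

definition fan_class :: "tfan set \<Rightarrow> bool" where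
  "fan_class C \<longleftrightarrow> (\<forall>F\<in>C. tropical_fan F) \<and>
     (\<forall>F\<in>C. \<forall>G. tropical_fan G \<and> fan_iso F G \<longrightarrow> G \<in> C)"

definition T_stable_in :: "tfan set \<Rightarrow> tfan set \<Rightarrow> bool" where
  "T_stable_in C S \<longleftrightarrow> fan_class C \<and> fan_class S \<and> S \<subseteq> C \<and>
     (\<forall>F\<in>S. \<forall>F'\<in>S. \<forall>G\<in>C. fan_iso (prod_fan F F') G \<longrightarrow> G \<in> S) \<and>
     (\<forall>F\<in>S. \<forall>f. meromorphic_fun F f \<and> (div_trivial F f \<or> div_fan F f \<in> S) \<longrightarrow>
        (\<forall>G\<in>C. fan_iso (trop_mod F f) G \<longrightarrow> G \<in> S)) \<and>
     (\<forall>F\<in>C. \<forall>\<sigma>\<in>Cones F. \<forall>\<rho>. rational_ray_in F \<sigma> \<rho> \<and> star_fan F \<sigma> \<in> S \<and> blow_up F \<sigma> \<rho> \<in> C \<longrightarrow>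
        (F \<in> S \<longleftrightarrow> blow_up F \<sigma> \<rho> \<in> S))"

definition T_stable_property_in :: "tfan set \<Rightarrow> (tfan \<Rightarrow> bool) \<Rightarrow> bool" where
  "T_stable_property_in C P \<longleftrightarrow> T_stable_in C {F \<in> C. P F}"

end

theory Submission
  imports Defs
begin


text \<open>
  \<open>K\<close>-normality at a codimension one cone \<open>\<tau>\<close> means that, modulo \<open>span \<tau>\<close>, the normal vectors of the
  facets around \<open>\<tau>\<close> satisfy no linear relations over \<open>K\<close> other than the multiples of the orientation.

  Around \<open>\<tau> \<times> \<eta>\<close> in a product one sees the facets around \<open>\<tau>\<close>, with weights scaled by that of \<open>\<eta>\<close>.
  Around the graph of \<open>\<tau>\<close> in a tropical modification, a relation projects to a relation of \<open>\<Sigma>\<close>, hence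
  to a multiple \<open>k \<omega>\<close>, and the vertical coordinate then forces the weight of \<open>\<tau>\<^sub>\<up>\<close> to be \<open>k ord\<^sub>\<tau>(f)\<close>;
  around a cone \<open>\<delta>\<^sub>\<up>\<close> one sees the divisor around \<open>\<delta>\<close>.

  A codimension one cone \<open>\<kappa>\<close> of a blow-up either lies in a codimension one cone \<open>\<zeta>\<close> of \<open>\<Sigma>\<close>, and then the
  facets around \<open>\<kappa>\<close> lie in different facets around \<open>\<zeta>\<close> and have the same normal vectors, or it is
  surrounded by two facets only, on opposite sides and both contained in the same facet of \<open>\<Sigma>\<close>.
  Conversely a codimension one cone of \<open>\<Sigma>\<close> either contains \<open>\<sigma>\<close>, where \<open>\<Sigma>\<^sup>\<sigma>\<close> decides, or it survives in
  the blow-up.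

  Unitarity is only needed to divide elements of \<open>\<int>\<close> by weights of facets.
\<close>

section \<open>Dimensions of finitely generated subspaces\<close>

definition fin_gen :: "'a::real_vector set \<Rightarrow> bool" where
  "fin_gen S \<longleftrightarrow> (\<exists>B. finite B \<and> S \<subseteq> span B)"

lemma fin_gen_mono: "fin_gen T \<Longrightarrow> S \<subseteq> span T \<Longrightarrow> fin_gen S"
  unfolding fin_gen_def by (meson order.trans span_minimal subspace_span)

lemma fin_gen_finite: "finite B \<Longrightarrow> fin_gen B"
  unfolding fin_gen_def by (meson span_superset)

lemma fin_gen_basis:
  assumes "fin_gen T"
  obtains B where "B \<subseteq> T" "independent B" "finite B" "span B = span T" "card B = dim T"
proof -
  obtain B where B: "B \<subseteq> T" "independent B" "T \<subseteq> span B" "card B = dim T"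
    using basis_exists by blast
  obtain A where "finite A" "T \<subseteq> span A"
    using assms fin_gen_def by blast
  then have "finite B"
    using independent_span_bound B by (metis order.trans)
  moreover have "span B = span T"
    using B by (metis span_eq span_superset subset_trans)
  ultimately show thesis using that B by blast
qed

lemma dim_mono_fin_gen:
  assumes "fin_gen T" "S \<subseteq> span T"
  shows "dim S \<le> dim T"
proof -
  obtain B where "finite B" "span B = span T" "card B = dim T"
    using fin_gen_basis[OF assms(1)] by metis
  then show ?thesis using dim_le_card[of S B] assms by simp
qed

lemma span_eq_fin_gen:
  assumes "fin_gen T" "S \<subseteq> span T" "dim T \<le> dim S"
  shows "span S = span T"
proof -
  obtain B where B: "finite B" "span B = span T" "card B = dim T"
    using fin_gen_basis[OF assms(1)] by metis
  obtain C where C: "C \<subseteq> S" "independent C" "finite C" "span C = span S" "card C = dim S"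
    using fin_gen_basis fin_gen_mono[OF assms(1,2)] by metis
  have "t \<in> span S" if "t \<in> T" for t
  proof (rule ccontr)
    assume t: "t \<notin> span S"
    then have "independent (insert t C)"
      using C by (simp add: independent_insertI)
    moreover have "insert t C \<subseteq> span B"
      using B C(1) assms(2) that by (auto intro: span_base)
    ultimately have "card (insert t C) \<le> card B"
      using B(1) independent_span_bound by blast
    moreover have "t \<notin> C" using t C by (metis span_base)
    ultimately show False using C B assms(3) by simp
  qed
  then show ?thesis
    by (meson assms(2) span_eq subsetI)
qed

lemma dim_insert_fin_gen:
  assumes "fin_gen S" "v \<notin> span S"
  shows "dim (insert v S) = dim S + 1"
proof -
  obtain B where B: "B \<subseteq> S" "independent B" "finite B" "span B = span S" "card B = dim S"
    using fin_gen_basis[OF assms(1)] by metis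
  have "independent (insert v B)" "v \<notin> B"
    using B assms by (auto simp: independent_insertI span_base)
  moreover have "insert v S \<subseteq> span (insert v B)"
    by (metis B(4) insert_subset span_base insertI1 span_mono subset_insertI subset_trans span_superset)
  ultimately have "card (insert v B) = dim (insert v S)"
    using B(1) by (intro basis_card_eq_dim) auto
  then show ?thesis using B \<open>v \<notin> B\<close> by simp
qed

lemma dim_linear_image_kernel:
  fixes f :: "'a::real_vector \<Rightarrow> 'b::real_vector"
  assumes f: "linear f" and S: "fin_gen S" and T: "T \<subseteq> span S"
    and ker: "\<And>x. x \<in> span S \<Longrightarrow> f x = 0 \<longleftrightarrow> x \<in> span T"
  shows "dim (f ` S) + dim T = dim S"
proof -
  obtain B where B: "B \<subseteq> T" "independent B" "finite B" "span B = span T" "card B = dim T"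
    using fin_gen_basis fin_gen_mono[OF S T] by metis
  obtain C where C: "B \<subseteq> C" "C \<subseteq> span S" "independent C" "span S \<subseteq> span C"
    using maximal_independent_subset_extend[of B "span S"] B(1,2) T by (metis order.trans)
  have sC: "span C = span S"
    using C by (metis span_eq span_span span_superset subset_antisym span_minimal subspace_span)
  have cC: "card C = dim S"
    using dim_eq_card[OF _ C(3)] sC by metis
  have fC: "finite C"
    using S C unfolding fin_gen_def
    by (metis fin_gen_basis independent_span_bound S)
  have inj: "inj_on f (span (C - B))"
  proof -
    have "x = 0" if x: "x \<in> span (C - B)" "f x = 0" for x
    proof -
      have "x \<in> span C" using x(1) by (meson Diff_subset span_mono subsetD)
      then have "x \<in> span B" using ker x(2) B(4) sC by blast
      then obtain u where u: "x = (\<Sum>b\<in>B. u b *\<^sub>R b)"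
        using B(3) by (auto simp: span_finite)
      obtain v where v: "x = (\<Sum>b\<in>C-B. v b *\<^sub>R b)"
        using x(1) fC by (auto simp: span_finite)
      define w where "w b = (if b \<in> B then u b else - v b)" for b
      have "(\<Sum>b\<in>C. w b *\<^sub>R b) = (\<Sum>b\<in>C-B. w b *\<^sub>R b) + (\<Sum>b\<in>B. w b *\<^sub>R b)"
        using fC C(1) by (simp add: sum.subset_diff)
      also have "(\<Sum>b\<in>C-B. w b *\<^sub>R b) = - (\<Sum>b\<in>C-B. v b *\<^sub>R b)"
        unfolding sum_negf[symmetric] by (rule sum.cong) (auto simp: w_def)
      also have "(\<Sum>b\<in>B. w b *\<^sub>R b) = x"
        unfolding u by (simp add: w_def)
      finally have "(\<Sum>b\<in>C. w b *\<^sub>R b) = 0" using v by simp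
      then have "\<forall>b\<in>C. w b = 0"
        using C(3) fC dependent_finite by blast
      then have "\<forall>b\<in>B. u b = 0" using C(1) w_def by force
      then show "x = 0" using u by simp
    qed
    then show ?thesis
      using linear_inj_on_iff_eq_0[OF f subspace_span, of "C - B"] by blast
  qed
  have ind: "independent (f ` (C - B))"
    using independent_mono[OF C(3)] inj f by (simp add: linear_independent_injective_image Diff_subset)
  have "span (f ` (C - B)) = span (f ` S)"
  proof -
    have "f ` C \<subseteq> insert 0 (f ` (C - B))"
    proof
      fix y assume "y \<in> f ` C"
      then obtain c where c: "c \<in> C" "y = f c" by blast
      show "y \<in> insert 0 (f ` (C - B))"
      proof (cases "c \<in> B")
        case True
        then have "f c = 0" using ker[of c] c C(2) B(4) by (metis span_base subsetD)
        then show ?thesis using c by simp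
      qed (use c in blast)
    qed
    then have "span (f ` C) \<subseteq> span (f ` (C - B))"
      by (metis span_insert_0 span_mono)
    moreover have "span (f ` (C - B)) \<subseteq> span (f ` C)"
      by (intro span_mono) blast
    ultimately have "span (f ` (C - B)) = span (f ` C)" by blast
    also have "\<dots> = f ` span C" using f by (simp add: linear_span_image)
    also have "\<dots> = span (f ` S)" using f sC by (simp add: linear_span_image)
    finally show ?thesis .
  qed
  then have "dim (f ` S) = card (f ` (C - B))"
    using dim_eq_card[OF _ ind] by metis
  also have "\<dots> = card (C - B)"
    using inj by (meson card_image inj_on_subset span_superset)
  also have "\<dots> = card C - card B"
    using B C by (simp add: card_Diff_subset)
  finally show ?thesis
    using B cC card_mono[OF fC C(1)] by simp
qed

lemma dim_inj_image_fin_gen: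
  fixes f :: "'a::real_vector \<Rightarrow> 'b::real_vector"
  assumes "linear f" "fin_gen S" "inj_on f (span S)"
  shows "dim (f ` S) = dim S"
proof -
  have "dim (f ` S) + dim {0::'a} = dim S"
  proof (rule dim_linear_image_kernel[OF assms(1,2)])
    show "{0} \<subseteq> span S" by (simp add: span_zero)
    fix x assume "x \<in> span S"
    then show "f x = 0 \<longleftrightarrow> x \<in> span {0}"
      using assms(1,3) by (metis inj_on_eq_iff linear_0 span_zero span_insert_0 span_empty singletonD singletonI)
  qed
  moreover have "dim {0::'a} = 0"
    using dim_eq_card_independent[of "{}::'a set"] by (metis card.empty dim_span independent_empty span_insert_0)
  ultimately show ?thesis by simp
qed

lemma fin_gen_linear_image:
  assumes "linear f" "fin_gen S" shows "fin_gen (f ` S)"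
proof -
  obtain B where "finite B" "S \<subseteq> span B" using assms fin_gen_def by blast
  then have "finite (f ` B)" "f ` S \<subseteq> span (f ` B)"
    using assms(1) by (auto simp: linear_span_image)
  then show ?thesis using fin_gen_def by blast
qed

lemma span_Times_0:
  fixes S :: "'a::real_vector set" and T :: "'b::real_vector set"
  assumes "0 \<in> S" "0 \<in> T"
  shows "span (S \<times> T) = span S \<times> span T"
proof
  have "subspace (span S \<times> span T)"
    by (auto simp: subspace_def zero_prod_def span_zero span_add span_scale)
  then show "span (S \<times> T) \<subseteq> span S \<times> span T"
    by (intro span_minimal) (auto intro: span_base)
next
  have l1: "linear (\<lambda>x::'a. (x, 0::'b))" and l2: "linear (\<lambda>y::'b. (0::'a, y))"
    by (auto intro!: linearI)
  have "(\<lambda>x. (x, 0)) ` span S \<subseteq> span (S \<times> T)"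
    unfolding linear_span_image[OF l1, symmetric] using assms by (intro span_mono) auto
  moreover have "(\<lambda>y. (0, y)) ` span T \<subseteq> span (S \<times> T)"
    unfolding linear_span_image[OF l2, symmetric] using assms by (intro span_mono) auto
  ultimately show "span S \<times> span T \<subseteq> span (S \<times> T)"
  proof (intro subsetI)
    fix z assume z: "z \<in> span S \<times> span T"
    assume a: "(\<lambda>x. (x, 0)) ` span S \<subseteq> span (S \<times> T)" "(\<lambda>y. (0, y)) ` span T \<subseteq> span (S \<times> T)"
    obtain x y where "z = (x, y)" "x \<in> span S" "y \<in> span T" using z by auto
    then have "(x, 0) + (0, y) \<in> span (S \<times> T)"
      using a by (intro span_add) auto
    then show "z \<in> span (S \<times> T)" using \<open>z = (x, y)\<close> by simp
  qed
qed

lemma fin_gen_Times: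
  fixes S :: "'a::real_vector set" and T :: "'b::real_vector set"
  assumes "fin_gen S" "fin_gen T"
  shows "fin_gen (S \<times> T)"
proof -
  obtain A B where "finite A" "S \<subseteq> span A" "finite B" "T \<subseteq> span B"
    using assms unfolding fin_gen_def by blast
  then have "finite (insert 0 A \<times> insert 0 B)" "S \<times> T \<subseteq> span (insert 0 A \<times> insert 0 B)"
    unfolding span_Times_0[OF insertI1 insertI1] by auto
  then show ?thesis unfolding fin_gen_def by blast
qed

lemma dim_Times_fin_gen:
  fixes S :: "'a::real_vector set" and T :: "'b::real_vector set"
  assumes "fin_gen S" "fin_gen T" and 0: "0 \<in> S" "0 \<in> T"
  shows "dim (S \<times> T) = dim S + dim T"
proof -
  have l2: "linear (\<lambda>y::'b. (0::'a, y))" by (auto intro!: linearI)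
  have "dim (fst ` (S \<times> T)) + dim ((\<lambda>y. (0::'a, y)) ` T) = dim (S \<times> T)"
  proof (rule dim_linear_image_kernel)
    show "linear (fst :: 'a \<times> 'b \<Rightarrow> 'a)" by (rule linear_fst)
    show "fin_gen (S \<times> T)" using assms fin_gen_Times by blast
    show "(\<lambda>y. (0::'a, y)) ` T \<subseteq> span (S \<times> T)" using 0 by (auto intro: span_base)
    show "fst x = 0 \<longleftrightarrow> x \<in> span ((\<lambda>y. (0::'a, y)) ` T)" if "x \<in> span (S \<times> T)" for x
      using that unfolding linear_span_image[OF l2] span_Times_0[OF 0] by (cases x) auto
  qed
  moreover have "fst ` (S \<times> T) = S" using 0 by force
  moreover have "dim ((\<lambda>y. (0::'a, y)) ` T) = dim T"
    by (rule dim_inj_image_fin_gen[OF l2 assms(2)]) (auto simp: inj_on_def)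
  ultimately show ?thesis by simp
qed


section \<open>Cones and their faces\<close>

lemma cone_face_convex_cone:
  assumes \<sigma>: "convex_cone \<sigma>" and f: "cone_face \<tau> \<sigma>"
  shows "convex_cone \<tau>"
proof -
  have sub: "\<tau> \<subseteq> \<sigma>" and cv: "convex \<tau>"
    and face: "\<And>a b x. a \<in> \<sigma> \<Longrightarrow> b \<in> \<sigma> \<Longrightarrow> x \<in> \<tau> \<Longrightarrow> x \<in> open_segment a b \<Longrightarrow> a \<in> \<tau> \<and> b \<in> \<tau>"
    and ne: "\<tau> \<noteq> {}"
    using f unfolding cone_face_def face_of_def by blast+
  have big: "0 \<in> \<tau> \<and> c *\<^sub>R t \<in> \<tau>" if t: "t \<in> \<tau>" and c: "c > 1" for t c
  proof (cases "t = 0")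
    case False
    have "t = (1 - 1/c) *\<^sub>R 0 + (1/c) *\<^sub>R (c *\<^sub>R t)" using c by simp
    moreover have "0 \<noteq> c *\<^sub>R t" "0 < 1/c" "1/c < 1" using c False by auto
    ultimately have "t \<in> open_segment 0 (c *\<^sub>R t)"
      unfolding in_segment by blast
    then show ?thesis
      using face[of 0 "c *\<^sub>R t" t] t sub \<sigma> c
      by (meson convex_cone_contains_0 convex_cone_scaleR less_eq_real_def order.strict_trans subsetD zero_less_one)
  qed (use t in simp)
  have 0: "0 \<in> \<tau>" using ne big[of _ 2] by auto
  have "c *\<^sub>R t \<in> \<tau>" if "t \<in> \<tau>" "c \<ge> 0" for t c
  proof (cases "c > 1")
    case False
    then have "c *\<^sub>R t + (1 - c) *\<^sub>R 0 \<in> \<tau>"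
      using that 0 by (intro convexD[OF cv]) auto
    then show ?thesis by simp
  qed (use big that in blast)
  then show ?thesis
    using cv ne by (auto simp: convex_cone_def conic_def)
qed

lemma cone_face_subset: "cone_face \<tau> \<sigma> \<Longrightarrow> \<tau> \<subseteq> \<sigma>"
  unfolding cone_face_def face_of_def by blast

lemma cone_face_summand:
  assumes \<sigma>: "convex_cone \<sigma>" and f: "cone_face \<tau> \<sigma>" and ab: "a \<in> \<sigma>" "b \<in> \<sigma>" "a + b \<in> \<tau>"
  shows "a \<in> \<tau>"
proof -
  have half: "(1/2) *\<^sub>R (a + b) \<in> \<tau>"
    using cone_face_convex_cone[OF \<sigma> f] ab(3) by (simp add: convex_cone_scaleR)
  show ?thesis
  proof (cases "a = b")
    case True
    then have "(1/2) *\<^sub>R (a + b) = a" by (simp flip: scaleR_2)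
    then show ?thesis using half by simp
  next
    case False
    have "(1/2) *\<^sub>R (a + b) = (1 - 1/2) *\<^sub>R a + (1/2) *\<^sub>R b" by (simp add: scaleR_add_right)
    moreover have "(0::real) < 1/2" "(1/2::real) < 1" by auto
    ultimately have "(1/2) *\<^sub>R (a + b) \<in> open_segment a b"
      unfolding in_segment using False by blast
    then show ?thesis
      using half ab f unfolding cone_face_def face_of_def by blast
  qed
qed

lemma cone_faceI:
  assumes \<sigma>: "convex_cone \<sigma>" and \<tau>: "convex_cone \<tau>" and sub: "\<tau> \<subseteq> \<sigma>"
    and face: "\<And>a b. a \<in> \<sigma> \<Longrightarrow> b \<in> \<sigma> \<Longrightarrow> a + b \<in> \<tau> \<Longrightarrow> a \<in> \<tau>"
  shows "cone_face \<tau> \<sigma>"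
proof -
  have "a \<in> \<tau> \<and> b \<in> \<tau>" if ab: "a \<in> \<sigma>" "b \<in> \<sigma>" "x \<in> \<tau>" "x \<in> open_segment a b" for a b x
  proof -
    obtain u where u: "0 < u" "u < 1" "x = (1 - u) *\<^sub>R a + u *\<^sub>R b"
      using ab(4) unfolding in_segment by blast
    have s: "(1 - u) *\<^sub>R a \<in> \<sigma>" "u *\<^sub>R b \<in> \<sigma>"
      using \<sigma> ab u by (auto simp: convex_cone_scaleR)
    have "(1 - u) *\<^sub>R a \<in> \<tau>" "u *\<^sub>R b \<in> \<tau>"
      using face[OF s] face[OF s(2,1)] ab(3) u(3) by (auto simp: add.commute)
    then have "(1/(1-u)) *\<^sub>R ((1 - u) *\<^sub>R a) \<in> \<tau>" "(1/u) *\<^sub>R (u *\<^sub>R b) \<in> \<tau>"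
      using \<tau> u by (auto intro!: convex_cone_scaleR simp del: scaleR_scaleR)
    then show ?thesis using u by simp
  qed
  then show ?thesis
    using \<tau> sub unfolding cone_face_def face_of_def convex_cone_def by blast
qed

lemma span_convex_cone:
  assumes \<tau>: "convex_cone \<tau>" and x: "x \<in> span \<tau>"
  obtains a b where "a \<in> \<tau>" "b \<in> \<tau>" "x = a - b"
proof -
  have "subspace {a - b | a b. a \<in> \<tau> \<and> b \<in> \<tau>}" (is "subspace ?D")
    unfolding subspace_def
  proof (intro conjI ballI allI)
    show "0 \<in> ?D" using convex_cone_contains_0[OF \<tau>] by (metis (mono_tags, lifting) diff_self mem_Collect_eq)
    fix x y assume "x \<in> ?D" "y \<in> ?D"
    then obtain a b c d where "x = a - b" "y = c - d" "a \<in> \<tau>" "b \<in> \<tau>" "c \<in> \<tau>" "d \<in> \<tau>" by blast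
    then have "x + y = (a + c) - (b + d)" "a + c \<in> \<tau>" "b + d \<in> \<tau>"
      using \<tau> by (auto simp: convex_cone_add)
    then show "x + y \<in> ?D" by blast
  next
    fix c x assume "x \<in> ?D"
    then obtain a b where ab: "x = a - b" "a \<in> \<tau>" "b \<in> \<tau>" by blast
    show "c *\<^sub>R x \<in> ?D"
    proof (cases "c \<ge> 0")
      case True
      then have "c *\<^sub>R x = c *\<^sub>R a - c *\<^sub>R b" "c *\<^sub>R a \<in> \<tau>" "c *\<^sub>R b \<in> \<tau>"
        using ab \<tau> by (auto simp: convex_cone_scaleR scaleR_diff_right)
      then show ?thesis by blast
    next
      case False
      then have "c *\<^sub>R x = (-c) *\<^sub>R b - (-c) *\<^sub>R a" "(-c) *\<^sub>R a \<in> \<tau>" "(-c) *\<^sub>R b \<in> \<tau>"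
        using ab \<tau> by (auto intro!: convex_cone_scaleR simp: scaleR_diff_right simp del: scaleR_minus_left)
           (simp_all)
      then show ?thesis by blast
    qed
  qed
  moreover have "\<tau> \<subseteq> ?D"
    using convex_cone_contains_0[OF \<tau>] by force
  ultimately have "span \<tau> \<subseteq> ?D" by (rule span_minimal[rotated])
  then show thesis using x that by blast
qed

lemma cone_face_span:
  assumes \<sigma>: "convex_cone \<sigma>" and f: "cone_face \<tau> \<sigma>" and x: "x \<in> \<sigma>" "x \<in> span \<tau>"
  shows "x \<in> \<tau>"
proof -
  obtain a b where ab: "a \<in> \<tau>" "b \<in> \<tau>" "x = a - b"
    using span_convex_cone[OF cone_face_convex_cone[OF \<sigma> f] x(2)] by metis
  then have "x + b \<in> \<tau>" by simp
  then show ?thesis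
    using cone_face_summand[OF \<sigma> f x(1)] ab(2) cone_face_subset[OF f] by blast
qed

lemma span_convex_cone_hull: "span (convex_cone hull G) = span G"
proof
  have "convex_cone hull G \<subseteq> span G"
    by (simp add: hull_minimal span_superset convex_cone_span)
  then show "span (convex_cone hull G) \<subseteq> span G"
    by (simp add: span_minimal)
  show "span G \<subseteq> span (convex_cone hull G)"
    by (simp add: span_mono hull_subset)
qed

lemma convex_cone_hull_image:
  fixes f :: "'a::real_vector \<Rightarrow> 'b::real_vector"
  assumes f: "linear f"
  shows "f ` (convex_cone hull G) = convex_cone hull (f ` G)"
proof
  have "convex_cone hull G \<subseteq> f -` (convex_cone hull (f ` G))"
  proof (rule hull_minimal)
    show "G \<subseteq> f -` (convex_cone hull (f ` G))"
      using hull_subset by fastforce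
    show "convex_cone (f -` (convex_cone hull (f ` G)))"
      unfolding convex_cone_iff[of "f -` _"]
      by (auto simp: linear_0[OF f] linear_add[OF f] linear_scale[OF f] convex_cone_hull_contains_0 convex_cone_hull_add convex_cone_hull_mul)
  qed
  then show "f ` (convex_cone hull G) \<subseteq> convex_cone hull (f ` G)" by blast
  show "convex_cone hull (f ` G) \<subseteq> f ` (convex_cone hull G)"
    using f by (intro hull_minimal image_mono hull_subset)
      (simp add: convex_cone_convex_cone_hull convex_cone_linear_image)
qed

lemma rational_cone_convex_cone: "rational_cone N \<sigma> \<Longrightarrow> convex_cone \<sigma>"
  unfolding rational_cone_def using convex_cone_convex_cone_hull by blast

lemma rational_cone_fin_gen: "rational_cone N \<sigma> \<Longrightarrow> fin_gen \<sigma>"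
  unfolding rational_cone_def fin_gen_def by (metis span_convex_cone_hull span_superset)

section \<open>Fans\<close>

context
  fixes F :: "'a::real_vector wfan"
  assumes F: "rational_fan F"
begin

lemma fan_rational_cone: "\<sigma> \<in> Cones F \<Longrightarrow> rational_cone (Lat F) \<sigma>"
  using F unfolding rational_fan_def by blast

lemma fan_convex_cone: "\<sigma> \<in> Cones F \<Longrightarrow> convex_cone \<sigma>"
  using fan_rational_cone rational_cone_convex_cone by blast

lemma fan_zero: "\<sigma> \<in> Cones F \<Longrightarrow> 0 \<in> \<sigma>"
  using fan_convex_cone convex_cone_contains_0 by blast

lemma fan_fin_gen: "\<sigma> \<in> Cones F \<Longrightarrow> fin_gen \<sigma>"
  using fan_rational_cone rational_cone_fin_gen by blast

lemma fan_finite: "finite (Cones F)" "Cones F \<noteq> {}"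
  using F unfolding rational_fan_def by blast+

lemma fan_Int:
  assumes "\<sigma> \<in> Cones F" "\<tau> \<in> Cones F" shows "\<sigma> \<inter> \<tau> \<in> Cones F"
  using F assms unfolding rational_fan_def by blast

lemma fan_face: "\<sigma> \<in> Cones F \<Longrightarrow> cone_face \<tau> \<sigma> \<Longrightarrow> \<tau> \<in> Cones F"
  using F unfolding rational_fan_def by blast

lemma fan_subset_face:
  assumes "\<sigma> \<in> Cones F" "\<tau> \<in> Cones F" "\<tau> \<subseteq> \<sigma>" shows "cone_face \<tau> \<sigma>"
proof -
  have "\<sigma> \<inter> \<tau> = \<tau>" using assms by blast
  then show ?thesis using F assms unfolding rational_fan_def by metis
qed

lemma fan_span_Int:
  assumes "\<sigma> \<in> Cones F" "\<tau> \<in> Cones F" "\<tau> \<subseteq> \<sigma>" "x \<in> \<sigma>" "x \<in> span \<tau>"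
  shows "x \<in> \<tau>"
  using cone_face_span[OF fan_convex_cone fan_subset_face] assms by metis

lemma fan_cone_eqI:
  assumes "\<sigma> \<in> Cones F" "\<tau> \<in> Cones F" "\<tau> \<subseteq> \<sigma>" "dim \<sigma> \<le> dim \<tau>"
  shows "\<tau> = \<sigma>"
proof -
  have "span \<tau> = span \<sigma>"
    using assms by (intro span_eq_fin_gen fan_fin_gen) (auto intro: span_base)
  then show ?thesis
    using fan_span_Int[OF assms(1-3)] assms(3) span_superset by blast
qed

lemma fan_dim_mono:
  assumes "\<sigma> \<in> Cones F" "\<tau> \<subseteq> \<sigma>" shows "dim \<tau> \<le> dim \<sigma>"
  using assms by (intro dim_mono_fin_gen fan_fin_gen) (auto intro: span_base)

lemma fan_dim_le: "\<sigma> \<in> Cones F \<Longrightarrow> dim \<sigma> \<le> fdim F"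
  unfolding fdim_def using fan_finite by simp

text \<open>\<open>c > 0\<close> says that \<open>x1\<close> and \<open>x2\<close> lie on the same side of \<open>span \<kappa>\<close>: then \<open>\<kappa>1\<close> and \<open>\<kappa>2\<close>
  meet outside \<open>span \<kappa>\<close>, so that \<open>\<kappa>1 \<inter> \<kappa>2\<close> is a common face of full dimension.\<close>

lemma fan_same_side:
  assumes c: "\<kappa> \<in> Cones F" "\<kappa>1 \<in> Cones F" "\<kappa>2 \<in> Cones F" "\<kappa> \<subseteq> \<kappa>1" "\<kappa> \<subseteq> \<kappa>2"
    and d: "dim \<kappa>1 = dim \<kappa> + 1" "dim \<kappa>2 = dim \<kappa> + 1"
    and x: "x1 \<in> \<kappa>1" "x1 \<notin> span \<kappa>" "x2 \<in> \<kappa>2" "x2 - c *\<^sub>R x1 \<in> span \<kappa>" "c > 0"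
  shows "\<kappa>1 = \<kappa>2"
proof -
  obtain a b where ab: "a \<in> \<kappa>" "b \<in> \<kappa>" "x2 - c *\<^sub>R x1 = a - b"
    using span_convex_cone[OF fan_convex_cone[OF c(1)] x(4)] by metis
  define z where "z = x2 + b"
  have z': "z = c *\<^sub>R x1 + a" using ab(3) unfolding z_def by (simp add: algebra_simps)
  have "z \<in> \<kappa>2" unfolding z_def using ab c x by (intro convex_cone_add fan_convex_cone) auto
  moreover have "z \<in> \<kappa>1" unfolding z' using ab c x by (intro convex_cone_add convex_cone_scaleR fan_convex_cone) auto
  moreover have "z \<notin> span \<kappa>"
  proof
    assume "z \<in> span \<kappa>"
    then have "z - a \<in> span \<kappa>" using ab(1) by (simp add: span_diff span_base)
    then have "c *\<^sub>R x1 \<in> span \<kappa>" unfolding z' by simp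
    then have "(1/c) *\<^sub>R (c *\<^sub>R x1) \<in> span \<kappa>" by (rule span_scale)
    then show False using x by simp
  qed
  ultimately have "insert z \<kappa> \<subseteq> \<kappa>1 \<inter> \<kappa>2" "dim (insert z \<kappa>) = dim \<kappa> + 1"
    using c dim_insert_fin_gen[OF fan_fin_gen[OF c(1)]] by auto
  then have D: "dim \<kappa> + 1 \<le> dim (\<kappa>1 \<inter> \<kappa>2)"
    using fan_dim_mono[OF fan_Int[OF c(2,3)]] by metis
  have "\<kappa>1 \<inter> \<kappa>2 = \<kappa>1" "\<kappa>1 \<inter> \<kappa>2 = \<kappa>2"
    using fan_cone_eqI[OF c(2) fan_Int[OF c(2,3)]] fan_cone_eqI[OF c(3) fan_Int[OF c(2,3)]] D d
    by auto
  then show ?thesis by blast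
qed

end

lemma tropical_rational_fan: "tropical_fan F \<Longrightarrow> rational_fan F"
  unfolding tropical_fan_def by blast

lemma tropical_facet_above:
  assumes F: "tropical_fan F" and \<sigma>: "\<sigma> \<in> Cones F"
  obtains \<eta> where "\<eta> \<in> cones_dim F (fdim F)" "\<sigma> \<subseteq> \<eta>"
proof -
  have "finite {\<eta> \<in> Cones F. \<sigma> \<subseteq> \<eta>}" "\<sigma> \<in> {\<eta> \<in> Cones F. \<sigma> \<subseteq> \<eta>}"
    using fan_finite[OF tropical_rational_fan[OF F]] \<sigma> by auto
  then obtain \<eta> where \<eta>: "\<eta> \<in> Cones F" "\<sigma> \<subseteq> \<eta>" "\<forall>\<xi>\<in>{\<eta> \<in> Cones F. \<sigma> \<subseteq> \<eta>}. \<eta> \<subseteq> \<xi> \<longrightarrow> \<eta> = \<xi>"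
    using finite_has_maximal2 by (metis (no_types, lifting) mem_Collect_eq)
  then have "\<eta> \<in> facets F"
    unfolding facets_def by auto
  then show thesis
    using that \<eta> F unfolding tropical_fan_def cones_dim_def by auto
qed

lemma tropical_facets:
  assumes F: "tropical_fan F"
  shows "facets F = cones_dim F (fdim F)"
proof
  show "facets F \<subseteq> cones_dim F (fdim F)"
    using F unfolding tropical_fan_def facets_def cones_dim_def by blast
  show "cones_dim F (fdim F) \<subseteq> facets F"
  proof
    fix \<eta> assume \<eta>: "\<eta> \<in> cones_dim F (fdim F)"
    have "\<xi> = \<eta>" if "\<xi> \<in> Cones F" "\<eta> \<subseteq> \<xi>" for \<xi>
      using fan_cone_eqI[OF tropical_rational_fan[OF F] that(1) _ that(2)]
        fan_dim_le[OF tropical_rational_fan[OF F] that(1)] \<eta>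
      unfolding cones_dim_def by auto
    then show "\<eta> \<in> facets F"
      using \<eta> unfolding facets_def cones_dim_def by blast
  qed
qed

lemma tropical_wt_Ints:
  assumes "tropical_fan F" "\<eta> \<in> cones_dim F (fdim F)"
  shows "wt F \<eta> \<in> \<int>" "wt F \<eta> \<noteq> 0"
proof -
  have "restrict (wt F) (cones_dim F (fdim F)) \<in> cones_dim F (fdim F) \<rightarrow>\<^sub>E \<int>"
    using assms(1) unfolding tropical_fan_def MW_def by blast
  then show "wt F \<eta> \<in> \<int>" using assms(2) by (metis PiE_mem restrict_apply')
  show "wt F \<eta> \<noteq> 0" using assms unfolding tropical_fan_def by blast
qed


section \<open>Normal vectors\<close>

lemma is_lattice_closed:
  assumes N: "is_lattice N"
  shows "0 \<in> N" "x \<in> N \<Longrightarrow> y \<in> N \<Longrightarrow> x + y \<in> N" "x \<in> N \<Longrightarrow> of_int k *\<^sub>R x \<in> N"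
    "x \<in> N \<Longrightarrow> y \<in> N \<Longrightarrow> x - y \<in> N"
proof -
  obtain B where B: "finite B" "N = {(\<Sum>b\<in>B. real_of_int (c b) *\<^sub>R b) | c. True}"
    using N unfolding is_lattice_def by blast
  have I: "(\<Sum>b\<in>B. real_of_int (c b) *\<^sub>R b) \<in> N" for c using B(2) by blast
  show "0 \<in> N" using I[of "\<lambda>_. 0"] by simp
  show add: "x + y \<in> N" if xy: "x \<in> N" "y \<in> N" for x y
  proof -
    obtain c d where "x = (\<Sum>b\<in>B. real_of_int (c b) *\<^sub>R b)" "y = (\<Sum>b\<in>B. real_of_int (d b) *\<^sub>R b)"
      using xy B(2) by blast
    then have "x + y = (\<Sum>b\<in>B. real_of_int (c b + d b) *\<^sub>R b)"
      by (simp add: scaleR_add_left sum.distrib)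
    then show ?thesis using I[of "\<lambda>b. c b + d b"] by simp
  qed
  show sc: "of_int k *\<^sub>R x \<in> N" if x: "x \<in> N" for x k
  proof -
    obtain c where "x = (\<Sum>b\<in>B. real_of_int (c b) *\<^sub>R b)"
      using x B(2) by blast
    then have "of_int k *\<^sub>R x = (\<Sum>b\<in>B. real_of_int (k * c b) *\<^sub>R b)"
      by (simp add: scaleR_sum_right)
    then show ?thesis using I[of "\<lambda>b. k * c b"] by simp
  qed
  show "x - y \<in> N" if "x \<in> N" "y \<in> N"
    using add[OF that(1) sc[OF that(2), of "-1"]] by simp
qed

lemma is_lattice_finite_box:
  assumes N: "is_lattice N" and C: "finite C"
  shows "finite {x \<in> N. \<exists>r. (\<forall>c\<in>C. 0 \<le> r c \<and> r c \<le> (1::real)) \<and> x = (\<Sum>c\<in>C. r c *\<^sub>R c)}" (is "finite ?S")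
proof -
  obtain B where B: "finite B" "independent B" "N = {(\<Sum>b\<in>B. real_of_int (c b) *\<^sub>R b) | c. True}"
    using N unfolding is_lattice_def by blast
  have "\<exists>g. linear g \<and> (\<forall>x\<in>B. g x = (if x = b then 1 else 0::real))" for b
    using linear_independent_extend[OF B(2), of "\<lambda>x. if x = b then 1 else 0"] by blast
  then obtain l where l: "\<And>b. linear (l b)" "\<And>b x. x \<in> B \<Longrightarrow> l b x = (if x = b then 1 else 0::real)"
    by metis
  define M where "M b = (\<Sum>c\<in>C. \<bar>l b c\<bar>)" for b
  have "?S \<subseteq> (\<lambda>k. \<Sum>b\<in>B. k b *\<^sub>R b) ` (\<Pi>\<^sub>E b\<in>B. {k \<in> \<int>. \<bar>k\<bar> \<le> M b})"
  proof
    fix x assume "x \<in> ?S"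
    then obtain r c where r: "\<forall>c\<in>C. 0 \<le> r c \<and> r c \<le> (1::real)" "x = (\<Sum>c\<in>C. r c *\<^sub>R c)"
      and c: "x = (\<Sum>b\<in>B. real_of_int (c b) *\<^sub>R b)"
      using B(3) by auto
    have lx: "l b x = of_int (c b)" if b: "b \<in> B" for b
    proof -
      have "l b x = (\<Sum>b'\<in>B. real_of_int (c b') * l b b')"
        unfolding c using l(1) by (simp add: linear_sum linear_scale)
      also have "\<dots> = (\<Sum>b'\<in>B. if b' = b then real_of_int (c b') else 0)"
        by (rule sum.cong) (auto simp: l(2))
      finally show ?thesis using b B(1) by simp
    qed
    have "\<bar>l b x\<bar> \<le> M b" for b
    proof -
      have "l b x = (\<Sum>c\<in>C. r c * l b c)"
        unfolding r(2) using l(1) by (simp add: linear_sum linear_scale)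
      then have "\<bar>l b x\<bar> \<le> (\<Sum>c\<in>C. \<bar>r c * l b c\<bar>)" by simp
      also have "\<dots> \<le> M b"
        unfolding M_def using r(1) by (intro sum_mono) (auto simp: abs_mult mult_left_le_one_le)
      finally show ?thesis .
    qed
    then have "restrict (\<lambda>b. l b x) B \<in> (\<Pi>\<^sub>E b\<in>B. {k \<in> \<int>. \<bar>k\<bar> \<le> M b})"
      using lx by auto
    moreover have "x = (\<Sum>b\<in>B. restrict (\<lambda>b. l b x) B b *\<^sub>R b)"
      using c lx by simp
    ultimately show "x \<in> (\<lambda>k. \<Sum>b\<in>B. k b *\<^sub>R b) ` (\<Pi>\<^sub>E b\<in>B. {k \<in> \<int>. \<bar>k\<bar> \<le> M b})" by blast
  qed
  moreover have "finite (\<Pi>\<^sub>E b\<in>B. {k \<in> \<int>. \<bar>k\<bar> \<le> M b})"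
    using B(1) finite_abs_int_segment by (intro finite_PiE) auto
  ultimately show ?thesis using finite_surj by blast
qed

lemma is_normal_vector_exists:
  assumes N: "is_lattice N" and \<sigma>: "rational_cone N \<sigma>" and \<tau>: "rational_cone N \<tau>"
    and sub: "\<tau> \<subseteq> \<sigma>" and d: "dim \<sigma> = dim \<tau> + 1"
  shows "\<exists>v. is_normal_vector N \<sigma> \<tau> v"
proof -
  obtain G H where G: "finite G" "G \<subseteq> N" "\<sigma> = convex_cone hull G"
    and H: "finite H" "H \<subseteq> N" "\<tau> = convex_cone hull H"
    using \<sigma> \<tau> unfolding rational_cone_def by metis
  have sp: "span \<sigma> = span G" "span \<tau> = span H"
    using G H by (simp_all add: span_convex_cone_hull)
  obtain C where C: "C \<subseteq> H" "independent C" "finite C" "span C = span \<tau>" "card C = dim H"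
    using fin_gen_basis[OF fin_gen_finite[OF H(1)]] sp by metis
  have "\<not> G \<subseteq> span \<tau>"
  proof
    assume "G \<subseteq> span \<tau>"
    then have "dim G \<le> dim \<tau>"
      using rational_cone_fin_gen[OF \<tau>] dim_mono_fin_gen by blast
    moreover have "dim G = dim \<sigma>" using sp by (metis dim_span)
    ultimately show False using d by simp
  qed
  then obtain g where g: "g \<in> G" "g \<notin> span \<tau>" by blast
  then have gC: "g \<notin> C" "g \<in> \<sigma>" "g \<in> N"
    using C G by (auto simp: span_base hull_inc)
  have ind: "independent (insert g C)"
    using C g by (simp add: independent_insertI)
  have "span (insert g \<tau>) = span \<sigma>"
  proof (rule span_eq_fin_gen[OF rational_cone_fin_gen[OF \<sigma>]])
    show "insert g \<tau> \<subseteq> span \<sigma>" using sub gC by (auto intro: span_base)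
    show "dim \<sigma> \<le> dim (insert g \<tau>)"
      using d dim_insert_fin_gen[OF rational_cone_fin_gen[OF \<tau>] g(2)] by simp
  qed
  moreover obtain l where l: "linear l" "\<forall>x\<in>insert g C. l x = (if x = g then 1 else 0::real)"
    using linear_independent_extend[OF ind, of "\<lambda>x. if x = g then 1 else 0"] by blast
  moreover have l0: "l x = 0" if "x \<in> span \<tau>" for x
  proof -
    have "x \<in> span C" using that C by simp
    moreover have "l c = 0" if "c \<in> C" for c using l(2) gC(1) that by auto
    ultimately show ?thesis
      using linear_eq_0_on_span[OF l(1)] by blast
  qed
  ultimately have dec: "x - l x *\<^sub>R g \<in> span \<tau>" if "x \<in> span \<sigma>" for x
  proof -
    have "x \<in> span (insert g \<tau>)" using that \<open>span (insert g \<tau>) = span \<sigma>\<close> by simp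
    then obtain k where k: "x - k *\<^sub>R g \<in> span \<tau>"
      using span_breakdown_eq by blast
    then have "l (x - k *\<^sub>R g) = 0" by (rule l0)
    then have "l x = k" using l by (simp add: linear_diff linear_scale)
    then show ?thesis using k by simp
  qed
  define S where "S = {x \<in> N. \<exists>r. (\<forall>c\<in>insert g C. 0 \<le> r c \<and> r c \<le> (1::real)) \<and> x = (\<Sum>c\<in>insert g C. r c *\<^sub>R c)}"
  define L where "L = {l x | x. x \<in> sublat N \<sigma> \<and> 0 < l x \<and> l x \<le> 1}"
  note Ncl = is_lattice_closed[OF N]
  have HN: "C \<subseteq> N" using C H by blast
  have sumN: "(\<Sum>c\<in>C. of_int (k c) *\<^sub>R c) \<in> N" for k
    using C(3) HN by (induction C rule: finite_induct) (auto intro: Ncl)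
  have "L \<subseteq> l ` S"
  proof
    fix m assume "m \<in> L"
    then obtain x where x: "m = l x" "x \<in> N" "x \<in> span \<sigma>" "0 < l x" "l x \<le> 1"
      unfolding L_def sublat_def by blast
    have "x - l x *\<^sub>R g \<in> span C" using dec[OF x(3)] C by simp
    then obtain u where u: "x - l x *\<^sub>R g = (\<Sum>c\<in>C. u c *\<^sub>R c)"
      using C(3) by (auto simp: span_finite)
    define y where "y = x - (\<Sum>c\<in>C. of_int \<lfloor>u c\<rfloor> *\<^sub>R c)"
    define r where "r c = (if c = g then l x else frac (u c))" for c
    have "(\<Sum>c\<in>insert g C. r c *\<^sub>R c) = l x *\<^sub>R g + (\<Sum>c\<in>C. r c *\<^sub>R c)"
      using C(3) gC by (simp add: r_def)
    also have "(\<Sum>c\<in>C. r c *\<^sub>R c) = (\<Sum>c\<in>C. u c *\<^sub>R c - of_int \<lfloor>u c\<rfloor> *\<^sub>R c)"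
      using gC by (intro sum.cong) (auto simp: r_def frac_def scaleR_diff_left)
    also have "l x *\<^sub>R g + \<dots> = y"
      unfolding y_def sum_subtractf u[symmetric] by simp
    finally have "y = (\<Sum>c\<in>insert g C. r c *\<^sub>R c)" ..
    moreover have "\<forall>c\<in>insert g C. 0 \<le> r c \<and> r c \<le> 1"
      using x by (auto simp: r_def intro: less_imp_le[OF frac_lt_1])
    moreover have "y \<in> N" unfolding y_def using x(2) sumN by (intro Ncl)
    ultimately have "y \<in> S" unfolding S_def by blast
    moreover have "l (\<Sum>c\<in>C. of_int \<lfloor>u c\<rfloor> *\<^sub>R c) = 0"
      using C(4) by (intro l0) (metis (no_types, lifting) span_base span_scale span_sum)
    then have "l y = m" unfolding y_def using l(1) x(1) by (simp add: linear_diff)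
    ultimately show "m \<in> l ` S" by blast
  qed
  moreover have "finite S"
    unfolding S_def using is_lattice_finite_box[OF N] C(3) by blast
  ultimately have finL: "finite L" using finite_surj by blast
  have "g \<in> sublat N \<sigma>" "l g = 1"
    unfolding sublat_def using gC l by (auto simp: span_base)
  then have neL: "L \<noteq> {}" unfolding L_def by force
  have "Min L \<in> L" using finL neL by simp
  then obtain v where v: "v \<in> N" "v \<in> span \<sigma>" "0 < l v" "l v \<le> 1" "l v = Min L"
    unfolding L_def sublat_def by auto
  have "is_normal_vector N \<sigma> \<tau> v"
    unfolding is_normal_vector_def
  proof (intro conjI)
    show "v \<in> sublat N \<sigma>" using v unfolding sublat_def by blast
    have "v = l v *\<^sub>R g + (v - l v *\<^sub>R g)" by simp
    moreover have "l v *\<^sub>R g \<in> \<sigma>"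
      using v(3) gC rational_cone_convex_cone[OF \<sigma>] by (simp add: convex_cone_scaleR)
    ultimately show "v \<in> {x + y | x y. x \<in> \<sigma> \<and> y \<in> span \<tau>}"
      using dec[OF v(2)] by blast
    show "{u + real_of_int k *\<^sub>R v | u k. u \<in> sublat N \<tau>} = sublat N \<sigma>"
    proof (intro subset_antisym subsetI)
      fix x assume "x \<in> {u + real_of_int k *\<^sub>R v | u k. u \<in> sublat N \<tau>}"
      then obtain u k where x: "x = u + real_of_int k *\<^sub>R v" "u \<in> N" "u \<in> span \<tau>"
        unfolding sublat_def by blast
      then show "x \<in> sublat N \<sigma>"
        unfolding sublat_def using v Ncl span_mono[OF sub] by (auto intro!: span_add span_scale)
    next
      fix x assume "x \<in> sublat N \<sigma>"
      then have x: "x \<in> N" "x \<in> span \<sigma>" unfolding sublat_def by auto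
      define k where "k = \<lfloor>l x / l v\<rfloor>"
      define u where "u = x - of_int k *\<^sub>R v"
      have u: "u \<in> N" "u \<in> span \<sigma>"
        unfolding u_def using x v by (auto intro!: Ncl span_diff span_scale)
      have "l u = l x - of_int k * l v" unfolding u_def using l(1) by (simp add: linear_diff linear_scale)
      also have "\<dots> = l v * frac (l x / l v)"
        using v(3) unfolding k_def frac_def by (simp add: field_simps)
      finally have lu: "l u = l v * frac (l x / l v)" .
      have "l u = 0"
      proof (rule ccontr)
        assume "l u \<noteq> 0"
        moreover have "0 \<le> l u" "l u < l v"
          unfolding lu using v(3) frac_lt_1[of "l x / l v"] by (auto simp: mult_less_cancel_left2)
        ultimately have "l u \<in> L" unfolding L_def sublat_def using u v by force
        then show False using finL \<open>l u < l v\<close> v(5) by (metis Min_le not_less)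
      qed
      then have "u \<in> span \<tau>" using dec[OF u(2)] by simp
      moreover have "x = u + real_of_int k *\<^sub>R v" unfolding u_def by simp
      ultimately show "x \<in> {u + real_of_int k *\<^sub>R v | u k. u \<in> sublat N \<tau>}"
        unfolding sublat_def using u by blast
    qed
  qed
  then show ?thesis by blast
qed

lemma is_normal_vector_unique:
  assumes out: "\<not> sublat N \<sigma> \<subseteq> span \<tau>"
    and half: "\<And>x y. x \<in> \<sigma> \<Longrightarrow> y \<in> \<sigma> \<Longrightarrow> x + y \<in> span \<tau> \<Longrightarrow> x \<in> span \<tau>"
    and v: "is_normal_vector N \<sigma> \<tau> v" and v': "is_normal_vector N \<sigma> \<tau> v'"
  shows "v - v' \<in> span \<tau>"
proof -
  have S: "sublat N \<sigma> = {u + real_of_int k *\<^sub>R v | u k. u \<in> sublat N \<tau>}"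
    "sublat N \<sigma> = {u + real_of_int k *\<^sub>R v' | u k. u \<in> sublat N \<tau>}"
    using v v' unfolding is_normal_vector_def by auto
  have nv: "v \<notin> span \<tau>"
  proof
    assume "v \<in> span \<tau>"
    then have "sublat N \<sigma> \<subseteq> span \<tau>"
      unfolding S(1) unfolding sublat_def by (auto intro!: span_add span_scale)
    then show False using out by blast
  qed
  have "v' \<in> sublat N \<sigma>" "v \<in> sublat N \<sigma>" using v v' unfolding is_normal_vector_def by auto
  then have "v' \<in> {u + real_of_int k *\<^sub>R v | u k. u \<in> sublat N \<tau>}"
    "v \<in> {u + real_of_int k *\<^sub>R v' | u k. u \<in> sublat N \<tau>}"
    unfolding S(1)[symmetric] S(2)[symmetric] .
  then obtain u k u' k' where u: "v' = u + real_of_int k *\<^sub>R v" "u \<in> span \<tau>"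
    "v = u' + real_of_int k' *\<^sub>R v'" "u' \<in> span \<tau>"
    unfolding sublat_def by blast
  have "v = u' + real_of_int k' *\<^sub>R (u + real_of_int k *\<^sub>R v)"
    using u(3) unfolding u(1) .
  also have "\<dots> = (u' + real_of_int k' *\<^sub>R u) + real_of_int (k * k') *\<^sub>R v"
    by (simp add: scaleR_add_right mult.commute)
  finally have "v - real_of_int (k * k') *\<^sub>R v = u' + real_of_int k' *\<^sub>R u"
    by (metis add_diff_cancel_right')
  then have "(1 - real_of_int (k * k')) *\<^sub>R v = u' + real_of_int k' *\<^sub>R u"
    by (simp add: scaleR_diff_left)
  then have "(1 - real_of_int (k * k')) *\<^sub>R v \<in> span \<tau>"
    using u(2,4) by (metis span_add span_scale)
  then have sp: "inverse (1 - real_of_int (k * k')) *\<^sub>R ((1 - real_of_int (k * k')) *\<^sub>R v) \<in> span \<tau>"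
    by (rule span_scale)
  have "1 - real_of_int (k * k') = 0"
  proof (rule ccontr)
    assume ne: "1 - real_of_int (k * k') \<noteq> 0"
    show False using sp nv unfolding scaleR_scaleR left_inverse[OF ne] scaleR_one by blast
  qed
  then have "real_of_int (k * k') = 1" by linarith
  then have "k * k' = 1" unfolding of_int_eq_1_iff .
  then consider "k = 1" | "k = -1" by (auto simp: zmult_eq_1_iff)
  then show ?thesis
  proof cases
    case 1
    then have "v - v' = - u" using u(1) by simp
    then show ?thesis using u(2) by (simp add: span_neg)
  next
    case 2
    obtain x y x' y' where x: "v = x + y" "x \<in> \<sigma>" "y \<in> span \<tau>" "v' = x' + y'" "x' \<in> \<sigma>" "y' \<in> span \<tau>"
      using v v' unfolding is_normal_vector_def by blast
    have "x + x' = u - y - y'" using x(1,4) u(1) 2 by (simp add: algebra_simps)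
    then have "x + x' \<in> span \<tau>" using u(2) x(3,6) by (metis span_diff)
    then have "x \<in> span \<tau>" using half x by blast
    then have "v \<in> span \<tau>" using x(1,3) by (metis span_add)
    then show ?thesis using nv by blast
  qed
qed

lemma is_normal_vector_image:
  assumes p: "linear p" and n: "is_normal_vector M \<sigma> \<tau> n"
    and \<sigma>: "p ` \<sigma> \<subseteq> \<sigma>'" "p ` sublat M \<sigma> = sublat N \<sigma>'"
    and \<tau>: "p ` span \<tau> \<subseteq> span \<tau>'" "p ` sublat M \<tau> = sublat N \<tau>'"
  shows "is_normal_vector N \<sigma>' \<tau>' (p n)"
  unfolding is_normal_vector_def
proof (intro conjI)
  have n1: "n \<in> sublat M \<sigma>" and n2: "\<exists>x y. n = x + y \<and> x \<in> \<sigma> \<and> y \<in> span \<tau>"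
    and n3: "{u + real_of_int k *\<^sub>R n | u k. u \<in> sublat M \<tau>} = sublat M \<sigma>"
    using n unfolding is_normal_vector_def by auto
  show "p n \<in> sublat N \<sigma>'" unfolding \<sigma>(2)[symmetric] using n1 by blast
  obtain x y where "n = x + y" "x \<in> \<sigma>" "y \<in> span \<tau>" using n2 by blast
  then have "p n = p x + p y" "p x \<in> \<sigma>'" "p y \<in> span \<tau>'"
    using \<sigma>(1) \<tau>(1) by (auto simp: linear_add[OF p])
  then show "p n \<in> {x + y | x y. x \<in> \<sigma>' \<and> y \<in> span \<tau>'}" by blast
  have "{u + real_of_int k *\<^sub>R p n | u k. u \<in> p ` sublat M \<tau>} =
    p ` {u + real_of_int k *\<^sub>R n | u k. u \<in> sublat M \<tau>}" (is "?A = p ` ?B")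
  proof (intro subset_antisym subsetI)
    fix z assume "z \<in> ?A"
    then obtain u k where "z = p u + real_of_int k *\<^sub>R p n" "u \<in> sublat M \<tau>" by blast
    then have "z = p (u + real_of_int k *\<^sub>R n)" by (simp add: linear_add[OF p] linear_scale[OF p])
    then show "z \<in> p ` ?B" using \<open>u \<in> sublat M \<tau>\<close> by blast
  next
    fix z assume "z \<in> p ` ?B"
    then obtain u k where "z = p (u + real_of_int k *\<^sub>R n)" "u \<in> sublat M \<tau>" by blast
    then have "z = p u + real_of_int k *\<^sub>R p n" by (simp add: linear_add[OF p] linear_scale[OF p])
    then show "z \<in> ?A" using \<open>u \<in> sublat M \<tau>\<close> by blast
  qed
  then show "{u + real_of_int k *\<^sub>R p n | u k. u \<in> sublat N \<tau>'} = sublat N \<sigma>'"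
    unfolding \<tau>(2)[symmetric] \<sigma>(2)[symmetric] n3 .
qed

lemma sublat_rational_cone_not_subset:
  assumes "rational_cone N \<sigma>" "\<not> \<sigma> \<subseteq> span \<tau>"
  shows "\<not> sublat N \<sigma> \<subseteq> span \<tau>"
proof
  assume s: "sublat N \<sigma> \<subseteq> span \<tau>"
  obtain G where G: "G \<subseteq> N" "\<sigma> = convex_cone hull G" using assms(1) unfolding rational_cone_def by blast
  then have "G \<subseteq> span \<tau>"
    using s unfolding sublat_def by (auto intro: span_base hull_inc)
  then have "\<sigma> \<subseteq> span \<tau>"
    using G by (simp add: hull_minimal convex_cone_span)
  then show False using assms(2) by blast
qed

context
  fixes F :: "'a::real_vector wfan"
  assumes F: "rational_fan F"
begin

lemma fan_lattice: "is_lattice (Lat F)"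
  using F unfolding rational_fan_def by blast

lemma fan_not_subset_span:
  assumes "\<sigma> \<in> Cones F" "\<tau> \<in> Cones F" "dim \<tau> < dim \<sigma>"
  shows "\<not> \<sigma> \<subseteq> span \<tau>"
  using dim_mono_fin_gen[OF fan_fin_gen[OF F]] assms by (metis not_less)

lemma fan_normal_vector_exists:
  assumes "\<sigma> \<in> Cones F" "\<tau> \<in> Cones F" "\<tau> \<subseteq> \<sigma>" "dim \<sigma> = dim \<tau> + 1"
  shows "is_normal_vector (Lat F) \<sigma> \<tau> (normal_vector (Lat F) \<sigma> \<tau>)"
  unfolding normal_vector_def
  using is_normal_vector_exists[OF fan_lattice fan_rational_cone[OF F] fan_rational_cone[OF F]] assms
  by (metis someI_ex)

lemma fan_normal_vector_unique:
  assumes c: "\<sigma> \<in> Cones F" "\<tau> \<in> Cones F" "\<tau> \<subseteq> \<sigma>" "dim \<tau> < dim \<sigma>"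
    and n: "is_normal_vector (Lat F) \<sigma> \<tau> v" "is_normal_vector (Lat F) \<sigma> \<tau> v'"
  shows "v - v' \<in> span \<tau>"
proof (rule is_normal_vector_unique[OF _ _ n])
  show "\<not> sublat (Lat F) \<sigma> \<subseteq> span \<tau>"
    using c by (intro sublat_rational_cone_not_subset fan_rational_cone[OF F] fan_not_subset_span)
  fix x y assume xy: "x \<in> \<sigma>" "y \<in> \<sigma>" "x + y \<in> span \<tau>"
  then have "x + y \<in> \<tau>"
    using c fan_convex_cone[OF F] by (intro fan_span_Int[OF F c(1-3)]) (auto intro: convex_cone_add)
  then have "x \<in> \<tau>"
    using cone_face_summand[OF fan_convex_cone[OF F] fan_subset_face[OF F]] c xy by metis
  then show "x \<in> span \<tau>" by (rule span_base)
qed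

lemma fan_normal_vector_notin_span:
  assumes c: "\<sigma> \<in> Cones F" "\<tau> \<in> Cones F" "dim \<tau> < dim \<sigma>"
    and n: "is_normal_vector (Lat F) \<sigma> \<tau> v"
  shows "v \<notin> span \<tau>"
proof
  assume v: "v \<in> span \<tau>"
  have S: "sublat (Lat F) \<sigma> = {u + real_of_int k *\<^sub>R v | u k. u \<in> sublat (Lat F) \<tau>}"
    using n unfolding is_normal_vector_def by blast
  have "sublat (Lat F) \<sigma> \<subseteq> span \<tau>"
    using v unfolding S unfolding sublat_def by (auto intro!: span_add span_scale)
  then show False
    using sublat_rational_cone_not_subset[OF fan_rational_cone[OF F c(1)]] fan_not_subset_span c by blast
qed

end


section \<open>Normality at a codimension one cone\<close>

definition top_star :: "'a::real_vector wfan \<Rightarrow> 'a set \<Rightarrow> 'a set set" where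
  "top_star F \<tau> = {\<eta> \<in> cones_dim F (fdim F). \<tau> \<subseteq> \<eta>}"

text \<open>\<open>MW\<^sub>1(\<Sigma>\<^sup>\<tau>, K) \<subseteq> K \<omega>\<close>, expressed in \<open>N\<close> instead of \<open>N\<^sup>\<tau>\<close>. Allowing arbitrary normal vectors
  makes the condition meaningful even when \<open>F\<close> is not known to be a fan.\<close>

definition normal_at :: "real set \<Rightarrow> 'a::real_vector wfan \<Rightarrow> 'a set \<Rightarrow> bool" where
  "normal_at K F \<tau> \<longleftrightarrow> (\<forall>w n.
     (\<forall>\<eta>\<in>top_star F \<tau>. w \<eta> \<in> K \<and> is_normal_vector (Lat F) \<eta> \<tau> (n \<eta>)) \<and>
     (\<Sum>\<eta>\<in>top_star F \<tau>. w \<eta> *\<^sub>R n \<eta>) \<in> span \<tau> \<longrightarrow>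
     (\<exists>k\<in>K. \<forall>\<eta>\<in>top_star F \<tau>. w \<eta> = k * wt F \<eta>))"

lemma normal_atI:
  assumes "\<And>w n. (\<And>\<eta>. \<eta> \<in> top_star F \<tau> \<Longrightarrow> w \<eta> \<in> K) \<Longrightarrow>
      (\<And>\<eta>. \<eta> \<in> top_star F \<tau> \<Longrightarrow> is_normal_vector (Lat F) \<eta> \<tau> (n \<eta>)) \<Longrightarrow>
      (\<Sum>\<eta>\<in>top_star F \<tau>. w \<eta> *\<^sub>R n \<eta>) \<in> span \<tau> \<Longrightarrow> \<exists>k\<in>K. \<forall>\<eta>\<in>top_star F \<tau>. w \<eta> = k * wt F \<eta>"
  shows "normal_at K F \<tau>"
  unfolding normal_at_def by (intro allI impI, rule assms) auto

lemma normal_atD: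
  assumes "normal_at K F \<tau>" "\<And>\<eta>. \<eta> \<in> top_star F \<tau> \<Longrightarrow> w \<eta> \<in> K"
    "\<And>\<eta>. \<eta> \<in> top_star F \<tau> \<Longrightarrow> is_normal_vector (Lat F) \<eta> \<tau> (n \<eta>)"
    "(\<Sum>\<eta>\<in>top_star F \<tau>. w \<eta> *\<^sub>R n \<eta>) \<in> span \<tau>"
  obtains k where "k \<in> K" "\<And>\<eta>. \<eta> \<in> top_star F \<tau> \<Longrightarrow> w \<eta> = k * wt F \<eta>"
  using assms(1)[unfolded normal_at_def, rule_format, of w n] assms(2-4) that by blast

text \<open>Facets of \<open>F\<close> that are not in the image of \<open>\<gamma>\<close> get weight \<open>0\<close>.\<close>

lemma normal_at_transfer:
  fixes F :: "'a::real_vector wfan" and P :: "'b::real_vector wfan" and p :: "'b \<Rightarrow> 'a"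
  assumes na: "normal_at K F \<tau>" and fin: "finite (top_star F \<tau>)" and K0: "0 \<in> K"
    and inj: "inj_on \<gamma> (top_star P \<kappa>)" and im: "\<gamma> ` top_star P \<kappa> \<subseteq> top_star F \<tau>"
    and ex: "\<And>\<eta>. \<eta> \<in> top_star F \<tau> - \<gamma> ` top_star P \<kappa> \<Longrightarrow> \<exists>n. is_normal_vector (Lat F) \<eta> \<tau> n"
    and p: "linear p" "p ` \<kappa> \<subseteq> span \<tau>"
    and nv: "\<And>\<xi> n. \<xi> \<in> top_star P \<kappa> \<Longrightarrow> is_normal_vector (Lat P) \<xi> \<kappa> n \<Longrightarrow>
      is_normal_vector (Lat F) (\<gamma> \<xi>) \<tau> (p n)"
    and wts: "\<And>\<xi>. \<xi> \<in> top_star P \<kappa> \<Longrightarrow> wt P \<xi> = c * wt F (\<gamma> \<xi>)"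
    and c: "c \<noteq> 0" "\<And>k. k \<in> K \<Longrightarrow> k / c \<in> K"
  shows "normal_at K P \<kappa>"
proof (rule normal_atI)
  fix w n
  assume w: "\<And>\<xi>. \<xi> \<in> top_star P \<kappa> \<Longrightarrow> w \<xi> \<in> K"
    and n: "\<And>\<xi>. \<xi> \<in> top_star P \<kappa> \<Longrightarrow> is_normal_vector (Lat P) \<xi> \<kappa> (n \<xi>)"
    and s: "(\<Sum>\<xi>\<in>top_star P \<kappa>. w \<xi> *\<^sub>R n \<xi>) \<in> span \<kappa>"
  let ?T = "top_star P \<kappa>" and ?i = "the_inv_into (top_star P \<kappa>) \<gamma>"
  have i: "?i (\<gamma> \<xi>) = \<xi>" if "\<xi> \<in> ?T" for \<xi> using the_inv_into_f_f[OF inj that] .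
  define w' where "w' \<eta> = (if \<eta> \<in> \<gamma> ` ?T then w (?i \<eta>) else 0)" for \<eta>
  define n' where "n' \<eta> = (if \<eta> \<in> \<gamma> ` ?T then p (n (?i \<eta>)) else (SOME m. is_normal_vector (Lat F) \<eta> \<tau> m))" for \<eta>
  have w'\<gamma>: "w' (\<gamma> \<xi>) = w \<xi>" and n'\<gamma>: "n' (\<gamma> \<xi>) = p (n \<xi>)" if "\<xi> \<in> ?T" for \<xi>
    unfolding w'_def n'_def using that i[OF that] by auto
  have w'K: "w' \<eta> \<in> K" for \<eta>
  proof (cases "\<eta> \<in> \<gamma> ` ?T")
    case True
    then obtain \<xi> where "\<xi> \<in> ?T" "\<eta> = \<gamma> \<xi>" by blast
    then show ?thesis using w'\<gamma> w by simp
  qed (simp add: w'_def K0)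
  have n': "is_normal_vector (Lat F) \<eta> \<tau> (n' \<eta>)" if \<eta>: "\<eta> \<in> top_star F \<tau>" for \<eta>
  proof (cases "\<eta> \<in> \<gamma> ` ?T")
    case True
    then obtain \<xi> where "\<xi> \<in> ?T" "\<eta> = \<gamma> \<xi>" by blast
    then show ?thesis using n'\<gamma> nv n by simp
  next
    case False
    then have "\<exists>m. is_normal_vector (Lat F) \<eta> \<tau> m" using ex \<eta> by blast
    then show ?thesis unfolding n'_def using False by (simp add: someI_ex)
  qed
  have "(\<Sum>\<eta>\<in>top_star F \<tau>. w' \<eta> *\<^sub>R n' \<eta>) = (\<Sum>\<eta>\<in>\<gamma> ` ?T. w' \<eta> *\<^sub>R n' \<eta>)"
    by (rule sum.mono_neutral_right[OF fin im]) (simp add: w'_def)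
  also have "\<dots> = (\<Sum>\<xi>\<in>?T. w \<xi> *\<^sub>R p (n \<xi>))"
    by (simp add: sum.reindex[OF inj] w'\<gamma> n'\<gamma> cong: sum.cong)
  also have "\<dots> = p (\<Sum>\<xi>\<in>?T. w \<xi> *\<^sub>R n \<xi>)"
    by (simp add: linear_sum[OF p(1)] linear_scale[OF p(1)])
  finally have "(\<Sum>\<eta>\<in>top_star F \<tau>. w' \<eta> *\<^sub>R n' \<eta>) \<in> p ` span \<kappa>" using s by simp
  also have "p ` span \<kappa> \<subseteq> span \<tau>"
    unfolding linear_span_image[OF p(1), symmetric] using p(2) by (simp add: span_minimal)
  finally obtain k where k: "k \<in> K" "\<And>\<eta>. \<eta> \<in> top_star F \<tau> \<Longrightarrow> w' \<eta> = k * wt F \<eta>"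
    using normal_atD[OF na, where w = w' and n = n', OF w'K n'] by metis
  have "w \<xi> = (k / c) * wt P \<xi>" if \<xi>: "\<xi> \<in> ?T" for \<xi>
  proof -
    have "w \<xi> = k * wt F (\<gamma> \<xi>)" using k(2)[of "\<gamma> \<xi>"] w'\<gamma>[OF \<xi>] im \<xi> by auto
    then show ?thesis using wts[OF \<xi>] c(1) by simp
  qed
  then show "\<exists>k\<in>K. \<forall>\<xi>\<in>?T. w \<xi> = k * wt P \<xi>" using c(2)[OF k(1)] by blast
qed

lemma top_starD:
  assumes "\<eta> \<in> top_star F \<tau>"
  shows "\<eta> \<in> Cones F" "dim \<eta> = fdim F" "\<tau> \<subseteq> \<eta>" "\<eta> \<in> cones_dim F (fdim F)"
  using assms unfolding top_star_def cones_dim_def by auto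

lemma codim1D: "\<tau> \<in> codim1 F \<Longrightarrow> \<tau> \<in> Cones F" "\<tau> \<in> codim1 F \<Longrightarrow> fdim F = dim \<tau> + 1"
  unfolding codim1_def by auto

lemma finite_top_star: "finite (Cones F) \<Longrightarrow> finite (top_star F \<tau>)"
  unfolding top_star_def cones_dim_def by simp

lemma normal_vector_top_star:
  assumes "rational_fan F" "\<tau> \<in> codim1 F" "\<eta> \<in> top_star F \<tau>"
  shows "is_normal_vector (Lat F) \<eta> \<tau> (normal_vector (Lat F) \<eta> \<tau>)"
  using fan_normal_vector_exists[OF assms(1)] codim1D[OF assms(2)] top_starD[OF assms(3)] by metis

lemma sum_diff_in_span:
  assumes "\<And>x. x \<in> A \<Longrightarrow> n x - n' x \<in> span S"
  shows "(\<Sum>x\<in>A. w x *\<^sub>R n x) \<in> span S \<longleftrightarrow> (\<Sum>x\<in>A. w x *\<^sub>R n' x) \<in> span S"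
proof -
  have "(\<Sum>x\<in>A. w x *\<^sub>R n x) - (\<Sum>x\<in>A. w x *\<^sub>R n' x) \<in> span S"
    unfolding sum_subtractf[symmetric] scaleR_diff_right[symmetric]
    using assms by (intro span_sum span_scale)
  then show ?thesis
    by (metis add_diff_cancel diff_add_cancel span_add_eq span_diff)
qed

lemma top_star_sum_in_span:
  assumes F: "rational_fan F" and \<tau>: "\<tau> \<in> codim1 F"
    and n: "\<And>\<eta>. \<eta> \<in> top_star F \<tau> \<Longrightarrow> is_normal_vector (Lat F) \<eta> \<tau> (n \<eta>)"
    and n': "\<And>\<eta>. \<eta> \<in> top_star F \<tau> \<Longrightarrow> is_normal_vector (Lat F) \<eta> \<tau> (n' \<eta>)"
  shows "(\<Sum>\<eta>\<in>top_star F \<tau>. w \<eta> *\<^sub>R n \<eta>) \<in> span \<tau> \<longleftrightarrow> (\<Sum>\<eta>\<in>top_star F \<tau>. w \<eta> *\<^sub>R n' \<eta>) \<in> span \<tau>"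
proof (rule sum_diff_in_span)
  fix \<eta> assume \<eta>: "\<eta> \<in> top_star F \<tau>"
  show "n \<eta> - n' \<eta> \<in> span \<tau>"
    using fan_normal_vector_unique[OF F _ _ _ _ n[OF \<eta>] n'[OF \<eta>]] codim1D[OF \<tau>] top_starD[OF \<eta>]
    by simp
qed

lemma tropical_balanced:
  assumes F: "tropical_fan F" and \<tau>: "\<tau> \<in> codim1 F"
    and n: "\<And>\<eta>. \<eta> \<in> top_star F \<tau> \<Longrightarrow> is_normal_vector (Lat F) \<eta> \<tau> (n \<eta>)"
  shows "(\<Sum>\<eta>\<in>top_star F \<tau>. wt F \<eta> *\<^sub>R n \<eta>) \<in> span \<tau>"
proof -
  let ?d = "fdim F" and ?q = "quot_map (span \<tau>)" and ?n = "\<lambda>\<eta>. normal_vector (Lat F) \<eta> \<tau>"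
  note q = quot_map[OF subspace_span[of \<tau>]]
  have "restrict (wt F) (cones_dim F ?d) \<in> MW F ?d \<int>"
    using F unfolding tropical_fan_def by blast
  then have "(\<Sum>\<sigma> | \<sigma> \<in> cones_dim F ?d \<and> \<tau> \<subseteq> \<sigma>. restrict (wt F) (cones_dim F ?d) \<sigma> *\<^sub>R ?q (?n \<sigma>)) = 0"
    using codim1D[OF \<tau>] unfolding MW_def by simp
  then have "(\<Sum>\<sigma>\<in>top_star F \<tau>. restrict (wt F) (cones_dim F ?d) \<sigma> *\<^sub>R ?q (?n \<sigma>)) = 0"
    unfolding top_star_def by simp
  also have "(\<Sum>\<sigma>\<in>top_star F \<tau>. restrict (wt F) (cones_dim F ?d) \<sigma> *\<^sub>R ?q (?n \<sigma>)) =
     (\<Sum>\<sigma>\<in>top_star F \<tau>. wt F \<sigma> *\<^sub>R ?q (?n \<sigma>))"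
    by (rule sum.cong) (auto simp: top_star_def)
  also have "\<dots> = ?q (\<Sum>\<sigma>\<in>top_star F \<tau>. wt F \<sigma> *\<^sub>R ?n \<sigma>)"
    using q(1) by (simp add: linear_sum linear_scale)
  finally have "(\<Sum>\<sigma>\<in>top_star F \<tau>. wt F \<sigma> *\<^sub>R ?n \<sigma>) \<in> span \<tau>"
    using q(2) by blast
  then show ?thesis
    using top_star_sum_in_span[OF tropical_rational_fan[OF F] \<tau> n normal_vector_top_star[OF tropical_rational_fan[OF F] \<tau>]]
    by blast
qed

section \<open>Star fans\<close>

context
  fixes F :: "'a::real_vector wfan" and \<sigma> :: "'a set"
  assumes F: "rational_fan F" and \<sigma>: "\<sigma> \<in> Cones F"
begin

private abbreviation "q \<equiv> quot_map (span \<sigma>)"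

private lemmas q_linear = quot_map(1)[OF subspace_span[of \<sigma>]]
private lemmas q_zero = quot_map(2)[OF subspace_span[of \<sigma>]]

lemma quot_map_mem_image_iff:
  assumes "\<sigma> \<subseteq> span S" shows "q x \<in> q ` span S \<longleftrightarrow> x \<in> span S"
proof
  assume "q x \<in> q ` span S"
  then obtain s where s: "s \<in> span S" "q x = q s" by blast
  then have "q (x - s) = 0" using q_linear by (simp add: linear_diff)
  then have "x - s \<in> span \<sigma>" using q_zero by blast
  then have "x - s \<in> span S" using assms by (meson span_minimal subspace_span subsetD)
  then have "(x - s) + s \<in> span S" using s(1) span_add by blast
  then show "x \<in> span S" by simp
qed blast

lemma quot_map_mem_span_iff:
  assumes "\<sigma> \<subseteq> span S" shows "q x \<in> span (q ` S) \<longleftrightarrow> x \<in> span S"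
  using quot_map_mem_image_iff[OF assms] by (simp add: linear_span_image[OF q_linear])

lemma quot_image_subsetD:
  assumes "\<eta> \<in> Cones F" "\<eta>' \<in> Cones F" "\<sigma> \<subseteq> \<eta>" "\<sigma> \<subseteq> \<eta>'" "q ` \<eta> \<subseteq> q ` \<eta>'"
  shows "\<eta> \<subseteq> \<eta>'"
proof
  fix x assume x: "x \<in> \<eta>"
  then have "q x \<in> q ` \<eta>'" using assms(5) by blast
  then obtain x' where x': "x' \<in> \<eta>'" "q x = q x'" by blast
  then have "q (x - x') = 0" using q_linear by (simp add: linear_diff)
  then have "x - x' \<in> span \<sigma>" using q_zero by blast
  then obtain a b where ab: "a \<in> \<sigma>" "b \<in> \<sigma>" "x - x' = a - b"
    using span_convex_cone[OF fan_convex_cone[OF F \<sigma>]] by metis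
  then have e: "x + b = x' + a" by (simp add: algebra_simps)
  have "b \<in> \<eta>" using ab assms by blast
  have "x + b \<in> \<eta>"
    using convex_cone_add[OF fan_convex_cone[OF F assms(1)] x \<open>b \<in> \<eta>\<close>] .
  moreover have "x' + a \<in> \<eta>'"
    using convex_cone_add[OF fan_convex_cone[OF F assms(2)] x'(1)] ab assms(4) by blast
  ultimately have xb: "x + b \<in> \<eta> \<inter> \<eta>'" using e by auto
  have "cone_face (\<eta> \<inter> \<eta>') \<eta>"
    using assms by (intro fan_subset_face[OF F] fan_Int[OF F]) auto
  then have "x \<in> \<eta> \<inter> \<eta>'"
    using cone_face_summand[OF fan_convex_cone[OF F assms(1)] _ x \<open>b \<in> \<eta>\<close> xb] by blast
  then show "x \<in> \<eta>'" by blast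
qed

lemma quot_image_inj_on: "inj_on (\<lambda>\<eta>. q ` \<eta>) {\<eta> \<in> Cones F. \<sigma> \<subseteq> \<eta>}"
  using quot_image_subsetD by (intro inj_onI subset_antisym) auto

lemma star_fan_Cones: "Cones (star_fan F \<sigma>) = (\<lambda>\<eta>. q ` \<eta>) ` {\<eta> \<in> Cones F. \<sigma> \<subseteq> \<eta>}"
  unfolding star_fan_def by auto

lemma star_fan_wt:
  assumes "\<eta> \<in> Cones F" "\<sigma> \<subseteq> \<eta>" shows "wt (star_fan F \<sigma>) (q ` \<eta>) = wt F \<eta>"
  unfolding star_fan_def using the_inv_into_f_f[OF quot_image_inj_on, of \<eta>] assms by simp

lemma dim_star_cone:
  assumes "\<eta> \<in> Cones F" "\<sigma> \<subseteq> \<eta>" shows "dim (q ` \<eta>) + dim \<sigma> = dim \<eta>"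
  using assms by (intro dim_linear_image_kernel q_linear fan_fin_gen[OF F] q_zero) (auto intro: span_base)

lemma is_normal_vector_star:
  assumes c: "\<eta> \<in> Cones F" "\<tau> \<in> Cones F" "\<sigma> \<subseteq> \<tau>" "\<tau> \<subseteq> \<eta>"
    and n: "is_normal_vector (Lat F) \<eta> \<tau> n"
  shows "is_normal_vector (q ` Lat F) (q ` \<eta>) (q ` \<tau>) (q n)"
proof -
  have s: "\<sigma> \<subseteq> span \<eta>" "\<sigma> \<subseteq> span \<tau>" using c span_superset by blast+
  have "q ` sublat (Lat F) \<eta> = sublat (q ` Lat F) (q ` \<eta>)" "q ` sublat (Lat F) \<tau> = sublat (q ` Lat F) (q ` \<tau>)"
    unfolding sublat_def using quot_map_mem_span_iff s by blast+
  then show ?thesis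
    by (intro is_normal_vector_image[OF q_linear n]) (simp_all add: linear_span_image[OF q_linear])
qed

end

lemma star_fan_fdim:
  assumes F: "tropical_fan F" and \<sigma>: "\<sigma> \<in> Cones F"
  shows "fdim (star_fan F \<sigma>) + dim \<sigma> = fdim F"
proof -
  note R = tropical_rational_fan[OF F]
  let ?q = "quot_map (span \<sigma>)"
  have fin: "finite (dim ` Cones (star_fan F \<sigma>))"
    using fan_finite[OF R] by (simp add: star_fan_Cones[OF R \<sigma>])
  obtain \<eta> where \<eta>: "\<eta> \<in> cones_dim F (fdim F)" "\<sigma> \<subseteq> \<eta>"
    using tropical_facet_above[OF F \<sigma>] .
  have "fdim (star_fan F \<sigma>) = dim (?q ` \<eta>)"
    unfolding fdim_def
  proof (rule Max_eqI[OF fin])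
    show "dim (?q ` \<eta>) \<in> dim ` Cones (star_fan F \<sigma>)"
      using \<eta> unfolding star_fan_Cones[OF R \<sigma>] cones_dim_def by blast
    fix y assume "y \<in> dim ` Cones (star_fan F \<sigma>)"
    then obtain \<xi> where \<xi>: "\<xi> \<in> Cones F" "\<sigma> \<subseteq> \<xi>" "y = dim (?q ` \<xi>)"
      unfolding star_fan_Cones[OF R \<sigma>] by blast
    have "dim (?q ` \<xi>) + dim \<sigma> = dim \<xi>" "dim (?q ` \<eta>) + dim \<sigma> = dim \<eta>"
      using dim_star_cone[OF R \<sigma>] \<xi> \<eta> unfolding cones_dim_def by auto
    then show "y \<le> dim (?q ` \<eta>)"
      using \<xi> \<eta> fan_dim_le[OF R \<xi>(1)] unfolding cones_dim_def by simp
  qed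
  then show ?thesis
    using dim_star_cone[OF R \<sigma>, of \<eta>] \<eta> unfolding cones_dim_def by simp
qed

lemma top_star_star_fan:
  assumes F: "tropical_fan F" and c: "\<sigma> \<in> Cones F" "\<tau> \<in> Cones F" "\<sigma> \<subseteq> \<tau>"
  shows "top_star (star_fan F \<sigma>) (quot_map (span \<sigma>) ` \<tau>) = (\<lambda>\<eta>. quot_map (span \<sigma>) ` \<eta>) ` top_star F \<tau>"
proof -
  note R = tropical_rational_fan[OF F]
  let ?q = "quot_map (span \<sigma>)"
  have "dim (?q ` \<eta>) = fdim (star_fan F \<sigma>) \<longleftrightarrow> dim \<eta> = fdim F" if "\<eta> \<in> Cones F" "\<sigma> \<subseteq> \<eta>" for \<eta>
    using star_fan_fdim[OF F c(1)] dim_star_cone[OF R c(1) that] by linarith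
  moreover have "?q ` \<tau> \<subseteq> ?q ` \<eta> \<longleftrightarrow> \<tau> \<subseteq> \<eta>" if \<eta>: "\<eta> \<in> Cones F" "\<sigma> \<subseteq> \<eta>" for \<eta>
    using quot_image_subsetD[OF R c(1,2) \<eta>(1) c(3) \<eta>(2)] by blast
  ultimately show ?thesis
    unfolding top_star_def cones_dim_def star_fan_Cones[OF R c(1)] using c(3) by auto
qed


context
  fixes F :: "'a::real_vector wfan" and \<tau> :: "'a set"
  assumes F: "tropical_fan F" and \<tau>: "\<tau> \<in> codim1 F"
begin

private abbreviation "qt \<equiv> quot_map (span \<tau>)"
private abbreviation "nv \<equiv> \<lambda>\<eta>. normal_vector (Lat F) \<eta> \<tau>"

private lemma fan_F: "rational_fan F" using F by (rule tropical_rational_fan)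
private lemma \<tau>C: "\<tau> \<in> Cones F" using codim1D \<tau> by blast
private lemma ql: "linear qt" by (rule quot_map(1)) simp
private lemma q0: "qt x = 0 \<longleftrightarrow> x \<in> span \<tau>" by (rule quot_map(2)) simp

private lemma image_tau: "qt ` \<tau> = {0}"
proof -
  have "qt x = 0" if "x \<in> \<tau>" for x using that q0 span_base by blast
  then show ?thesis using fan_zero[OF fan_F \<tau>C] by force
qed

private lemma top_star_inj: "inj_on (\<lambda>\<eta>. qt ` \<eta>) (top_star F \<tau>)"
  by (rule inj_on_subset[OF quot_image_inj_on[OF fan_F \<tau>C]]) (auto dest: top_starD)

private lemma star_dim1: "cones_dim (star_fan F \<tau>) 1 = (\<lambda>\<eta>. qt ` \<eta>) ` top_star F \<tau>"
proof -
  have "dim (qt ` \<eta>) = 1 \<longleftrightarrow> dim \<eta> = fdim F" if "\<eta> \<in> Cones F" "\<tau> \<subseteq> \<eta>" for \<eta>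
    using dim_star_cone[OF fan_F \<tau>C that] codim1D(2)[OF \<tau>] by linarith
  then show ?thesis
    unfolding cones_dim_def top_star_def star_fan_Cones[OF fan_F \<tau>C] by auto
qed

private lemma star_dim0:
  assumes "\<kappa> \<in> Cones (star_fan F \<tau>)" "dim \<kappa> + 1 = 1"
  shows "\<kappa> = {0}"
proof -
  obtain \<eta> where \<eta>: "\<eta> \<in> Cones F" "\<tau> \<subseteq> \<eta>" "\<kappa> = qt ` \<eta>"
    using assms(1) unfolding star_fan_Cones[OF fan_F \<tau>C] by blast
  then have "dim \<eta> = dim \<tau>" using dim_star_cone[OF fan_F \<tau>C \<eta>(1,2)] assms(2) by simp
  then have "\<tau> = \<eta>" using fan_cone_eqI[OF fan_F \<eta>(1) \<tau>C \<eta>(2)] by simp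
  then show ?thesis using \<eta>(3) image_tau by simp
qed

private lemma star_zero: "{0} \<in> Cones (star_fan F \<tau>)" "dim {0::'a} + 1 = 1"
proof -
  show "{0} \<in> Cones (star_fan F \<tau>)"
    unfolding star_fan_Cones[OF fan_F \<tau>C] using \<tau>C image_tau by blast
  show "dim {0::'a} + 1 = 1"
    using dim_star_cone[OF fan_F \<tau>C \<tau>C] image_tau by simp
qed

private lemma star_normal_vector:
  assumes \<eta>: "\<eta> \<in> top_star F \<tau>"
  shows "normal_vector (Lat (star_fan F \<tau>)) (qt ` \<eta>) {0} = qt (nv \<eta>)"
proof -
  note \<eta>' = top_starD[OF \<eta>]
  have n: "is_normal_vector (Lat F) \<eta> \<tau> (nv \<eta>)"
    using normal_vector_top_star[OF fan_F \<tau> \<eta>] .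
  have L: "Lat (star_fan F \<tau>) = qt ` Lat F" unfolding star_fan_def by simp
  have N: "is_normal_vector (qt ` Lat F) (qt ` \<eta>) {0} (qt (nv \<eta>))"
    using is_normal_vector_star[OF fan_F \<tau>C \<eta>'(1) \<tau>C order_refl \<eta>'(3) n] unfolding image_tau .
  have N': "is_normal_vector (qt ` Lat F) (qt ` \<eta>) {0} (normal_vector (qt ` Lat F) (qt ` \<eta>) {0})"
    unfolding normal_vector_def by (rule someI) (rule N)
  have "normal_vector (qt ` Lat F) (qt ` \<eta>) {0} - qt (nv \<eta>) \<in> span {0}"
  proof (rule is_normal_vector_unique[OF _ _ N' N])
    have "nv \<eta> \<notin> span \<tau>"
      using fan_normal_vector_notin_span[OF fan_F \<eta>'(1) \<tau>C _ n] \<eta>' codim1D[OF \<tau>] by simp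
    then have "qt (nv \<eta>) \<noteq> 0" using q0 by blast
    moreover have "qt (nv \<eta>) \<in> sublat (qt ` Lat F) (qt ` \<eta>)"
      using N unfolding is_normal_vector_def by blast
    ultimately show "\<not> sublat (qt ` Lat F) (qt ` \<eta>) \<subseteq> span {0}" by auto
    fix x y assume xy: "x \<in> qt ` \<eta>" "y \<in> qt ` \<eta>" "x + y \<in> span {0}"
    then obtain a b where ab: "a \<in> \<eta>" "b \<in> \<eta>" "x = qt a" "y = qt b" by blast
    then have "qt (a + b) = 0" using xy(3) ql by (simp add: linear_add)
    then have "a + b \<in> span \<tau>" using q0 by blast
    then have "a + b \<in> \<tau>"
      using fan_span_Int[OF fan_F \<eta>'(1) \<tau>C \<eta>'(3)] convex_cone_add[OF fan_convex_cone[OF fan_F \<eta>'(1)]] ab by blast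
    then have "a \<in> \<tau>"
      using cone_face_summand[OF fan_convex_cone[OF fan_F \<eta>'(1)] fan_subset_face[OF fan_F \<eta>'(1) \<tau>C \<eta>'(3)]] ab by blast
    then have "x = 0" using q0 ab(3) by (simp add: span_base)
    then show "x \<in> span {0}" by simp
  qed
  then show ?thesis unfolding L by simp
qed

lemma MW_star_iff:
  "w \<in> MW (star_fan F \<tau>) 1 K \<longleftrightarrow> w \<in> (\<lambda>\<eta>. qt ` \<eta>) ` top_star F \<tau> \<rightarrow>\<^sub>E K \<and>
     (\<Sum>\<eta>\<in>top_star F \<tau>. w (qt ` \<eta>) *\<^sub>R nv \<eta>) \<in> span \<tau>"
proof -
  let ?S = "star_fan F \<tau>" and ?r = "quot_map (span {0}) :: 'a \<Rightarrow> 'a"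
  have r: "linear ?r" "?r x = 0 \<longleftrightarrow> x = 0" for x
    by (rule quot_map(1)[OF subspace_span], subst quot_map(2)[OF subspace_span], simp)
  define P where "P \<kappa> \<longleftrightarrow>
     (\<Sum>\<sigma> | \<sigma> \<in> cones_dim ?S 1 \<and> \<kappa> \<subseteq> \<sigma>. w \<sigma> *\<^sub>R quot_map (span \<kappa>) (normal_vector (Lat ?S) \<sigma> \<kappa>)) = 0" for \<kappa>
  have all: "(\<forall>\<kappa>\<in>Cones ?S. dim \<kappa> + 1 = 1 \<longrightarrow> P \<kappa>) \<longleftrightarrow> P {0}"
    using star_dim0 star_zero by blast
  have "P {0} \<longleftrightarrow> (\<Sum>\<sigma> | \<sigma> \<in> cones_dim ?S 1 \<and> {0} \<subseteq> \<sigma>. w \<sigma> *\<^sub>R ?r (normal_vector (Lat ?S) \<sigma> {0})) = 0"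
    unfolding P_def ..
  also have "{\<sigma>. \<sigma> \<in> cones_dim ?S 1 \<and> {0} \<subseteq> \<sigma>} = (\<lambda>\<eta>. qt ` \<eta>) ` top_star F \<tau>"
  proof -
    have "0 \<in> qt ` \<eta>" if "\<eta> \<in> top_star F \<tau>" for \<eta>
      using fan_zero[OF fan_F top_starD(1)[OF that]] linear_0[OF ql] by (metis imageI)
    then show ?thesis unfolding star_dim1 by blast
  qed
  also have "(\<Sum>\<sigma>\<in>(\<lambda>\<eta>. qt ` \<eta>) ` top_star F \<tau>. w \<sigma> *\<^sub>R ?r (normal_vector (Lat ?S) \<sigma> {0})) =
    (\<Sum>\<eta>\<in>top_star F \<tau>. w (qt ` \<eta>) *\<^sub>R ?r (qt (nv \<eta>)))"
    by (simp add: sum.reindex[OF top_star_inj] star_normal_vector cong: sum.cong)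
  also have "\<dots> = ?r (qt (\<Sum>\<eta>\<in>top_star F \<tau>. w (qt ` \<eta>) *\<^sub>R nv \<eta>))"
    by (simp only: linear_sum[OF r(1)] linear_sum[OF ql] linear_scale[OF r(1)] linear_scale[OF ql])
  also have "\<dots> = 0 \<longleftrightarrow> (\<Sum>\<eta>\<in>top_star F \<tau>. w (qt ` \<eta>) *\<^sub>R nv \<eta>) \<in> span \<tau>"
    using r(2) q0 by simp
  finally have "(\<forall>\<kappa>\<in>Cones ?S. dim \<kappa> + 1 = 1 \<longrightarrow> P \<kappa>) \<longleftrightarrow>
      (\<Sum>\<eta>\<in>top_star F \<tau>. w (qt ` \<eta>) *\<^sub>R nv \<eta>) \<in> span \<tau>"
    unfolding all .
  then show ?thesis
    unfolding MW_def P_def mem_Collect_eq star_dim1[symmetric] by blast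
qed

lemma normal_at_iff_MW_star:
  assumes K: "\<And>k z. k \<in> K \<Longrightarrow> z \<in> \<int> \<Longrightarrow> k * z \<in> K"
  shows "normal_at K F \<tau> \<longleftrightarrow> MW (star_fan F \<tau>) 1 K =
       {restrict (\<lambda>\<sigma>. k * wt (star_fan F \<tau>) \<sigma>) (cones_dim (star_fan F \<tau>) 1) | k. k \<in> K}"
proof
  have wtq: "wt (star_fan F \<tau>) (qt ` \<eta>) = wt F \<eta>" if "\<eta> \<in> top_star F \<tau>" for \<eta>
    using star_fan_wt[OF fan_F \<tau>C] top_starD[OF that] by blast
  note nv = normal_vector_top_star[OF fan_F \<tau>]
  let ?M = "{restrict (\<lambda>\<sigma>. k * wt (star_fan F \<tau>) \<sigma>) (cones_dim (star_fan F \<tau>) 1) | k. k \<in> K}"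
  {
    assume na: "normal_at K F \<tau>"
    show "MW (star_fan F \<tau>) 1 K = ?M"
    proof
      show "MW (star_fan F \<tau>) 1 K \<subseteq> ?M"
      proof
        fix w assume "w \<in> MW (star_fan F \<tau>) 1 K"
        then have w: "w \<in> (\<lambda>\<eta>. qt ` \<eta>) ` top_star F \<tau> \<rightarrow>\<^sub>E K"
          "(\<Sum>\<eta>\<in>top_star F \<tau>. w (qt ` \<eta>) *\<^sub>R nv \<eta>) \<in> span \<tau>"
          unfolding MW_star_iff by auto
        have wK: "w (qt ` \<eta>) \<in> K" if "\<eta> \<in> top_star F \<tau>" for \<eta>
          using w(1) that by (intro PiE_mem[OF w(1)]) blast
        obtain k where k: "k \<in> K" "\<And>\<eta>. \<eta> \<in> top_star F \<tau> \<Longrightarrow> w (qt ` \<eta>) = k * wt F \<eta>"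
          using normal_atD[OF na wK nv w(2)] by blast
        have "w = restrict (\<lambda>\<sigma>. k * wt (star_fan F \<tau>) \<sigma>) (cones_dim (star_fan F \<tau>) 1)"
        proof
          fix \<kappa>
          show "w \<kappa> = restrict (\<lambda>\<sigma>. k * wt (star_fan F \<tau>) \<sigma>) (cones_dim (star_fan F \<tau>) 1) \<kappa>"
          proof (cases "\<kappa> \<in> (\<lambda>\<eta>. qt ` \<eta>) ` top_star F \<tau>")
            case True
            then show ?thesis unfolding star_dim1 using k(2) wtq by auto
          next
            case False
            then show ?thesis unfolding star_dim1 using PiE_arb[OF w(1)] by auto
          qed
        qed
        then show "w \<in> ?M" using k(1) by blast
      qed
      show "?M \<subseteq> MW (star_fan F \<tau>) 1 K"
      proof
        fix w assume "w \<in> ?M"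
        then obtain k where k: "k \<in> K"
          and w: "w = restrict (\<lambda>\<sigma>. k * wt (star_fan F \<tau>) \<sigma>) ((\<lambda>\<eta>. qt ` \<eta>) ` top_star F \<tau>)"
          unfolding star_dim1 by blast
        have wq: "w (qt ` \<eta>) = k * wt F \<eta>" if "\<eta> \<in> top_star F \<tau>" for \<eta>
          using that wtq unfolding w by simp
        have "w \<in> (\<lambda>\<eta>. qt ` \<eta>) ` top_star F \<tau> \<rightarrow>\<^sub>E K"
        proof (rule PiE_I)
          fix \<kappa> assume "\<kappa> \<in> (\<lambda>\<eta>. qt ` \<eta>) ` top_star F \<tau>"
          then obtain \<eta> where \<eta>: "\<eta> \<in> top_star F \<tau>" "\<kappa> = qt ` \<eta>" by blast
          show "w \<kappa> \<in> K"
            unfolding \<eta>(2) wq[OF \<eta>(1)]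
            by (rule K[OF k tropical_wt_Ints(1)[OF F top_starD(4)[OF \<eta>(1)]]])
        next
          fix \<kappa> assume "\<kappa> \<notin> (\<lambda>\<eta>. qt ` \<eta>) ` top_star F \<tau>"
          then show "w \<kappa> = undefined" unfolding w by (simp only: restrict_def if_False)
        qed
        moreover have "(\<Sum>\<eta>\<in>top_star F \<tau>. w (qt ` \<eta>) *\<^sub>R nv \<eta>) = k *\<^sub>R (\<Sum>\<eta>\<in>top_star F \<tau>. wt F \<eta> *\<^sub>R nv \<eta>)"
          unfolding scaleR_sum_right by (rule sum.cong) (auto simp: wq)
        then have "(\<Sum>\<eta>\<in>top_star F \<tau>. w (qt ` \<eta>) *\<^sub>R nv \<eta>) \<in> span \<tau>"
          using tropical_balanced[OF F \<tau> nv] by (simp add: span_scale)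
        ultimately show "w \<in> MW (star_fan F \<tau>) 1 K" unfolding MW_star_iff by blast
      qed
    qed
  next
    assume M: "MW (star_fan F \<tau>) 1 K = ?M"
    show "normal_at K F \<tau>"
    proof (rule normal_atI)
      fix w n
      assume wK: "\<And>\<eta>. \<eta> \<in> top_star F \<tau> \<Longrightarrow> w \<eta> \<in> K"
        and n: "\<And>\<eta>. \<eta> \<in> top_star F \<tau> \<Longrightarrow> is_normal_vector (Lat F) \<eta> \<tau> (n \<eta>)"
        and s: "(\<Sum>\<eta>\<in>top_star F \<tau>. w \<eta> *\<^sub>R n \<eta>) \<in> span \<tau>"
      define w' where "w' = restrict (\<lambda>\<kappa>. w (the_inv_into (top_star F \<tau>) (\<lambda>\<eta>. qt ` \<eta>) \<kappa>)) ((\<lambda>\<eta>. qt ` \<eta>) ` top_star F \<tau>)"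
      have w': "w' (qt ` \<eta>) = w \<eta>" if "\<eta> \<in> top_star F \<tau>" for \<eta>
        unfolding w'_def using that the_inv_into_f_f[OF top_star_inj that] by simp
      have "(\<Sum>\<eta>\<in>top_star F \<tau>. w \<eta> *\<^sub>R nv \<eta>) \<in> span \<tau>"
        using s top_star_sum_in_span[OF fan_F \<tau> n nv] by blast
      also have "(\<Sum>\<eta>\<in>top_star F \<tau>. w \<eta> *\<^sub>R nv \<eta>) = (\<Sum>\<eta>\<in>top_star F \<tau>. w' (qt ` \<eta>) *\<^sub>R nv \<eta>)"
        by (rule sum.cong) (auto simp: w')
      finally have "w' \<in> MW (star_fan F \<tau>) 1 K"
        unfolding MW_star_iff using w' wK by (auto simp: w'_def)
      then obtain k where k: "k \<in> K" "w' = restrict (\<lambda>\<sigma>. k * wt (star_fan F \<tau>) \<sigma>) (cones_dim (star_fan F \<tau>) 1)"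
        using M by blast
      have "w \<eta> = k * wt F \<eta>" if \<eta>: "\<eta> \<in> top_star F \<tau>" for \<eta>
        using w'[OF \<eta>] k(2) wtq[OF \<eta>] \<eta> unfolding star_dim1 by simp
      then show "\<exists>k\<in>K. \<forall>\<eta>\<in>top_star F \<tau>. w \<eta> = k * wt F \<eta>" using k(1) by blast
    qed
  }
qed

end

lemma normal_over_iff:
  assumes "tropical_fan F" "\<And>k z. k \<in> K \<Longrightarrow> z \<in> \<int> \<Longrightarrow> k * z \<in> K"
  shows "normal_over K F \<longleftrightarrow> (\<forall>\<tau>\<in>codim1 F. normal_at K F \<tau>)"
  unfolding normal_over_def using normal_at_iff_MW_star[OF assms(1) _ assms(2)] by blast

lemma normal_at_of_star_fan:
  assumes F: "tropical_fan F" and c: "\<sigma> \<in> Cones F" "\<tau> \<in> codim1 F" "\<sigma> \<subseteq> \<tau>" and K0: "0 \<in> K"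
    and na: "normal_at K (star_fan F \<sigma>) (quot_map (span \<sigma>) ` \<tau>)"
  shows "normal_at K F \<tau>"
proof -
  let ?q = "quot_map (span \<sigma>)"
  note R = tropical_rational_fan[OF F]
  note \<tau> = codim1D(1)[OF c(2)]
  have ql: "linear ?q" by (rule quot_map(1)) simp
  note ts = top_star_star_fan[OF F c(1) \<tau> c(3)]
  have L: "Lat (star_fan F \<sigma>) = ?q ` Lat F" unfolding star_fan_def by simp
  show ?thesis
  proof (rule normal_at_transfer[OF na _ K0, where \<gamma> = "\<lambda>\<eta>. ?q ` \<eta>" and p = ?q and c = 1])
    show "finite (top_star (star_fan F \<sigma>) (?q ` \<tau>))"
      unfolding ts using finite_top_star[OF fan_finite(1)[OF R]] by blast
    show "inj_on (\<lambda>\<eta>. ?q ` \<eta>) (top_star F \<tau>)"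
      using c(3) by (intro inj_on_subset[OF quot_image_inj_on[OF R c(1)]]) (auto dest: top_starD)
    show "is_normal_vector (Lat (star_fan F \<sigma>)) (?q ` \<eta>) (?q ` \<tau>) (?q n)"
      if "\<eta> \<in> top_star F \<tau>" "is_normal_vector (Lat F) \<eta> \<tau> n" for \<eta> n
      unfolding L
      using is_normal_vector_star[OF R c(1) top_starD(1)[OF that(1)] \<tau> c(3) top_starD(3)[OF that(1)] that(2)] .
    show "wt F \<eta> = 1 * wt (star_fan F \<sigma>) (?q ` \<eta>)" if "\<eta> \<in> top_star F \<tau>" for \<eta>
      using star_fan_wt[OF R c(1)] top_starD[OF that] c(3) by force
  qed (use ts ql in \<open>auto intro: span_base\<close>)
qed


section \<open>Isomorphisms\<close>

context
  fixes F :: "'a::real_vector wfan" and G :: "'b::real_vector wfan" and \<phi> :: "'a \<Rightarrow> 'b"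
  assumes G: "rational_fan G"
    and lin: "linear \<phi>" and inj: "inj_on \<phi> (span (support F))"
    and lat: "\<phi> ` sublat (Lat F) (support F) = sublat (Lat G) (support G)"
    and cones: "(\<lambda>\<sigma>. \<phi> ` \<sigma>) ` Cones F = Cones G"
    and wts: "\<forall>\<sigma>\<in>cones_dim F (fdim F). wt G (\<phi> ` \<sigma>) = wt F \<sigma>"
begin

lemma iso_span_subset: "\<sigma> \<in> Cones F \<Longrightarrow> span \<sigma> \<subseteq> span (support F)"
  unfolding support_def by (intro span_mono) blast

lemma iso_subset: "\<sigma> \<in> Cones F \<Longrightarrow> \<sigma> \<subseteq> span (support F)"
  using iso_span_subset span_superset by blast

lemma iso_support: "support G = \<phi> ` support F"
  unfolding support_def cones[symmetric] by blast

lemma iso_image_subset_iff: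
  assumes "\<sigma> \<in> Cones F" "\<tau> \<in> Cones F" shows "\<phi> ` \<tau> \<subseteq> \<phi> ` \<sigma> \<longleftrightarrow> \<tau> \<subseteq> \<sigma>"
  using inj_on_image_subset_iff[OF inj] iso_subset assms by blast

lemma iso_dim:
  assumes "\<sigma> \<in> Cones F" shows "dim (\<phi> ` \<sigma>) = dim \<sigma>"
proof -
  obtain g where g: "linear g" "\<forall>v\<in>span (support F). g (\<phi> v) = v"
    using linear_exists_left_inverse_on[OF lin subspace_span inj] by blast
  have "g ` \<phi> ` \<sigma> = \<sigma>"
    using g(2) iso_subset[OF assms] by (force simp: image_image)
  moreover have "fin_gen (\<phi> ` \<sigma>)" using fan_fin_gen[OF G] cones assms by blast
  ultimately have "fin_gen \<sigma>" using fin_gen_linear_image[OF g(1)] by metis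
  then show ?thesis
    using inj_on_subset[OF inj iso_span_subset[OF assms]] by (intro dim_inj_image_fin_gen[OF lin])
qed

lemma iso_fdim: "fdim G = fdim F"
proof -
  have "dim ` Cones G = dim ` Cones F"
    unfolding cones[symmetric] image_image using iso_dim by simp
  then show ?thesis unfolding fdim_def by simp
qed

lemma iso_cones_dim: "cones_dim G k = (\<lambda>\<sigma>. \<phi> ` \<sigma>) ` cones_dim F k"
  unfolding cones_dim_def cones[symmetric] using iso_dim by auto

lemma iso_top_star:
  assumes "\<tau> \<in> Cones F" shows "top_star G (\<phi> ` \<tau>) = (\<lambda>\<eta>. \<phi> ` \<eta>) ` top_star F \<tau>"
  unfolding top_star_def iso_fdim iso_cones_dim
  using iso_image_subset_iff[OF _ assms] unfolding cones_dim_def by auto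

lemma iso_sublat:
  assumes "\<sigma> \<in> Cones F" shows "sublat (Lat G) (\<phi> ` \<sigma>) = \<phi> ` sublat (Lat F) \<sigma>"
proof
  have sp: "span (\<phi> ` \<sigma>) = \<phi> ` span \<sigma>" "span (support G) = \<phi> ` span (support F)"
    unfolding iso_support by (simp_all add: linear_span_image[OF lin])
  show "sublat (Lat G) (\<phi> ` \<sigma>) \<subseteq> \<phi> ` sublat (Lat F) \<sigma>"
  proof
    fix z assume "z \<in> sublat (Lat G) (\<phi> ` \<sigma>)"
    then obtain y where y: "z \<in> Lat G" "z = \<phi> y" "y \<in> span \<sigma>"
      unfolding sublat_def sp by blast
    then have "z \<in> sublat (Lat G) (support G)"
      unfolding sublat_def sp using iso_span_subset[OF assms] by blast
    then obtain x where x: "z = \<phi> x" "x \<in> Lat F" "x \<in> span (support F)"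
      using lat unfolding sublat_def by blast
    then have "x = y"
      using inj_onD[OF inj] y iso_span_subset[OF assms] by blast
    then show "z \<in> \<phi> ` sublat (Lat F) \<sigma>" unfolding sublat_def using x y by blast
  qed
  show "\<phi> ` sublat (Lat F) \<sigma> \<subseteq> sublat (Lat G) (\<phi> ` \<sigma>)"
  proof
    fix z assume "z \<in> \<phi> ` sublat (Lat F) \<sigma>"
    then obtain x where x: "z = \<phi> x" "x \<in> Lat F" "x \<in> span \<sigma>" unfolding sublat_def by blast
    then have "z \<in> sublat (Lat G) (support G)"
      using lat iso_span_subset[OF assms] unfolding sublat_def by blast
    then show "z \<in> sublat (Lat G) (\<phi> ` \<sigma>)" unfolding sublat_def sp using x by blast
  qed
qed

lemma iso_normal_vector:
  assumes c: "\<eta> \<in> Cones F" "\<tau> \<in> Cones F"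
    and n: "is_normal_vector (Lat G) (\<phi> ` \<eta>) (\<phi> ` \<tau>) n"
    and g: "linear g" "\<And>v. v \<in> span (support F) \<Longrightarrow> g (\<phi> v) = v"
  shows "is_normal_vector (Lat F) \<eta> \<tau> (g n)"
proof -
  have inv: "g ` \<phi> ` S = S" if "S \<subseteq> span (support F)" for S
    using g(2) that by (force simp: image_image)
  have sub: "sublat (Lat F) \<sigma> \<subseteq> span (support F)" if "\<sigma> \<in> Cones F" for \<sigma>
    unfolding sublat_def using iso_span_subset[OF that] by blast
  show ?thesis
    using inv[OF iso_subset[OF c(1)]] inv[OF iso_span_subset[OF c(2)]] inv[OF sub[OF c(1)]] inv[OF sub[OF c(2)]]
    by (intro is_normal_vector_image[OF g(1) n]) (simp_all add: iso_sublat c linear_span_image[OF lin])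
qed

lemma iso_normal_at:
  assumes \<tau>: "\<tau> \<in> Cones F" and na: "normal_at K F \<tau>" and K0: "0 \<in> K"
  shows "normal_at K G (\<phi> ` \<tau>)"
proof -
  obtain g where g: "linear g" "\<And>v. v \<in> span (support F) \<Longrightarrow> g (\<phi> v) = v"
    using linear_exists_left_inverse_on[OF lin subspace_span inj] by blast
  have g\<phi>: "g ` \<phi> ` \<sigma> = \<sigma>" if "\<sigma> \<in> Cones F" for \<sigma>
    using g(2) iso_subset[OF that] by (force simp: image_image)
  note ts = iso_top_star[OF \<tau>]
  have gts: "(\<lambda>\<eta>. g ` \<eta>) ` top_star G (\<phi> ` \<tau>) = top_star F \<tau>"
  proof -
    have "((\<lambda>\<eta>. g ` \<eta>) \<circ> (\<lambda>\<eta>. \<phi> ` \<eta>)) ` top_star F \<tau> = id ` top_star F \<tau>"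
      by (rule image_cong) (simp_all only: g\<phi> top_starD comp_apply id_apply)
    then show ?thesis unfolding ts image_comp by simp
  qed
  show ?thesis
  proof (rule normal_at_transfer[OF na _ K0, where \<gamma> = "\<lambda>\<eta>. g ` \<eta>" and p = g and c = 1])
    show "finite (top_star F \<tau>)"
      unfolding gts[symmetric] using finite_top_star[OF fan_finite(1)[OF G]] by blast
    show "inj_on (\<lambda>\<eta>. g ` \<eta>) (top_star G (\<phi> ` \<tau>))"
      unfolding ts using g\<phi> by (auto intro!: inj_onI dest!: top_starD(1))
    show "g ` \<phi> ` \<tau> \<subseteq> span \<tau>" using g\<phi>[OF \<tau>] span_superset by blast
    fix \<xi> assume "\<xi> \<in> top_star G (\<phi> ` \<tau>)"
    then obtain \<eta> where \<eta>: "\<xi> = \<phi> ` \<eta>" "\<eta> \<in> top_star F \<tau>" unfolding ts by blast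
    note g\<eta> = g\<phi>[OF top_starD(1)[OF \<eta>(2)]]
    show "is_normal_vector (Lat F) (g ` \<xi>) \<tau> (g n)" if "is_normal_vector (Lat G) \<xi> (\<phi> ` \<tau>) n" for n
      using iso_normal_vector[OF top_starD(1)[OF \<eta>(2)] \<tau> _ g] that
      unfolding \<eta>(1) g\<eta> by blast
    show "wt G \<xi> = 1 * wt F (g ` \<xi>)"
      unfolding \<eta>(1) g\<eta> using wts top_starD(4)[OF \<eta>(2)] by simp
  qed (use gts g(1) in auto)
qed

end

lemma normal_at_fan_iso:
  assumes iso: "fan_iso F G" and G: "rational_fan G" and na: "\<forall>\<tau>\<in>codim1 F. normal_at K F \<tau>" and K0: "0 \<in> K"
  shows "\<forall>\<tau>\<in>codim1 G. normal_at K G \<tau>"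
proof
  obtain \<phi> where \<phi>: "linear \<phi>" "inj_on \<phi> (span (support F))"
    "\<phi> ` sublat (Lat F) (support F) = sublat (Lat G) (support G)"
    "(\<lambda>\<sigma>. \<phi> ` \<sigma>) ` Cones F = Cones G" "\<forall>\<sigma>\<in>cones_dim F (fdim F). wt G (\<phi> ` \<sigma>) = wt F \<sigma>"
    using iso unfolding fan_iso_def by blast
  fix \<tau> assume \<tau>: "\<tau> \<in> codim1 G"
  then obtain \<sigma> where \<sigma>: "\<tau> = \<phi> ` \<sigma>" "\<sigma> \<in> Cones F"
    using \<phi>(4) unfolding codim1_def by blast
  then have "\<sigma> \<in> codim1 F"
    using \<tau> iso_dim[OF G \<phi> \<sigma>(2)] iso_fdim[OF G \<phi>] unfolding codim1_def by simp
  then show "normal_at K G \<tau>"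
    unfolding \<sigma>(1) using iso_normal_at[OF G \<phi> \<sigma>(2) _ K0] na by blast
qed

lemma fan_iso_wt:
  assumes iso: "fan_iso F G" and G: "rational_fan G" and \<eta>: "\<eta> \<in> cones_dim G (fdim G)"
  obtains \<xi> where "\<xi> \<in> cones_dim F (fdim F)" "wt G \<eta> = wt F \<xi>"
proof -
  obtain \<phi> where \<phi>: "linear \<phi>" "inj_on \<phi> (span (support F))"
    "\<phi> ` sublat (Lat F) (support F) = sublat (Lat G) (support G)"
    "(\<lambda>\<sigma>. \<phi> ` \<sigma>) ` Cones F = Cones G" "\<forall>\<sigma>\<in>cones_dim F (fdim F). wt G (\<phi> ` \<sigma>) = wt F \<sigma>"
    using iso unfolding fan_iso_def by blast
  show thesis
    using \<eta> that \<phi>(5) unfolding iso_fdim[OF G \<phi>] iso_cones_dim[OF G \<phi>] by blast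
qed


section \<open>Products\<close>

lemma sublat_Times:
  assumes "0 \<in> S" "0 \<in> T" shows "sublat (M \<times> N) (S \<times> T) = sublat M S \<times> sublat N T"
  unfolding sublat_def span_Times_0[OF assms] by blast

lemma is_normal_vector_fst:
  assumes 0: "0 \<in> \<sigma>" "0 \<in> \<tau>" "0 \<in> \<eta>" "0 \<in> N"
    and n: "is_normal_vector (M \<times> N) (\<sigma> \<times> \<eta>) (\<tau> \<times> \<eta>) n"
  shows "is_normal_vector M \<sigma> \<tau> (fst n)"
proof (rule is_normal_vector_image[OF linear_fst n])
  have "0 \<in> sublat N \<eta>" unfolding sublat_def using 0 span_zero by blast
  then show "fst ` sublat (M \<times> N) (\<sigma> \<times> \<eta>) = sublat M \<sigma>" "fst ` sublat (M \<times> N) (\<tau> \<times> \<eta>) = sublat M \<tau>"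
    unfolding sublat_Times[OF 0(1,3)] sublat_Times[OF 0(2,3)] by force+
qed (auto simp: span_Times_0[OF 0(2,3)])

lemma is_normal_vector_snd:
  assumes 0: "0 \<in> \<sigma>" "0 \<in> \<tau>" "0 \<in> \<eta>" "0 \<in> N"
    and n: "is_normal_vector (N \<times> M) (\<eta> \<times> \<sigma>) (\<eta> \<times> \<tau>) n"
  shows "is_normal_vector M \<sigma> \<tau> (snd n)"
proof (rule is_normal_vector_image[OF linear_snd n])
  have "0 \<in> sublat N \<eta>" unfolding sublat_def using 0 span_zero by blast
  then show "snd ` sublat (N \<times> M) (\<eta> \<times> \<sigma>) = sublat M \<sigma>" "snd ` sublat (N \<times> M) (\<eta> \<times> \<tau>) = sublat M \<tau>"
    unfolding sublat_Times[OF 0(3,1)] sublat_Times[OF 0(3,2)] by force+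
qed (auto simp: span_Times_0[OF 0(3,2)])

context
  fixes F :: "'a::real_vector wfan" and F' :: "'b::real_vector wfan"
  assumes F: "tropical_fan F" and F': "tropical_fan F'"
begin

private lemma RF: "rational_fan F" "rational_fan F'"
  using F F' tropical_rational_fan by blast+

private lemma dim_cone_Times:
  assumes "\<sigma> \<in> Cones F" "\<sigma>' \<in> Cones F'" shows "dim (\<sigma> \<times> \<sigma>') = dim \<sigma> + dim \<sigma>'"
  using assms fan_fin_gen[OF RF(1)] fan_fin_gen[OF RF(2)] fan_zero[OF RF(1)] fan_zero[OF RF(2)]
  by (intro dim_Times_fin_gen)

private lemma Cones_prod: "Cones (prod_fan F F') = (\<lambda>(\<sigma>, \<sigma>'). \<sigma> \<times> \<sigma>') ` (Cones F \<times> Cones F')"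
  unfolding prod_fan_def by auto

private lemma Times_subset:
  assumes "\<sigma> \<in> Cones F" "\<sigma>' \<in> Cones F'" "\<sigma> \<times> \<sigma>' \<subseteq> \<tau> \<times> \<tau>'" shows "\<sigma> \<subseteq> \<tau>" "\<sigma>' \<subseteq> \<tau>'"
  using fan_zero[OF RF(1) assms(1)] fan_zero[OF RF(2) assms(2)] assms(3) by blast+

private lemma fdim_prod: "fdim (prod_fan F F') = fdim F + fdim F'"
proof -
  obtain \<eta> \<eta>' where \<eta>: "\<eta> \<in> cones_dim F (fdim F)" "\<eta>' \<in> cones_dim F' (fdim F')"
    using tropical_facet_above[OF F] tropical_facet_above[OF F'] fan_finite(2)[OF RF(1)] fan_finite(2)[OF RF(2)]
    by (metis ex_in_conv)
  show ?thesis
    unfolding fdim_def[of "prod_fan F F'"]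
  proof (rule Max_eqI)
    show "finite (dim ` Cones (prod_fan F F'))"
      unfolding Cones_prod using fan_finite(1)[OF RF(1)] fan_finite(1)[OF RF(2)] by blast
    have "\<eta> \<times> \<eta>' \<in> Cones (prod_fan F F')"
      unfolding Cones_prod using \<eta> unfolding cones_dim_def by auto
    moreover have "dim (\<eta> \<times> \<eta>') = fdim F + fdim F'"
      using \<eta> dim_cone_Times unfolding cones_dim_def by auto
    ultimately show "fdim F + fdim F' \<in> dim ` Cones (prod_fan F F')" by (metis imageI)
    fix y assume "y \<in> dim ` Cones (prod_fan F F')"
    then obtain \<sigma> \<sigma>' where "\<sigma> \<in> Cones F" "\<sigma>' \<in> Cones F'" "y = dim (\<sigma> \<times> \<sigma>')"
      unfolding Cones_prod by auto
    then show "y \<le> fdim F + fdim F'"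
      using dim_cone_Times fan_dim_le[OF RF(1)] fan_dim_le[OF RF(2)] by (simp add: add_mono)
  qed
qed

private lemma top_star_prod:
  assumes "\<sigma> \<in> Cones F" "\<sigma>' \<in> Cones F'"
  shows "top_star (prod_fan F F') (\<sigma> \<times> \<sigma>') = (\<lambda>(\<eta>, \<eta>'). \<eta> \<times> \<eta>') ` (top_star F \<sigma> \<times> top_star F' \<sigma>')"
proof (intro subset_antisym subsetI)
  fix \<xi> assume "\<xi> \<in> top_star (prod_fan F F') (\<sigma> \<times> \<sigma>')"
  note \<xi> = top_starD[OF this]
  obtain \<eta> \<eta>' where \<eta>: "\<xi> = \<eta> \<times> \<eta>'" "\<eta> \<in> Cones F" "\<eta>' \<in> Cones F'"
    using \<xi>(1) unfolding Cones_prod by auto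
  have "dim \<eta> + dim \<eta>' = fdim F + fdim F'"
    using \<xi>(2) dim_cone_Times[OF \<eta>(2,3)] fdim_prod \<eta>(1) by simp
  then have "dim \<eta> = fdim F" "dim \<eta>' = fdim F'"
    using fan_dim_le[OF RF(1) \<eta>(2)] fan_dim_le[OF RF(2) \<eta>(3)] by linarith+
  moreover have "\<sigma> \<subseteq> \<eta>" "\<sigma>' \<subseteq> \<eta>'"
    using Times_subset[OF assms] \<xi>(3) \<eta>(1) by blast+
  ultimately show "\<xi> \<in> (\<lambda>(\<eta>, \<eta>'). \<eta> \<times> \<eta>') ` (top_star F \<sigma> \<times> top_star F' \<sigma>')"
    using \<eta> unfolding top_star_def cones_dim_def by auto
next
  fix \<xi> assume "\<xi> \<in> (\<lambda>(\<eta>, \<eta>'). \<eta> \<times> \<eta>') ` (top_star F \<sigma> \<times> top_star F' \<sigma>')"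
  then obtain \<eta> \<eta>' where \<eta>: "\<xi> = \<eta> \<times> \<eta>'" "\<eta> \<in> top_star F \<sigma>" "\<eta>' \<in> top_star F' \<sigma>'" by auto
  note a = top_starD[OF \<eta>(2)] and b = top_starD[OF \<eta>(3)]
  have "\<eta> \<times> \<eta>' \<in> Cones (prod_fan F F')" unfolding Cones_prod using a(1) b(1) by auto
  moreover have "dim (\<eta> \<times> \<eta>') = fdim (prod_fan F F')"
    using dim_cone_Times[OF a(1) b(1)] a(2) b(2) fdim_prod by simp
  ultimately show "\<xi> \<in> top_star (prod_fan F F') (\<sigma> \<times> \<sigma>')"
    unfolding \<eta>(1) top_star_def cones_dim_def using a(3) b(3) by blast
qed

private lemma wt_prod:
  assumes "\<eta> \<in> Cones F" "\<eta>' \<in> Cones F'"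
  shows "fst ` (\<eta> \<times> \<eta>') = \<eta>" "snd ` (\<eta> \<times> \<eta>') = \<eta>'" "wt (prod_fan F F') (\<eta> \<times> \<eta>') = wt F \<eta> * wt F' \<eta>'"
proof -
  have "0 \<in> \<eta>" "0 \<in> \<eta>'" using fan_zero[OF RF(1)] fan_zero[OF RF(2)] assms by auto
  then show "fst ` (\<eta> \<times> \<eta>') = \<eta>" "snd ` (\<eta> \<times> \<eta>') = \<eta>'" by force+
  then show "wt (prod_fan F F') (\<eta> \<times> \<eta>') = wt F \<eta> * wt F' \<eta>'" unfolding prod_fan_def by simp
qed

private lemma top_star_facet:
  assumes "rational_fan E" "\<eta> \<in> Cones E" "dim \<eta> = fdim E" shows "top_star E \<eta> = {\<eta>}"
proof -
  have "\<xi> = \<eta>" if "\<xi> \<in> Cones E" "dim \<xi> = fdim E" "\<eta> \<subseteq> \<xi>" for \<xi>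
    using fan_cone_eqI[OF assms(1) that(1) assms(2) that(3)] that(2) assms(3) by simp
  then show ?thesis unfolding top_star_def cones_dim_def using assms by blast
qed

lemma normal_at_prod:
  assumes na: "\<forall>\<tau>\<in>codim1 F. normal_at K F \<tau>" "\<forall>\<tau>\<in>codim1 F'. normal_at K F' \<tau>"
    and K: "0 \<in> K" "\<forall>\<eta>\<in>cones_dim F (fdim F). \<forall>k\<in>K. k / wt F \<eta> \<in> K"
      "\<forall>\<eta>\<in>cones_dim F' (fdim F'). \<forall>k\<in>K. k / wt F' \<eta> \<in> K"
  shows "\<forall>\<kappa>\<in>codim1 (prod_fan F F'). normal_at K (prod_fan F F') \<kappa>"
proof
  fix \<kappa> assume \<kappa>: "\<kappa> \<in> codim1 (prod_fan F F')"
  then obtain \<sigma> \<sigma>' where s: "\<kappa> = \<sigma> \<times> \<sigma>'" "\<sigma> \<in> Cones F" "\<sigma>' \<in> Cones F'"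
    using codim1D(1)[OF \<kappa>] unfolding Cones_prod by auto
  have "dim \<sigma> + dim \<sigma>' + 1 = fdim F + fdim F'"
    using codim1D(2)[OF \<kappa>] fdim_prod dim_cone_Times[OF s(2,3)] s(1) by simp
  then consider "dim \<sigma> + 1 = fdim F" "dim \<sigma>' = fdim F'" | "dim \<sigma> = fdim F" "dim \<sigma>' + 1 = fdim F'"
    using fan_dim_le[OF RF(1) s(2)] fan_dim_le[OF RF(2) s(3)] by linarith
  then show "normal_at K (prod_fan F F') \<kappa>"
  proof cases
    case 1
    have ts: "top_star (prod_fan F F') \<kappa> = (\<lambda>\<eta>. \<eta> \<times> \<sigma>') ` top_star F \<sigma>"
      unfolding s(1) top_star_prod[OF s(2,3)] top_star_facet[OF RF(2) s(3) 1(2)] by force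
    have w: "wt F' \<sigma>' \<noteq> 0" "\<And>k. k \<in> K \<Longrightarrow> k / wt F' \<sigma>' \<in> K"
      using K(3) s(3) 1(2) tropical_wt_Ints(2)[OF F'] unfolding cones_dim_def by auto
    note f = wt_prod[OF top_starD(1) s(3)]
    show ?thesis
    proof (rule normal_at_transfer[OF _ _ K(1), where \<gamma> = "\<lambda>\<xi>. fst ` \<xi>" and p = fst and c = "wt F' \<sigma>'" and F = F and \<tau> = \<sigma>])
      show "normal_at K F \<sigma>" using na(1) s(2) 1 unfolding codim1_def by blast
      show "finite (top_star F \<sigma>)" using finite_top_star fan_finite(1)[OF RF(1)] .
      show "inj_on (\<lambda>\<xi>. fst ` \<xi>) (top_star (prod_fan F F') \<kappa>)"
        unfolding ts by (rule inj_onI) (auto simp only: f(1))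
      show "(\<lambda>\<xi>. fst ` \<xi>) ` top_star (prod_fan F F') \<kappa> \<subseteq> top_star F \<sigma>"
        unfolding ts by (auto simp only: f(1))
      show "\<exists>n. is_normal_vector (Lat F) \<eta> \<sigma> n"
        if "\<eta> \<in> top_star F \<sigma> - (\<lambda>\<xi>. fst ` \<xi>) ` top_star (prod_fan F F') \<kappa>" for \<eta>
        using normal_vector_top_star[OF RF(1), of \<sigma> \<eta>] that s(2) 1 unfolding codim1_def by blast
      show "linear (fst :: 'a \<times> 'b \<Rightarrow> 'a)" by (rule linear_fst)
      show "fst ` \<kappa> \<subseteq> span \<sigma>" unfolding s(1) by (auto intro: span_base)
      fix \<xi> assume "\<xi> \<in> top_star (prod_fan F F') \<kappa>"
      then obtain \<eta> where \<eta>: "\<eta> \<in> top_star F \<sigma>" "\<xi> = \<eta> \<times> \<sigma>'" unfolding ts by blast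
      show "wt (prod_fan F F') \<xi> = wt F' \<sigma>' * wt F (fst ` \<xi>)"
        unfolding \<eta>(2) f[OF \<eta>(1)] by simp
      fix n assume "is_normal_vector (Lat (prod_fan F F')) \<xi> \<kappa> n"
      then show "is_normal_vector (Lat F) (fst ` \<xi>) \<sigma> (fst n)"
        unfolding \<eta>(2) f[OF \<eta>(1)] s(1)
        using fan_zero[OF RF(1)] fan_zero[OF RF(2)] s top_starD(1)[OF \<eta>(1)] is_lattice_closed(1)[OF fan_lattice[OF RF(2)]]
        by (intro is_normal_vector_fst[where \<eta> = \<sigma>' and N = "Lat F'"]) (auto simp: prod_fan_def)
    qed (use w in auto)
  next
    case 2
    have ts: "top_star (prod_fan F F') \<kappa> = (\<lambda>\<eta>. \<sigma> \<times> \<eta>) ` top_star F' \<sigma>'"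
      unfolding s(1) top_star_prod[OF s(2,3)] top_star_facet[OF RF(1) s(2) 2(1)] by force
    have w: "wt F \<sigma> \<noteq> 0" "\<And>k. k \<in> K \<Longrightarrow> k / wt F \<sigma> \<in> K"
      using K(2) s(2) 2(1) tropical_wt_Ints(2)[OF F] unfolding cones_dim_def by auto
    note f = wt_prod[OF s(2) top_starD(1)]
    show ?thesis
    proof (rule normal_at_transfer[OF _ _ K(1), where \<gamma> = "\<lambda>\<xi>. snd ` \<xi>" and p = snd and c = "wt F \<sigma>" and F = F' and \<tau> = \<sigma>'])
      show "normal_at K F' \<sigma>'" using na(2) s(3) 2 unfolding codim1_def by blast
      show "finite (top_star F' \<sigma>')" using finite_top_star fan_finite(1)[OF RF(2)] .
      show "inj_on (\<lambda>\<xi>. snd ` \<xi>) (top_star (prod_fan F F') \<kappa>)"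
        unfolding ts by (rule inj_onI) (auto simp only: f(2))
      show "(\<lambda>\<xi>. snd ` \<xi>) ` top_star (prod_fan F F') \<kappa> \<subseteq> top_star F' \<sigma>'"
        unfolding ts by (auto simp only: f(2))
      show "\<exists>n. is_normal_vector (Lat F') \<eta> \<sigma>' n"
        if "\<eta> \<in> top_star F' \<sigma>' - (\<lambda>\<xi>. snd ` \<xi>) ` top_star (prod_fan F F') \<kappa>" for \<eta>
        using normal_vector_top_star[OF RF(2), of \<sigma>' \<eta>] that s(3) 2 unfolding codim1_def by blast
      show "linear (snd :: 'a \<times> 'b \<Rightarrow> 'b)" by (rule linear_snd)
      show "snd ` \<kappa> \<subseteq> span \<sigma>'" unfolding s(1) by (auto intro: span_base)
      fix \<xi> assume "\<xi> \<in> top_star (prod_fan F F') \<kappa>"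
      then obtain \<eta> where \<eta>: "\<eta> \<in> top_star F' \<sigma>'" "\<xi> = \<sigma> \<times> \<eta>" unfolding ts by blast
      show "wt (prod_fan F F') \<xi> = wt F \<sigma> * wt F' (snd ` \<xi>)"
        unfolding \<eta>(2) f[OF \<eta>(1)] by simp
      fix n assume "is_normal_vector (Lat (prod_fan F F')) \<xi> \<kappa> n"
      then show "is_normal_vector (Lat F') (snd ` \<xi>) \<sigma>' (snd n)"
        unfolding \<eta>(2) f[OF \<eta>(1)] s(1)
        using fan_zero[OF RF(1)] fan_zero[OF RF(2)] s top_starD(1)[OF \<eta>(1)] is_lattice_closed(1)[OF fan_lattice[OF RF(1)]]
        by (intro is_normal_vector_snd[where \<eta> = \<sigma> and N = "Lat F"]) (auto simp: prod_fan_def)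
    qed (use w in auto)
  qed
qed

end


section \<open>Tropical modifications\<close>

context
  fixes f :: "'a::real_vector \<Rightarrow> real" and \<sigma> :: "'a set" and g :: "'a \<Rightarrow> real"
  assumes \<sigma>0: "0 \<in> \<sigma>" and g: "linear g" and fg: "\<forall>x\<in>\<sigma>. f x = g x"
begin

private lemma graph_linear: "linear (\<lambda>x. (x, g x))"
  by (rule linearI) (simp_all add: linear_add[OF g] linear_scale[OF g])

private lemma f0: "f 0 = 0" using fg \<sigma>0 linear_0[OF g] by simp

lemma graph_cone_eq: "graph_cone f \<sigma> = (\<lambda>x. (x, g x)) ` \<sigma>"
  unfolding graph_cone_def by (rule image_cong) (auto simp: fg)

lemma span_graph_cone: "span (graph_cone f \<sigma>) = (\<lambda>x. (x, g x)) ` span \<sigma>"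
  unfolding graph_cone_eq by (rule linear_span_image[OF graph_linear])

lemma dim_graph_cone: "fin_gen \<sigma> \<Longrightarrow> dim (graph_cone f \<sigma>) = dim \<sigma>"
  unfolding graph_cone_eq by (rule dim_inj_image_fin_gen[OF graph_linear]) (auto simp: inj_on_def)

lemma up_cone_vertical: "(0, 1) \<in> up_cone f \<sigma>"
  unfolding up_cone_def using \<sigma>0 f0 by force

lemma span_up_cone: "span (up_cone f \<sigma>) = span \<sigma> \<times> UNIV"
proof
  have st: "span (\<sigma> \<times> (UNIV::real set)) = span \<sigma> \<times> UNIV"
    using span_Times_0[OF \<sigma>0, of UNIV] by simp
  have "up_cone f \<sigma> \<subseteq> \<sigma> \<times> UNIV" unfolding up_cone_def by blast
  then show "span (up_cone f \<sigma>) \<subseteq> span \<sigma> \<times> UNIV" unfolding st[symmetric] by (rule span_mono)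
  have "\<sigma> \<times> UNIV \<subseteq> span (up_cone f \<sigma>)"
  proof clarify
    fix x and y :: real assume x: "x \<in> \<sigma>"
    have "(x, f x) \<in> up_cone f \<sigma>" unfolding up_cone_def using x by force
    then have "(x, f x) + (y - f x) *\<^sub>R (0, 1) \<in> span (up_cone f \<sigma>)"
      using up_cone_vertical by (intro span_add span_scale span_base)
    then show "(x, y) \<in> span (up_cone f \<sigma>)" by simp
  qed
  then show "span \<sigma> \<times> UNIV \<subseteq> span (up_cone f \<sigma>)" unfolding st[symmetric] by (rule span_minimal) simp
qed

lemma dim_up_cone:
  assumes "fin_gen \<sigma>" shows "dim (up_cone f \<sigma>) = dim \<sigma> + 1"
proof -
  have u: "fin_gen (UNIV :: real set)" unfolding fin_gen_def
    by (intro exI[of _ "Basis::real set"] conjI finite_Basis) (simp only: span_Basis order_refl)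
  have "dim (up_cone f \<sigma>) = dim (span \<sigma> \<times> (UNIV::real set))" unfolding span_up_cone[symmetric] by simp
  also have "\<dots> = dim (span \<sigma>) + dim (UNIV :: real set)"
    using assms by (intro dim_Times_fin_gen u) (auto simp: span_zero intro: fin_gen_mono)
  also have "dim (UNIV :: real set) = 1" by simp
  finally show ?thesis by simp
qed

end

lemma fst_graph_cone: "fst ` graph_cone f \<sigma> = \<sigma>"
  unfolding graph_cone_def by force

lemma fst_up_cone: "fst ` up_cone f \<sigma> = \<sigma>"
  unfolding up_cone_def by force

lemma graph_cone_subset_iff: "graph_cone f \<tau> \<subseteq> graph_cone f \<sigma> \<longleftrightarrow> \<tau> \<subseteq> \<sigma>"
  unfolding graph_cone_def by auto

lemma up_cone_subset_iff: "up_cone f \<tau> \<subseteq> up_cone f \<sigma> \<longleftrightarrow> \<tau> \<subseteq> \<sigma>"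
proof
  show "\<tau> \<subseteq> \<sigma>" if "up_cone f \<tau> \<subseteq> up_cone f \<sigma>"
    using image_mono[OF that, of fst] unfolding fst_up_cone .
qed (auto simp: up_cone_def)

lemma graph_cone_subset_up_cone_iff: "graph_cone f \<tau> \<subseteq> up_cone f \<sigma> \<longleftrightarrow> \<tau> \<subseteq> \<sigma>"
  unfolding graph_cone_def up_cone_def by force

lemma is_normal_vector_graph_cone:
  assumes \<tau>: "0 \<in> \<tau>" "\<tau> \<subseteq> \<sigma>" and g: "linear g" and fg: "\<forall>x\<in>\<sigma>. f x = g x"
    and int: "g ` sublat N \<sigma> \<subseteq> \<int>"
    and n: "is_normal_vector (N \<times> \<int>) (graph_cone f \<sigma>) (graph_cone f \<tau>) n"
  shows "is_normal_vector N \<sigma> \<tau> (fst n)" "snd n = g (fst n)"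
proof -
  let ?h = "\<lambda>x. (x, g x)"
  have 0: "0 \<in> \<sigma>" and fg': "\<forall>x\<in>\<tau>. f x = g x" using \<tau> fg by auto
  note sp = span_graph_cone[OF 0 g fg] span_graph_cone[OF \<tau>(1) g fg']
  have "g x \<in> \<int>" if "x \<in> N" "x \<in> span \<sigma>" for x using int that unfolding sublat_def by blast
  moreover have "span \<tau> \<subseteq> span \<sigma>" using \<tau>(2) by (rule span_mono)
  ultimately have L: "sublat (N \<times> \<int>) (graph_cone f \<sigma>) = ?h ` sublat N \<sigma>"
    "sublat (N \<times> \<int>) (graph_cone f \<tau>) = ?h ` sublat N \<tau>"
    unfolding sublat_def sp by auto
  have "n \<in> ?h ` sublat N \<sigma>" using n unfolding is_normal_vector_def L by blast
  then show "snd n = g (fst n)" by auto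
  show "is_normal_vector N \<sigma> \<tau> (fst n)"
    by (rule is_normal_vector_image[OF linear_fst n]) (simp_all add: L sp fst_graph_cone image_image)
qed

lemma is_normal_vector_up_cone:
  assumes 0: "0 \<in> \<tau>" "0 \<in> \<sigma>" and g: "linear g" and fg: "\<forall>x\<in>\<sigma>. f x = g x" and sub: "\<tau> \<subseteq> \<sigma>"
    and n: "is_normal_vector (N \<times> \<int>) (up_cone f \<sigma>) (up_cone f \<tau>) n"
  shows "is_normal_vector N \<sigma> \<tau> (fst n)"
proof -
  have fg': "\<forall>x\<in>\<tau>. f x = g x" using fg sub by auto
  note sp = span_up_cone[OF 0(2) g fg] span_up_cone[OF 0(1) g fg']
  have L: "sublat (N \<times> \<int>) (up_cone f \<sigma>) = sublat N \<sigma> \<times> \<int>"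
    "sublat (N \<times> \<int>) (up_cone f \<tau>) = sublat N \<tau> \<times> \<int>"
    unfolding sublat_def sp by auto
  have "(\<int> :: real set) \<noteq> {}" using Ints_0 by blast
  then have "fst ` (S \<times> (\<int> :: real set)) = S" for S :: "'a set" by (simp add: fst_image_times)
  then show ?thesis
    by (intro is_normal_vector_image[OF linear_fst n]) (auto simp: L sp fst_up_cone)
qed

lemma is_normal_vector_up_graph_cone:
  assumes 0: "0 \<in> \<tau>" "0 \<in> N" and g: "linear g" and fg: "\<forall>x\<in>\<tau>. f x = g x"
    and int: "g ` sublat N \<tau> \<subseteq> \<int>"
    and n: "is_normal_vector (N \<times> \<int>) (up_cone f \<tau>) (graph_cone f \<tau>) n"
  shows "fst n \<in> span \<tau>" "snd n = g (fst n) + 1"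
proof -
  note sp = span_up_cone[OF 0(1) g fg] span_graph_cone[OF 0(1) g fg]
  have n1: "n \<in> N \<times> \<int>" "n \<in> span \<tau> \<times> UNIV"
    and n2: "\<exists>x y. n = x + y \<and> x \<in> up_cone f \<tau> \<and> y \<in> (\<lambda>x. (x, g x)) ` span \<tau>"
    and n3: "{u + real_of_int k *\<^sub>R n | u k. u \<in> sublat (N \<times> \<int>) (graph_cone f \<tau>)} = (N \<times> \<int>) \<inter> (span \<tau> \<times> UNIV)"
    using n unfolding is_normal_vector_def sp sublat_def[of _ "up_cone f \<tau>"] by auto
  show z: "fst n \<in> span \<tau>" using n1 by auto
  obtain x y t where xy: "n = (x, f x + t) + (y, g y)" "x \<in> \<tau>" "t \<ge> 0"
    using n2 unfolding up_cone_def by blast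
  have sn: "snd n = g (fst n) + t" using xy(1,2) fg linear_add[OF g] by simp
  have "g (fst n) \<in> \<int>" using int n1 unfolding sublat_def by auto
  moreover have "snd n \<in> \<int>" using n1 by auto
  ultimately have "t \<in> \<int>" using sn by (metis Ints_diff add_diff_cancel_left')
  have "(0, 1) \<in> {u + real_of_int k *\<^sub>R n | u k. u \<in> sublat (N \<times> \<int>) (graph_cone f \<tau>)}"
    unfolding n3 using 0 span_zero by auto
  then obtain u k where u: "(0, 1) = u + real_of_int k *\<^sub>R n" "u \<in> (\<lambda>x. (x, g x)) ` span \<tau>"
    unfolding sublat_def sp by blast
  then obtain v where v: "u = (v, g v)" by blast
  have "0 = v + real_of_int k *\<^sub>R fst n" "1 = g v + real_of_int k * snd n"
    using arg_cong[OF u(1), of fst] arg_cong[OF u(1), of snd] v by auto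
  moreover have "g (v + real_of_int k *\<^sub>R fst n) = g v + real_of_int k * g (fst n)"
    by (simp add: linear_add[OF g] linear_scale[OF g])
  ultimately have "real_of_int k * t = 1"
    using sn linear_0[OF g] by (simp add: distrib_left)
  moreover obtain j where j: "t = of_int j" using \<open>t \<in> \<int>\<close> by (elim Ints_cases)
  ultimately have "real_of_int (k * j) = 1" by simp
  then have "k * j = 1" unfolding of_int_eq_1_iff .
  then have "j = 1 \<or> j = - 1" by (auto simp: zmult_eq_1_iff)
  then have "t = 1" using xy(3) j by auto
  then show "snd n = g (fst n) + 1" using sn by simp
qed

context
  fixes F :: "'a::real_normed_vector wfan" and f :: "'a \<Rightarrow> real"
  assumes F: "tropical_fan F" and f: "meromorphic_fun F f"
begin

private lemma fan_M: "rational_fan F" by (rule tropical_rational_fan[OF F])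

private abbreviation "g \<equiv> lin_form f"

lemma lin_form:
  assumes \<sigma>: "\<sigma> \<in> Cones F"
  shows "linear (g \<sigma>)" "\<forall>x\<in>\<sigma>. f x = g \<sigma> x" "g \<sigma> ` sublat (Lat F) \<sigma> \<subseteq> \<int>"
proof -
  obtain h where h: "linear h" "\<forall>x\<in>\<sigma>. f x = h x" "h ` sublat (Lat F) \<sigma> \<subseteq> \<int>"
    using f \<sigma> unfolding meromorphic_fun_def by blast
  have "\<exists>h. linear h \<and> (\<forall>x\<in>\<sigma>. f x = h x)" using h by blast
  then have g: "linear (g \<sigma>) \<and> (\<forall>x\<in>\<sigma>. f x = g \<sigma> x)" unfolding lin_form_def by (rule someI_ex)
  then show "linear (g \<sigma>)" and fg: "\<forall>x\<in>\<sigma>. f x = g \<sigma> x" by blast+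
  have "g \<sigma> x = h x" if "x \<in> \<sigma>" for x using fg h(2) that by simp
  then have "g \<sigma> x = h x" if "x \<in> span \<sigma>" for x
    using linear_eq_on[of "g \<sigma>" h x \<sigma>] g h(1) that by blast
  then show "g \<sigma> ` sublat (Lat F) \<sigma> \<subseteq> \<int>" using h(3) unfolding sublat_def by auto
qed

lemma lin_form_face:
  assumes "\<sigma> \<in> Cones F" "\<tau> \<in> Cones F" "\<tau> \<subseteq> \<sigma>" "x \<in> span \<tau>"
  shows "g \<sigma> x = g \<tau> x"
proof (rule linear_eq_on[OF lin_form(1)[OF assms(1)] lin_form(1)[OF assms(2)] assms(4)])
  fix y assume "y \<in> \<tau>"
  then show "g \<sigma> y = g \<tau> y"
    using lin_form(2)[OF assms(1)] lin_form(2)[OF assms(2)] assms(3) by (metis subsetD)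
qed

lemma ord_at_eq:
  assumes \<tau>: "\<tau> \<in> codim1 F"
    and n: "\<And>\<eta>. \<eta> \<in> top_star F \<tau> \<Longrightarrow> is_normal_vector (Lat F) \<eta> \<tau> (n \<eta>)"
  shows "ord_at F f \<tau> = - (\<Sum>\<eta>\<in>top_star F \<tau>. wt F \<eta> * g \<eta> (n \<eta>)) + g \<tau> (\<Sum>\<eta>\<in>top_star F \<tau>. wt F \<eta> *\<^sub>R n \<eta>)"
proof -
  let ?n = "\<lambda>\<eta>. normal_vector (Lat F) \<eta> \<tau>"
  note \<tau>' = codim1D[OF \<tau>] and gt = lin_form(1)[OF codim1D(1)[OF \<tau>]]
  have e: "g \<eta> (n \<eta>) - g \<eta> (?n \<eta>) = g \<tau> (n \<eta>) - g \<tau> (?n \<eta>)" if \<eta>: "\<eta> \<in> top_star F \<tau>" for \<eta>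
  proof -
    note \<eta>' = top_starD[OF \<eta>]
    have "n \<eta> - ?n \<eta> \<in> span \<tau>"
      using fan_normal_vector_unique[OF fan_M \<eta>'(1) \<tau>'(1) \<eta>'(3) _ n[OF \<eta>] normal_vector_top_star[OF fan_M \<tau> \<eta>]] \<eta>'(2) \<tau>'(2)
      by simp
    then have "g \<eta> (n \<eta> - ?n \<eta>) = g \<tau> (n \<eta> - ?n \<eta>)"
      by (rule lin_form_face[OF \<eta>'(1) \<tau>'(1) \<eta>'(3)])
    then show ?thesis using lin_form(1)[OF \<eta>'(1)] gt by (simp add: linear_diff)
  qed
  have "ord_at F f \<tau> = - (\<Sum>\<eta>\<in>top_star F \<tau>. wt F \<eta> * g \<eta> (?n \<eta>)) + g \<tau> (\<Sum>\<eta>\<in>top_star F \<tau>. wt F \<eta> *\<^sub>R ?n \<eta>)"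
    unfolding ord_at_def top_star_def by simp
  also have "\<dots> = (\<Sum>\<eta>\<in>top_star F \<tau>. wt F \<eta> * (g \<tau> (?n \<eta>) - g \<eta> (?n \<eta>)))"
    by (simp add: linear_sum[OF gt] linear_scale[OF gt] sum_subtractf algebra_simps)
  also have "\<dots> = (\<Sum>\<eta>\<in>top_star F \<tau>. wt F \<eta> * (g \<tau> (n \<eta>) - g \<eta> (n \<eta>)))"
  proof (rule sum.cong[OF refl])
    fix \<eta> assume "\<eta> \<in> top_star F \<tau>"
    from e[OF this] show "wt F \<eta> * (g \<tau> (?n \<eta>) - g \<eta> (?n \<eta>)) = wt F \<eta> * (g \<tau> (n \<eta>) - g \<eta> (n \<eta>))"
      by (intro arg_cong[where f = "\<lambda>x. wt F \<eta> * x"]) linarith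
  qed
  also have "\<dots> = - (\<Sum>\<eta>\<in>top_star F \<tau>. wt F \<eta> * g \<eta> (n \<eta>)) + g \<tau> (\<Sum>\<eta>\<in>top_star F \<tau>. wt F \<eta> *\<^sub>R n \<eta>)"
    by (simp add: linear_sum[OF gt] linear_scale[OF gt] sum_subtractf algebra_simps)
  finally show ?thesis .
qed

private abbreviation "D \<equiv> div_fan F f"
private abbreviation "M \<equiv> trop_mod F f"

lemma div_fan_cone:
  assumes "\<delta> \<in> Cones D"
  shows "\<delta> \<in> Cones F" "dim \<delta> + 1 \<le> fdim F" "dim \<delta> + 1 = fdim F \<Longrightarrow> ord_at F f \<delta> \<noteq> 0"
proof -
  obtain \<tau> where \<tau>: "\<tau> \<in> codim1 F" "ord_at F f \<tau> \<noteq> 0" "cone_face \<delta> \<tau>"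
    using assms unfolding div_fan_def by auto
  note \<tau>' = codim1D[OF \<tau>(1)]
  show \<delta>: "\<delta> \<in> Cones F" using fan_face[OF fan_M \<tau>'(1) \<tau>(3)] .
  note s = cone_face_subset[OF \<tau>(3)]
  show "dim \<delta> + 1 \<le> fdim F" using fan_dim_mono[OF fan_M \<tau>'(1) s] \<tau>'(2) by simp
  assume "dim \<delta> + 1 = fdim F"
  then have "\<delta> = \<tau>" using fan_cone_eqI[OF fan_M \<tau>'(1) \<delta> s] \<tau>'(2) by simp
  then show "ord_at F f \<delta> \<noteq> 0" using \<tau>(2) by simp
qed

lemma codim1_in_div_fan:
  assumes \<tau>: "\<tau> \<in> codim1 F" "ord_at F f \<tau> \<noteq> 0" shows "\<tau> \<in> Cones D"
proof -
  have "cone_face \<tau> \<tau>" using fan_subset_face[OF fan_M] codim1D(1)[OF \<tau>(1)] by blast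
  then show ?thesis using \<tau> unfolding div_fan_def by auto
qed

lemma fdim_div_fan:
  assumes "Cones D \<noteq> {}" shows "fdim D + 1 = fdim F"
proof -
  obtain \<tau> where \<tau>: "\<tau> \<in> codim1 F" "ord_at F f \<tau> \<noteq> 0"
    using assms unfolding div_fan_def by auto
  have "finite (Cones D)"
    using div_fan_cone(1) fan_finite(1)[OF fan_M] by (meson finite_subset subsetI)
  have "fdim D = dim \<tau>" unfolding fdim_def
  proof (rule Max_eqI)
    show "finite (dim ` Cones D)" using \<open>finite (Cones D)\<close> by blast
    show "dim \<tau> \<in> dim ` Cones D" using codim1_in_div_fan[OF \<tau>] by blast
    show "y \<le> dim \<tau>" if "y \<in> dim ` Cones D" for y
      using that div_fan_cone(2) codim1D(2)[OF \<tau>(1)] by force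
  qed
  then show ?thesis using codim1D(2)[OF \<tau>(1)] by simp
qed

lemma dim_trop_mod_graph: "\<sigma> \<in> Cones F \<Longrightarrow> dim (graph_cone f \<sigma>) = dim \<sigma>"
  using dim_graph_cone[OF fan_zero[OF fan_M] lin_form(1,2) fan_fin_gen[OF fan_M]] by blast

lemma dim_trop_mod_up: "\<sigma> \<in> Cones F \<Longrightarrow> dim (up_cone f \<sigma>) = dim \<sigma> + 1"
  using dim_up_cone[OF fan_zero[OF fan_M] lin_form(1,2) fan_fin_gen[OF fan_M]] by blast

lemma up_cone_not_subset_graph: "\<sigma> \<in> Cones F \<Longrightarrow> \<eta> \<in> Cones F \<Longrightarrow> \<not> up_cone f \<sigma> \<subseteq> graph_cone f \<eta>"
proof
  assume c: "\<sigma> \<in> Cones F" "\<eta> \<in> Cones F" and s: "up_cone f \<sigma> \<subseteq> graph_cone f \<eta>"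
  have "(0, 1) \<in> graph_cone f \<eta>"
    using up_cone_vertical[OF fan_zero[OF fan_M c(1)] lin_form(1)[OF c(1)] lin_form(2)[OF c(1)]] s by blast
  then have "f 0 = 1" unfolding graph_cone_def by auto
  moreover have "f 0 = 0"
    using lin_form(2)[OF c(1)] fan_zero[OF fan_M c(1)] linear_0[OF lin_form(1)[OF c(1)]] by simp
  ultimately show False by simp
qed

lemma Cones_trop_mod: "Cones M = graph_cone f ` Cones F \<union> up_cone f ` Cones D"
  unfolding trop_mod_def by simp

lemma fdim_trop_mod: "fdim M = fdim F"
proof -
  obtain \<eta> where \<eta>: "\<eta> \<in> cones_dim F (fdim F)"
    using tropical_facet_above[OF F] fan_finite(2)[OF fan_M] by (metis ex_in_conv)
  show ?thesis unfolding fdim_def[of M]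
  proof (rule Max_eqI)
    have "finite (Cones D)"
      using div_fan_cone(1) fan_finite(1)[OF fan_M] by (meson finite_subset subsetI)
    then show "finite (dim ` Cones M)" unfolding Cones_trop_mod using fan_finite(1)[OF fan_M] by blast
    show "fdim F \<in> dim ` Cones M"
      unfolding Cones_trop_mod using \<eta> dim_trop_mod_graph[of \<eta>] unfolding cones_dim_def by force
    fix y assume "y \<in> dim ` Cones M"
    then consider \<sigma> where "\<sigma> \<in> Cones F" "y = dim (graph_cone f \<sigma>)"
      | \<delta> where "\<delta> \<in> Cones D" "y = dim (up_cone f \<delta>)"
      unfolding Cones_trop_mod by blast
    then show "y \<le> fdim F"
    proof cases
      case 1
      then show ?thesis using dim_trop_mod_graph fan_dim_le[OF fan_M] by simp
    next
      case 2
      then show ?thesis using dim_trop_mod_up div_fan_cone by simp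
    qed
  qed
qed

lemma wt_trop_mod_graph: "\<eta> \<in> cones_dim F (fdim F) \<Longrightarrow> wt M (graph_cone f \<eta>) = wt F \<eta>"
  unfolding trop_mod_def by (simp add: fst_graph_cone)

lemma wt_trop_mod_up: "dim \<delta> + 1 = fdim F \<Longrightarrow> wt M (up_cone f \<delta>) = ord_at F f \<delta>"
  unfolding trop_mod_def by (simp add: fst_up_cone cones_dim_def)

lemma top_star_trop_mod_up:
  assumes \<delta>: "\<delta> \<in> Cones D"
  shows "top_star M (up_cone f \<delta>) = up_cone f ` top_star D \<delta>"
proof -
  have d: "fdim D + 1 = fdim F" using fdim_div_fan \<delta> by blast
  have "\<kappa> \<in> up_cone f ` top_star D \<delta>" if \<kappa>: "\<kappa> \<in> top_star M (up_cone f \<delta>)" for \<kappa>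
  proof -
    note \<kappa>' = top_starD[OF \<kappa>]
    have "\<kappa> \<notin> graph_cone f ` Cones F"
      using up_cone_not_subset_graph[OF div_fan_cone(1)[OF \<delta>]] \<kappa>'(3) by blast
    then obtain \<eta> where \<eta>: "\<eta> \<in> Cones D" "\<kappa> = up_cone f \<eta>" using \<kappa>'(1) unfolding Cones_trop_mod by blast
    have "\<eta> \<in> top_star D \<delta>"
      using \<kappa>'(2,3) dim_trop_mod_up[OF div_fan_cone(1)[OF \<eta>(1)]] d \<eta> fdim_trop_mod
      unfolding top_star_def cones_dim_def by (simp add: up_cone_subset_iff)
    then show ?thesis using \<eta>(2) by blast
  qed
  moreover have "up_cone f \<eta> \<in> top_star M (up_cone f \<delta>)" if \<eta>: "\<eta> \<in> top_star D \<delta>" for \<eta>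
  proof -
    note \<eta>' = top_starD[OF \<eta>]
    show ?thesis
      using \<eta>' dim_trop_mod_up[OF div_fan_cone(1)[OF \<eta>'(1)]] d fdim_trop_mod
      unfolding top_star_def cones_dim_def Cones_trop_mod by (simp add: up_cone_subset_iff)
  qed
  ultimately show ?thesis by blast
qed

lemma top_star_trop_mod_graph:
  assumes \<tau>: "\<tau> \<in> codim1 F"
  shows "top_star M (graph_cone f \<tau>) =
    graph_cone f ` top_star F \<tau> \<union> (if ord_at F f \<tau> \<noteq> 0 then {up_cone f \<tau>} else {})"
proof -
  note \<tau>' = codim1D[OF \<tau>]
  have "\<kappa> \<in> graph_cone f ` top_star F \<tau> \<or> \<kappa> = up_cone f \<tau> \<and> ord_at F f \<tau> \<noteq> 0"
    if \<kappa>: "\<kappa> \<in> top_star M (graph_cone f \<tau>)" for \<kappa>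
  proof -
    note \<kappa>' = top_starD[OF \<kappa>]
    consider \<eta> where "\<eta> \<in> Cones F" "\<kappa> = graph_cone f \<eta>" | \<delta> where "\<delta> \<in> Cones D" "\<kappa> = up_cone f \<delta>"
      using \<kappa>'(1) unfolding Cones_trop_mod by blast
    then show ?thesis
    proof cases
      case 1
      then have "\<eta> \<in> top_star F \<tau>"
        using \<kappa>'(2,3) dim_trop_mod_graph[OF 1(1)] fdim_trop_mod
        unfolding top_star_def cones_dim_def by (simp add: graph_cone_subset_iff)
      then show ?thesis using 1(2) by blast
    next
      case 2
      note \<delta> = div_fan_cone[OF 2(1)]
      have d: "dim \<delta> + 1 = fdim F" using \<kappa>'(2) 2(2) dim_trop_mod_up[OF \<delta>(1)] fdim_trop_mod by simp
      have "\<tau> \<subseteq> \<delta>" using \<kappa>'(3) 2(2) graph_cone_subset_up_cone_iff by metis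
      then have "\<tau> = \<delta>" using fan_cone_eqI[OF fan_M \<delta>(1) \<tau>'(1)] d \<tau>'(2) by simp
      then show ?thesis using 2(2) \<delta>(3)[OF d] by simp
    qed
  qed
  moreover have "graph_cone f \<eta> \<in> top_star M (graph_cone f \<tau>)" if \<eta>: "\<eta> \<in> top_star F \<tau>" for \<eta>
    using top_starD[OF \<eta>] dim_trop_mod_graph[of \<eta>] fdim_trop_mod
    unfolding top_star_def[of M] cones_dim_def[of M] Cones_trop_mod by (simp add: graph_cone_subset_iff)
  moreover have "up_cone f \<tau> \<in> top_star M (graph_cone f \<tau>)" if "ord_at F f \<tau> \<noteq> 0"
    using codim1_in_div_fan[OF \<tau> that] dim_trop_mod_up[OF \<tau>'(1)] fdim_trop_mod \<tau>'(2)
    unfolding top_star_def[of M] cones_dim_def[of M] Cones_trop_mod by (simp add: graph_cone_subset_up_cone_iff)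
  ultimately show ?thesis by auto
qed

private lemma Lat_M: "Lat M = Lat F \<times> \<int>" unfolding trop_mod_def by simp

lemma normal_at_trop_mod_graph:
  assumes \<tau>: "\<tau> \<in> codim1 F" and na: "normal_at K F \<tau>"
  shows "normal_at K M (graph_cone f \<tau>)"
proof (rule normal_atI)
  note \<tau>' = codim1D[OF \<tau>]
  note gt = lin_form(1)[OF \<tau>'(1)] and sp = span_graph_cone[OF fan_zero[OF fan_M \<tau>'(1)] lin_form(1,2)[OF \<tau>'(1)]]
  let ?T = "top_star F \<tau>" and ?U = "if ord_at F f \<tau> \<noteq> 0 then {up_cone f \<tau>} else {}"
  note ts = top_star_trop_mod_graph[OF \<tau>]
  fix w n
  assume w: "\<And>\<xi>. \<xi> \<in> top_star M (graph_cone f \<tau>) \<Longrightarrow> w \<xi> \<in> K"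
    and n: "\<And>\<xi>. \<xi> \<in> top_star M (graph_cone f \<tau>) \<Longrightarrow> is_normal_vector (Lat M) \<xi> (graph_cone f \<tau>) (n \<xi>)"
    and s: "(\<Sum>\<xi>\<in>top_star M (graph_cone f \<tau>). w \<xi> *\<^sub>R n \<xi>) \<in> span (graph_cone f \<tau>)"
  define v where "v \<eta> = w (graph_cone f \<eta>)" for \<eta>
  define m where "m \<eta> = fst (n (graph_cone f \<eta>))" for \<eta>
  define u where "u = (\<Sum>\<xi>\<in>?U. w \<xi> *\<^sub>R n \<xi>)"
  have m: "is_normal_vector (Lat F) \<eta> \<tau> (m \<eta>)" "n (graph_cone f \<eta>) = (m \<eta>, g \<eta> (m \<eta>))" if \<eta>: "\<eta> \<in> ?T" for \<eta>
  proof -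
    note \<eta>' = top_starD[OF \<eta>]
    have "is_normal_vector (Lat F \<times> \<int>) (graph_cone f \<eta>) (graph_cone f \<tau>) (n (graph_cone f \<eta>))"
      using n[of "graph_cone f \<eta>"] \<eta> unfolding ts Lat_M by blast
    note * = is_normal_vector_graph_cone[OF fan_zero[OF fan_M \<tau>'(1)] \<eta>'(3) lin_form[OF \<eta>'(1)] this]
    show "is_normal_vector (Lat F) \<eta> \<tau> (m \<eta>)" unfolding m_def by (rule *(1))
    show "n (graph_cone f \<eta>) = (m \<eta>, g \<eta> (m \<eta>))" unfolding m_def *(2)[symmetric] by simp
  qed
  have u: "fst u \<in> span \<tau>" "snd u = g \<tau> (fst u) + (if ord_at F f \<tau> \<noteq> 0 then w (up_cone f \<tau>) else 0)"
  proof -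
    have "fst u \<in> span \<tau> \<and> snd u = g \<tau> (fst u) + (if ord_at F f \<tau> \<noteq> 0 then w (up_cone f \<tau>) else 0)"
    proof (cases "ord_at F f \<tau> \<noteq> 0")
      case True
      have "is_normal_vector (Lat F \<times> \<int>) (up_cone f \<tau>) (graph_cone f \<tau>) (n (up_cone f \<tau>))"
        using n[of "up_cone f \<tau>"] True unfolding ts Lat_M by simp
      note * = is_normal_vector_up_graph_cone[OF fan_zero[OF fan_M \<tau>'(1)] is_lattice_closed(1)[OF fan_lattice[OF fan_M]]
          lin_form[OF \<tau>'(1)] this]
      have "u = w (up_cone f \<tau>) *\<^sub>R n (up_cone f \<tau>)" unfolding u_def using True by simp
      then show ?thesis using * True by (simp add: span_scale linear_scale[OF gt] algebra_simps)
    next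
      case False
      then show ?thesis unfolding u_def by (simp add: span_zero linear_0[OF gt])
    qed
    then show "fst u \<in> span \<tau>" "snd u = g \<tau> (fst u) + (if ord_at F f \<tau> \<noteq> 0 then w (up_cone f \<tau>) else 0)"
      by blast+
  qed
  have inj: "inj_on (graph_cone f) ?T"
    by (rule inj_onI) (metis fst_graph_cone)
  have disj: "graph_cone f ` ?T \<inter> ?U = {}"
    using up_cone_not_subset_graph[OF \<tau>'(1)] by (auto dest!: top_starD(1))
  have fin: "finite ?T" using finite_top_star[OF fan_finite(1)[OF fan_M]] .
  have "(\<Sum>\<xi>\<in>top_star M (graph_cone f \<tau>). w \<xi> *\<^sub>R n \<xi>) = (\<Sum>\<xi>\<in>graph_cone f ` ?T. w \<xi> *\<^sub>R n \<xi>) + u"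
    unfolding ts u_def using fin disj by (intro sum.union_disjoint) auto
  also have "(\<Sum>\<xi>\<in>graph_cone f ` ?T. w \<xi> *\<^sub>R n \<xi>) = (\<Sum>\<eta>\<in>?T. v \<eta> *\<^sub>R (m \<eta>, g \<eta> (m \<eta>)))"
    by (simp add: sum.reindex[OF inj] m(2) v_def cong: sum.cong)
  also have "\<dots> = (\<Sum>\<eta>\<in>?T. v \<eta> *\<^sub>R m \<eta>, \<Sum>\<eta>\<in>?T. v \<eta> * g \<eta> (m \<eta>))"
    by (simp add: sum_prod)
  finally obtain z where z: "z \<in> span \<tau>" "(\<Sum>\<eta>\<in>?T. v \<eta> *\<^sub>R m \<eta>) + fst u = z"
    "(\<Sum>\<eta>\<in>?T. v \<eta> * g \<eta> (m \<eta>)) + snd u = g \<tau> z"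
    using s unfolding sp by (cases u) auto
  have zs: "(\<Sum>\<eta>\<in>?T. v \<eta> *\<^sub>R m \<eta>) \<in> span \<tau>"
    using span_diff[OF z(1) u(1)] unfolding z(2)[symmetric] by simp
  have vK: "v \<eta> \<in> K" if "\<eta> \<in> ?T" for \<eta>
    unfolding v_def using that w ts by blast
  obtain k where k: "k \<in> K" "\<And>\<eta>. \<eta> \<in> ?T \<Longrightarrow> v \<eta> = k * wt F \<eta>"
    using normal_atD[OF na vK m(1) zs] by blast
  have "(if ord_at F f \<tau> \<noteq> 0 then w (up_cone f \<tau>) else 0) = snd u - g \<tau> (fst u)" using u(2) by simp
  also have "\<dots> = g \<tau> (z - fst u) - (\<Sum>\<eta>\<in>?T. v \<eta> * g \<eta> (m \<eta>))"
    using z(3) by (simp add: linear_diff[OF gt])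
  also have "z - fst u = (\<Sum>\<eta>\<in>?T. v \<eta> *\<^sub>R m \<eta>)" using z(2) by (simp add: algebra_simps)
  also have "\<dots> = (\<Sum>\<eta>\<in>?T. k *\<^sub>R (wt F \<eta> *\<^sub>R m \<eta>))"
    by (rule sum.cong) (simp_all add: k(2))
  also have "\<dots> = k *\<^sub>R (\<Sum>\<eta>\<in>?T. wt F \<eta> *\<^sub>R m \<eta>)" by (rule scaleR_sum_right[symmetric])
  also have "(\<Sum>\<eta>\<in>?T. v \<eta> * g \<eta> (m \<eta>)) = k * (\<Sum>\<eta>\<in>?T. wt F \<eta> * g \<eta> (m \<eta>))"
    unfolding sum_distrib_left by (rule sum.cong) (simp_all add: k(2))
  also have "g \<tau> (k *\<^sub>R (\<Sum>\<eta>\<in>?T. wt F \<eta> *\<^sub>R m \<eta>)) - k * (\<Sum>\<eta>\<in>?T. wt F \<eta> * g \<eta> (m \<eta>)) = k * ord_at F f \<tau>"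
  proof -
    have o: "ord_at F f \<tau> = - (\<Sum>\<eta>\<in>?T. wt F \<eta> * g \<eta> (m \<eta>)) + g \<tau> (\<Sum>\<eta>\<in>?T. wt F \<eta> *\<^sub>R m \<eta>)"
      by (rule ord_at_eq[OF \<tau>]) (rule m(1))
    show ?thesis unfolding o linear_scale[OF gt] by (simp add: right_diff_distrib)
  qed
  finally have uw: "(if ord_at F f \<tau> \<noteq> 0 then w (up_cone f \<tau>) else 0) = k * ord_at F f \<tau>" .
  have "w \<xi> = k * wt M \<xi>" if \<xi>: "\<xi> \<in> top_star M (graph_cone f \<tau>)" for \<xi>
  proof -
    consider \<eta> where "\<eta> \<in> ?T" "\<xi> = graph_cone f \<eta>" | "ord_at F f \<tau> \<noteq> 0" "\<xi> = up_cone f \<tau>"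
      using \<xi> unfolding ts by (auto split: if_splits)
    then show ?thesis
    proof cases
      case 1
      then show ?thesis using k(2)[OF 1(1)] wt_trop_mod_graph[OF top_starD(4)[OF 1(1)]] unfolding v_def by simp
    next
      case 2
      then show ?thesis using uw wt_trop_mod_up \<tau>'(2) by simp
    qed
  qed
  then show "\<exists>k\<in>K. \<forall>\<xi>\<in>top_star M (graph_cone f \<tau>). w \<xi> = k * wt M \<xi>" using k(1) by blast
qed

lemma normal_at_trop_mod_up:
  assumes \<delta>: "\<delta> \<in> Cones D" and na: "normal_at K D \<delta>" and K: "0 \<in> K"
  shows "normal_at K M (up_cone f \<delta>)"
proof -
  note ts = top_star_trop_mod_up[OF \<delta>]
  have d: "fdim D + 1 = fdim F" using fdim_div_fan \<delta> by blast
  show ?thesis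
  proof (rule normal_at_transfer[OF na _ K, where \<gamma> = "\<lambda>\<xi>. fst ` \<xi>" and p = fst and c = 1])
    have "finite (Cones D)"
      using div_fan_cone(1) fan_finite(1)[OF fan_M] by (meson finite_subset subsetI)
    then show "finite (top_star D \<delta>)" by (rule finite_top_star)
    show "inj_on (\<lambda>\<xi>. fst ` \<xi>) (top_star M (up_cone f \<delta>))"
      unfolding ts by (rule inj_onI) (auto simp: fst_up_cone)
    have im: "(\<lambda>\<xi>. fst ` \<xi>) ` top_star M (up_cone f \<delta>) = top_star D \<delta>"
      unfolding ts image_comp by (simp add: comp_def fst_up_cone)
    then show "(\<lambda>\<xi>. fst ` \<xi>) ` top_star M (up_cone f \<delta>) \<subseteq> top_star D \<delta>" by blast
    show "\<exists>n. is_normal_vector (Lat D) \<eta> \<delta> n"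
      if "\<eta> \<in> top_star D \<delta> - (\<lambda>\<xi>. fst ` \<xi>) ` top_star M (up_cone f \<delta>)" for \<eta>
      using that im by blast
    show "linear (fst :: 'a \<times> real \<Rightarrow> 'a)" by (rule linear_fst)
    show "fst ` up_cone f \<delta> \<subseteq> span \<delta>" unfolding fst_up_cone by (rule span_superset)
    fix \<xi> assume "\<xi> \<in> top_star M (up_cone f \<delta>)"
    then obtain \<eta> where \<eta>: "\<eta> \<in> top_star D \<delta>" "\<xi> = up_cone f \<eta>" unfolding ts by blast
    note \<eta>' = top_starD[OF \<eta>(1)] and \<eta>F = div_fan_cone(1)[OF top_starD(1)[OF \<eta>(1)]]
    show "wt M \<xi> = 1 * wt D (fst ` \<xi>)"
      unfolding \<eta>(2) fst_up_cone using wt_trop_mod_up[of \<eta>] \<eta>'(2) d by (simp add: div_fan_def)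
    fix n assume "is_normal_vector (Lat M) \<xi> (up_cone f \<delta>) n"
    then have "is_normal_vector (Lat F) \<eta> \<delta> (fst n)"
      unfolding \<eta>(2) Lat_M
      by (intro is_normal_vector_up_cone[OF fan_zero[OF fan_M div_fan_cone(1)[OF \<delta>]] fan_zero[OF fan_M \<eta>F] lin_form(1,2)[OF \<eta>F] \<eta>'(3)])
    then show "is_normal_vector (Lat D) (fst ` \<xi>) \<delta> (fst n)"
      unfolding \<eta>(2) fst_up_cone by (simp add: div_fan_def)
  qed auto
qed

lemma normal_at_trop_mod:
  assumes na: "\<forall>\<tau>\<in>codim1 F. normal_at K F \<tau>"
    and D: "div_trivial F f \<or> (\<forall>\<delta>\<in>codim1 D. normal_at K D \<delta>)" and K: "0 \<in> K"
  shows "\<forall>\<kappa>\<in>codim1 M. normal_at K M \<kappa>"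
proof
  fix \<kappa> assume \<kappa>: "\<kappa> \<in> codim1 M"
  note \<kappa>' = codim1D[OF \<kappa>]
  consider \<tau> where "\<tau> \<in> Cones F" "\<kappa> = graph_cone f \<tau>" | \<delta> where "\<delta> \<in> Cones D" "\<kappa> = up_cone f \<delta>"
    using \<kappa>'(1) unfolding Cones_trop_mod by blast
  then show "normal_at K M \<kappa>"
  proof cases
    case 1
    then have "\<tau> \<in> codim1 F"
      using \<kappa>'(2) fdim_trop_mod dim_trop_mod_graph[OF 1(1)] unfolding codim1_def by simp
    then show ?thesis unfolding 1(2) using normal_at_trop_mod_graph na by blast
  next
    case 2
    have "\<delta> \<in> codim1 D"
      using \<kappa>'(2) fdim_trop_mod dim_trop_mod_up[OF div_fan_cone(1)[OF 2(1)]]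
        fdim_div_fan 2 unfolding codim1_def by fastforce
    moreover have "\<not> div_trivial F f" using 2(1) unfolding div_trivial_def div_fan_def by auto
    ultimately have "normal_at K D \<delta>" using D by blast
    then show ?thesis unfolding 2(2) using normal_at_trop_mod_up[OF 2(1) _ K] by blast
  qed
qed

end


section \<open>Blow-ups\<close>

lemma convex_cone_hull_singleton: "x \<in> convex_cone hull {v} \<longleftrightarrow> (\<exists>c\<ge>0. x = c *\<^sub>R v)"
proof -
  have "convex_cone {c *\<^sub>R v | c. c \<ge> 0}" unfolding convex_cone_iff
  proof (intro conjI ballI allI impI)
    show "0 \<in> {c *\<^sub>R v | c. c \<ge> 0}" by (auto intro: exI[of _ 0])
    fix x y assume "x \<in> {c *\<^sub>R v | c. c \<ge> 0}" "y \<in> {c *\<^sub>R v | c. c \<ge> 0}"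
    then obtain a b where "x = a *\<^sub>R v" "y = b *\<^sub>R v" "a \<ge> 0" "b \<ge> 0" by blast
    then have "x + y = (a + b) *\<^sub>R v" "a + b \<ge> 0" by (simp_all add: scaleR_add_left)
    then show "x + y \<in> {c *\<^sub>R v | c. c \<ge> 0}" by blast
  next
    fix x and c :: real assume "x \<in> {c *\<^sub>R v | c. c \<ge> 0}" "c \<ge> 0"
    then obtain a where "x = a *\<^sub>R v" "a \<ge> 0" by blast
    then have "c *\<^sub>R x = (c * a) *\<^sub>R v" "c * a \<ge> 0" using \<open>c \<ge> 0\<close> by simp_all
    then show "c *\<^sub>R x \<in> {c *\<^sub>R v | c. c \<ge> 0}" by blast
  qed
  moreover have "{v} \<subseteq> {c *\<^sub>R v | c. c \<ge> 0}" by (auto intro: exI[of _ 1])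
  ultimately have "convex_cone hull {v} \<subseteq> {c *\<^sub>R v | c. c \<ge> 0}" by (rule hull_minimal[rotated])
  moreover have "c *\<^sub>R v \<in> convex_cone hull {v}" if "c \<ge> 0" for c
    using that by (intro convex_cone_hull_mul hull_inc) auto
  ultimately show ?thesis by blast
qed

text \<open>A generator \<open>g\<close> with \<open>g - c v\<close> in the cone can be expressed by \<open>v\<close> and the other generators,
  so the generators can be removed one after the other.\<close>

lemma convex_cone_hull_eq_ray:
  assumes "finite G" "- v \<notin> convex_cone hull (insert v G)"
    and "\<forall>g\<in>G. \<exists>c>0. g - c *\<^sub>R v \<in> convex_cone hull (insert v G)"
  shows "convex_cone hull (insert v G) = convex_cone hull {v}"
  using assms
proof (induction G rule: finite_induct)
  case (insert g G)
  let ?H = "convex_cone hull (insert v (insert g G))" and ?H' = "convex_cone hull (insert v G)"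
  have sub: "?H' \<subseteq> ?H" by (rule hull_mono) blast
  obtain c where c: "c > 0" "g - c *\<^sub>R v \<in> ?H" using insert.prems(2) by blast
  have "?H = convex_cone hull ({g} \<union> insert v G)" by (simp add: insert_commute)
  then obtain x h where xh: "g - c *\<^sub>R v = x + h" "x \<in> convex_cone hull {g}" "h \<in> ?H'"
    using c(2) unfolding convex_cone_hull_Un by blast
  obtain b where b: "b \<ge> 0" "x = b *\<^sub>R g" using xh(2) unfolding convex_cone_hull_singleton by blast
  have v: "v \<in> ?H'" "v \<in> ?H" "g \<in> ?H" by (auto intro: hull_inc)
  have "b < 1"
  proof (rule ccontr)
    assume "\<not> b < 1"
    then have "(b - 1) *\<^sub>R g + h \<in> ?H"
      using v xh(3) sub by (intro convex_cone_hull_add convex_cone_hull_mul) auto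
    moreover have "(b - 1) *\<^sub>R g + h = - (c *\<^sub>R v)" using xh(1) b(2) by (simp add: algebra_simps)
    ultimately have "- (c *\<^sub>R v) \<in> ?H" by simp
    then have "(1 / c) *\<^sub>R (- (c *\<^sub>R v)) \<in> ?H" using c(1) by (intro convex_cone_hull_mul) auto
    then show False using insert.prems(1) c(1) by simp
  qed
  have "c *\<^sub>R v + h \<in> ?H'" using v c(1) xh(3) by (intro convex_cone_hull_add convex_cone_hull_mul) auto
  moreover have "c *\<^sub>R v + h = (1 - b) *\<^sub>R g" using xh(1) b(2) by (simp add: algebra_simps)
  ultimately have "(1 - b) *\<^sub>R g \<in> ?H'" by simp
  then have gH: "(1 / (1 - b)) *\<^sub>R ((1 - b) *\<^sub>R g) \<in> ?H'"
    by (rule convex_cone_hull_mul) (use \<open>b < 1\<close> in simp)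
  have "(1 / (1 - b)) *\<^sub>R ((1 - b) *\<^sub>R g) = g" using \<open>b < 1\<close> unfolding scaleR_scaleR by simp
  then have "g \<in> ?H'" using gH by metis
  then have "insert v (insert g G) \<subseteq> ?H'" by (auto intro: hull_inc)
  then have "?H \<subseteq> ?H'" by (rule hull_minimal) (rule convex_cone_convex_cone_hull)
  then have eq: "?H = ?H'" using sub by blast
  show ?case
    using insert.IH insert.prems unfolding eq by blast
qed simp

lemma cone_face_generated:
  assumes \<eta>: "convex_cone \<eta>" and \<tau>: "convex_cone \<tau>" "\<tau> \<subseteq> \<eta>" and g: "g \<in> \<eta>"
  defines "E \<equiv> {z \<in> \<eta>. \<exists>c>0. \<exists>t\<in>\<tau>. g + t - c *\<^sub>R z \<in> \<eta>}"
  shows "cone_face E \<eta>" "\<tau> \<subseteq> E" "g \<in> E"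
proof -
  note add = convex_cone_add[OF \<eta>] and sc = convex_cone_scaleR[OF \<eta>]
  have 0: "0 \<in> \<tau>" "0 \<in> \<eta>" using \<eta> \<tau>(1) convex_cone_contains_0 by blast+
  show "g \<in> E" unfolding E_def using g 0 by (auto intro!: exI[of _ 1] bexI[of _ 0])
  show tE: "\<tau> \<subseteq> E"
  proof
    fix t assume "t \<in> \<tau>"
    moreover have "g + t - 1 *\<^sub>R t \<in> \<eta>" using g by simp
    ultimately show "t \<in> E" unfolding E_def using \<tau>(2) zero_less_one by blast
  qed
  have cE: "convex_cone E" unfolding convex_cone_iff
  proof (intro conjI ballI allI impI)
    show "0 \<in> E" using tE 0 by blast
    fix x y assume "x \<in> E" "y \<in> E"
    then obtain c s d t where x: "x \<in> \<eta>" "c > 0" "s \<in> \<tau>" "g + s - c *\<^sub>R x \<in> \<eta>"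
      and y: "y \<in> \<eta>" "d > 0" "t \<in> \<tau>" "g + t - d *\<^sub>R y \<in> \<eta>" unfolding E_def by blast
    define m where "m = min c d"
    have m: "m > 0" "c - m \<ge> 0" "d - m \<ge> 0" unfolding m_def using x(2) y(2) by auto
    have "(g + s - c *\<^sub>R x) + (c - m) *\<^sub>R x \<in> \<eta>" "(g + t - d *\<^sub>R y) + (d - m) *\<^sub>R y \<in> \<eta>"
      using x y m by (auto intro!: add sc)
    then have "(1/2) *\<^sub>R (((g + s - c *\<^sub>R x) + (c - m) *\<^sub>R x) + ((g + t - d *\<^sub>R y) + (d - m) *\<^sub>R y)) \<in> \<eta>"
      by (intro sc add[of "g + s - c *\<^sub>R x + _"]) auto
    also have "((g + s - c *\<^sub>R x) + (c - m) *\<^sub>R x) + ((g + t - d *\<^sub>R y) + (d - m) *\<^sub>R y)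
      = 2 *\<^sub>R g + (s + t) - m *\<^sub>R (x + y)"
      by (simp add: algebra_simps scaleR_2)
    also have "(1/2) *\<^sub>R (2 *\<^sub>R g + (s + t) - m *\<^sub>R (x + y)) = g + (1/2) *\<^sub>R (s + t) - (m / 2) *\<^sub>R (x + y)"
      by (simp add: scaleR_add_right scaleR_diff_right)
    finally have "g + (1/2) *\<^sub>R (s + t) - (m / 2) *\<^sub>R (x + y) \<in> \<eta>" .
    moreover have "(1/2) *\<^sub>R (s + t) \<in> \<tau>"
      using \<tau>(1) x(3) y(3) by (intro convex_cone_scaleR convex_cone_add) auto
    moreover have "m / 2 > 0" "x + y \<in> \<eta>" using m(1) add x(1) y(1) by auto
    ultimately show "x + y \<in> E" unfolding E_def by blast
  next
    fix x and k :: real assume "x \<in> E" "k \<ge> 0"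
    then obtain c s where x: "x \<in> \<eta>" "c > 0" "s \<in> \<tau>" "g + s - c *\<^sub>R x \<in> \<eta>" unfolding E_def by blast
    show "k *\<^sub>R x \<in> E"
    proof (cases "k = 0")
      case True
      then show ?thesis using tE 0 by auto
    next
      case False
      then have "g + s - (c / k) *\<^sub>R (k *\<^sub>R x) \<in> \<eta>" "c / k > 0" "k *\<^sub>R x \<in> \<eta>"
        using x \<open>k \<ge> 0\<close> sc by auto
      then show ?thesis unfolding E_def using x(3) by blast
    qed
  qed
  show "cone_face E \<eta>"
  proof (rule cone_faceI[OF \<eta> cE])
    show "E \<subseteq> \<eta>" unfolding E_def by blast
    fix a b assume ab: "a \<in> \<eta>" "b \<in> \<eta>" "a + b \<in> E"
    then obtain c s where c: "c > 0" "s \<in> \<tau>" "g + s - c *\<^sub>R (a + b) \<in> \<eta>" unfolding E_def by blast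
    then have "(g + s - c *\<^sub>R (a + b)) + c *\<^sub>R b \<in> \<eta>" using ab by (intro add sc) auto
    then have "g + s - c *\<^sub>R a \<in> \<eta>" by (simp add: algebra_simps)
    then show "a \<in> E" unfolding E_def using ab(1) c by blast
  qed
qed

text \<open>A face \<open>\<tau>\<close> of \<open>\<eta>\<close> that is maximal among those not containing \<open>v\<close>: modulo \<open>span \<tau>\<close>, every face
  of \<open>\<eta>\<close> generated by a generator contains \<open>v\<close>, so that \<open>\<eta>\<close> becomes the ray of \<open>v\<close>.\<close>

lemma fan_face_avoiding:
  assumes F: "rational_fan F" and \<eta>: "\<eta> \<in> Cones F" and v: "v \<in> \<eta>" "v \<noteq> 0"
  obtains \<tau> where "\<tau> \<in> Cones F" "\<tau> \<subseteq> \<eta>" "v \<notin> \<tau>" "dim \<eta> \<le> dim \<tau> + 1"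
proof -
  note C\<eta> = fan_convex_cone[OF F \<eta>]
  have pointed: "x = 0" if "x \<in> \<eta>" "- x \<in> \<eta>" for x
    using F \<eta> that unfolding rational_fan_def strongly_convex_def by blast
  have "cone_face {0} \<eta>"
  proof (rule cone_faceI[OF C\<eta>])
    show "convex_cone {0::'a}" "{0} \<subseteq> \<eta>" using fan_zero[OF F \<eta>] by auto
    fix a b assume "a \<in> \<eta>" "b \<in> \<eta>" "a + b \<in> {0}"
    then have "- a \<in> \<eta>" using minus_unique[of a b] by auto
    then show "a \<in> {0}" using pointed \<open>a \<in> \<eta>\<close> by auto
  qed
  then have z: "{0} \<in> Cones F" by (rule fan_face[OF F \<eta>])
  define A where "A = {\<tau> \<in> Cones F. \<tau> \<subseteq> \<eta> \<and> v \<notin> \<tau>}"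
  have "finite A" "A \<noteq> {}" unfolding A_def using fan_finite(1)[OF F] z fan_zero[OF F \<eta>] v(2) by auto
  then have M: "Max (dim ` A) \<in> dim ` A" "\<And>\<xi>. \<xi> \<in> A \<Longrightarrow> dim \<xi> \<le> Max (dim ` A)"
    by auto
  then obtain \<tau> where \<tau>A: "\<tau> \<in> A" "\<And>\<xi>. \<xi> \<in> A \<Longrightarrow> dim \<xi> \<le> dim \<tau>" by force
  then have \<tau>: "\<tau> \<in> Cones F" "\<tau> \<subseteq> \<eta>" "v \<notin> \<tau>" unfolding A_def by auto
  note C\<tau> = fan_convex_cone[OF F \<tau>(1)]
  note face = cone_face_summand[OF C\<eta> fan_subset_face[OF F \<eta> \<tau>(1,2)]]
  let ?q = "quot_map (span \<tau>)"
  note ql = quot_map(1)[OF subspace_span[of \<tau>]] and q0 = quot_map(2)[OF subspace_span[of \<tau>]]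
  obtain G where G: "finite G" "\<eta> = convex_cone hull G"
    using fan_rational_cone[OF F \<eta>] unfolding rational_cone_def by blast
  define H where "H = {h \<in> ?q ` G. h \<noteq> 0}"
  have q\<eta>: "?q ` \<eta> = convex_cone hull (insert (?q v) H)"
  proof
    have "?q ` G \<subseteq> convex_cone hull (insert (?q v) H)"
    proof
      fix h assume "h \<in> ?q ` G"
      then show "h \<in> convex_cone hull (insert (?q v) H)"
        by (cases "h = 0") (auto simp: H_def convex_cone_hull_contains_0 intro: hull_inc)
    qed
    then show "?q ` \<eta> \<subseteq> convex_cone hull (insert (?q v) H)"
      unfolding G(2) convex_cone_hull_image[OF ql] by (intro hull_minimal convex_cone_convex_cone_hull)
    have "H \<subseteq> ?q ` \<eta>" unfolding H_def G(2) by (auto intro: hull_inc)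
    then show "convex_cone hull (insert (?q v) H) \<subseteq> ?q ` \<eta>"
      using v(1) C\<eta> ql by (intro hull_minimal convex_cone_linear_image) auto
  qed
  have "convex_cone hull (insert (?q v) H) = convex_cone hull {?q v}"
  proof (rule convex_cone_hull_eq_ray)
    show "finite H" unfolding H_def using G(1) by simp
    show "- ?q v \<notin> convex_cone hull (insert (?q v) H)"
    proof
      assume "- ?q v \<in> convex_cone hull (insert (?q v) H)"
      then obtain x where x: "x \<in> \<eta>" "- ?q v = ?q x" unfolding q\<eta>[symmetric] by blast
      then have "?q (v + x) = 0" by (simp add: linear_add[OF ql] eq_neg_iff_add_eq_0 add.commute flip: x(2))
      then have "v + x \<in> span \<tau>" using q0 by blast
      then have "v + x \<in> \<tau>"
        using fan_span_Int[OF F \<eta> \<tau>(1,2)] convex_cone_add[OF C\<eta> v(1) x(1)] by blast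
      then show False using face[OF v(1) x(1)] \<tau>(3) by blast
    qed
    show "\<forall>h\<in>H. \<exists>c>0. h - c *\<^sub>R ?q v \<in> convex_cone hull (insert (?q v) H)"
    proof
      fix h assume "h \<in> H"
      then obtain g where g: "g \<in> G" "h = ?q g" "?q g \<noteq> 0" unfolding H_def by blast
      then have g\<eta>: "g \<in> \<eta>" unfolding G(2) by (simp add: hull_inc)
      define E where "E = {z \<in> \<eta>. \<exists>c>0. \<exists>t\<in>\<tau>. g + t - c *\<^sub>R z \<in> \<eta>}"
      note E = cone_face_generated[OF C\<eta> C\<tau> \<tau>(2) g\<eta>, folded E_def]
      have EF: "E \<in> Cones F" by (rule fan_face[OF F \<eta> E(1)])
      have "v \<in> E"
      proof (rule ccontr)
        assume "v \<notin> E"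
        then have "E \<in> A" unfolding A_def using EF cone_face_subset[OF E(1)] by blast
        then have "\<tau> = E" using fan_cone_eqI[OF F EF \<tau>(1) E(2)] \<tau>A(2) by blast
        then have "?q g = 0" using E(3) q0 span_base by blast
        then show False using g(3) by blast
      qed
      then obtain c t where c: "c > 0" "t \<in> \<tau>" "g + t - c *\<^sub>R v \<in> \<eta>" unfolding E_def by blast
      have "?q t = 0" using q0 c(2) span_base by blast
      then have "?q (g + t - c *\<^sub>R v) = h - c *\<^sub>R ?q v"
        using g(2) by (simp add: linear_add[OF ql] linear_diff[OF ql] linear_scale[OF ql])
      then have "h - c *\<^sub>R ?q v \<in> ?q ` \<eta>" using c(3) by (metis imageI)
      then show "\<exists>c>0. h - c *\<^sub>R ?q v \<in> convex_cone hull (insert (?q v) H)"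
        unfolding q\<eta>[symmetric] using c(1) by blast
    qed
  qed
  then have ray: "?q ` \<eta> = convex_cone hull {?q v}" using q\<eta> by simp
  have "\<eta> \<subseteq> span (insert v \<tau>)"
  proof
    fix x assume "x \<in> \<eta>"
    then obtain c where "?q x = c *\<^sub>R ?q v" using ray convex_cone_hull_singleton by blast
    then have "?q (x - c *\<^sub>R v) = 0" by (simp add: linear_diff[OF ql] linear_scale[OF ql])
    then have "x - c *\<^sub>R v \<in> span \<tau>" using q0 by blast
    then show "x \<in> span (insert v \<tau>)" using span_breakdown_eq by blast
  qed
  moreover have "fin_gen (insert v \<tau>)"
  proof (rule fin_gen_mono[OF fan_fin_gen[OF F \<eta>]])
    show "insert v \<tau> \<subseteq> span \<eta>" using v(1) \<tau>(2) span_superset[of \<eta>] by blast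
  qed
  ultimately have "dim \<eta> \<le> dim (insert v \<tau>)" by (rule dim_mono_fin_gen[rotated])
  also have "v \<notin> span \<tau>" using fan_span_Int[OF F \<eta> \<tau>(1,2) v(1)] \<tau>(3) by blast
  then have "dim (insert v \<tau>) = dim \<tau> + 1" by (rule dim_insert_fin_gen[OF fan_fin_gen[OF F \<tau>(1)]])
  finally show thesis using that \<tau> by blast
qed

lemma rel_interior_segment:
  fixes S :: "'a::real_normed_vector set"
  assumes v: "v \<in> rel_interior S" and x: "x \<in> S"
  obtains e where "e > 0" "v + e *\<^sub>R (v - x) \<in> S"
proof -
  obtain r where r: "r > 0" "ball v r \<inter> affine hull S \<subseteq> S" "v \<in> S"
    using v unfolding mem_rel_interior_ball by blast
  define e where "e = r / (2 * (norm (v - x) + 1))"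
  have n: "norm (v - x) + 1 > 0" by (simp add: add_nonneg_pos)
  have e: "e > 0" unfolding e_def using r(1) n by simp
  have "e * norm (v - x) \<le> e * (norm (v - x) + 1)" using e by simp
  also have "\<dots> = r / 2" unfolding e_def using n by (simp add: field_simps)
  also have "\<dots> < r" using r(1) by simp
  finally have "v + e *\<^sub>R (v - x) \<in> ball v r" using e by (simp add: dist_norm)
  moreover have "(1 + e) *\<^sub>R v + (- e) *\<^sub>R x \<in> affine hull S"
    using r(3) x by (intro mem_affine[OF affine_affine_hull]) (auto intro: hull_inc)
  then have "v + e *\<^sub>R (v - x) \<in> affine hull S" by (simp add: algebra_simps)
  ultimately show thesis using that e r(2) by blast
qed

lemma is_normal_vector_mono:
  assumes "span \<sigma>' = span \<sigma>" "span \<tau>' = span \<tau>" "\<sigma> \<subseteq> \<sigma>'" "is_normal_vector N \<sigma> \<tau> n"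
  shows "is_normal_vector N \<sigma>' \<tau>' n"
  using assms(3,4) unfolding is_normal_vector_def sublat_def assms(1,2) by blast

lemma fan_normal_vectors_same_side:
  assumes F: "rational_fan F" and c: "\<kappa> \<in> Cones F" "\<kappa>1 \<in> Cones F" "\<kappa>2 \<in> Cones F" "\<kappa> \<subseteq> \<kappa>1" "\<kappa> \<subseteq> \<kappa>2"
    and d: "dim \<kappa>1 = dim \<kappa> + 1" "dim \<kappa>2 = dim \<kappa> + 1"
    and n: "is_normal_vector (Lat F) \<kappa>1 \<kappa> n1" "is_normal_vector (Lat F) \<kappa>2 \<kappa> n2"
    and k: "n2 - k *\<^sub>R n1 \<in> span \<kappa>" "k > 0"
  shows "\<kappa>1 = \<kappa>2"
proof -
  obtain x y where x: "n1 = x + y" "x \<in> \<kappa>1" "y \<in> span \<kappa>" using n(1) unfolding is_normal_vector_def by blast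
  obtain x' y' where x': "n2 = x' + y'" "x' \<in> \<kappa>2" "y' \<in> span \<kappa>" using n(2) unfolding is_normal_vector_def by blast
  have "n1 \<notin> span \<kappa>" using fan_normal_vector_notin_span[OF F c(2,1) _ n(1)] d by simp
  then have xn: "x \<notin> span \<kappa>" using x(1,3) span_add by blast
  have "x' - k *\<^sub>R x = (n2 - k *\<^sub>R n1) - y' + k *\<^sub>R y" unfolding x(1) x'(1) by (simp add: algebra_simps)
  also have "\<dots> \<in> span \<kappa>" by (rule span_add[OF span_diff[OF k(1) x'(3)] span_scale[OF x(3)]])
  finally show ?thesis by (rule fan_same_side[OF F c d x(2) xn x'(2) _ k(2)])
qed


context
  fixes F :: "'a::real_normed_vector wfan" and \<sigma> \<rho> :: "'a set" and v :: 'a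
  assumes F: "tropical_fan F" and \<sigma>: "\<sigma> \<in> Cones F" and v: "v \<noteq> 0" "\<rho> = convex_cone hull {v}" "v \<in> rel_interior \<sigma>"
    and trB: "tropical_fan (blow_up F \<sigma> \<rho>)"
begin

private abbreviation "B \<equiv> blow_up F \<sigma> \<rho>"
private abbreviation "join \<tau> \<equiv> {x + y | x y. x \<in> \<tau> \<and> y \<in> \<rho>}"

private lemma RU: "rational_fan F" by (rule tropical_rational_fan[OF F])
private lemma RB: "rational_fan B" by (rule tropical_rational_fan[OF trB])

private lemma v\<sigma>: "v \<in> \<sigma>"
  using v(3) unfolding mem_rel_interior by blast

private lemma v_mem_iff:
  assumes \<eta>: "\<eta> \<in> Cones F" shows "v \<in> \<eta> \<longleftrightarrow> \<sigma> \<subseteq> \<eta>"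
proof
  assume "v \<in> \<eta>"
  then have vI: "v \<in> \<sigma> \<inter> \<eta>" using v\<sigma> by blast
  have I: "\<sigma> \<inter> \<eta> \<in> Cones F" by (rule fan_Int[OF RU \<sigma> \<eta>])
  show "\<sigma> \<subseteq> \<eta>"
  proof
    fix x assume x: "x \<in> \<sigma>"
    obtain e where e: "e > 0" "v + e *\<^sub>R (v - x) \<in> \<sigma>" using rel_interior_segment[OF v(3) x] .
    have "e *\<^sub>R x + (v + e *\<^sub>R (v - x)) = (1 + e) *\<^sub>R v" by (simp add: algebra_simps)
    moreover have "(1 + e) *\<^sub>R v \<in> \<sigma> \<inter> \<eta>"
      using e(1) vI fan_convex_cone[OF RU I] by (intro convex_cone_scaleR) auto
    ultimately have s: "e *\<^sub>R x + (v + e *\<^sub>R (v - x)) \<in> \<sigma> \<inter> \<eta>" by simp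
    have ex: "e *\<^sub>R x \<in> \<sigma>" using e(1) x fan_convex_cone[OF RU \<sigma>] by (intro convex_cone_scaleR) auto
    have "cone_face (\<sigma> \<inter> \<eta>) \<sigma>" by (rule fan_subset_face[OF RU \<sigma> I]) blast
    from cone_face_summand[OF fan_convex_cone[OF RU \<sigma>] this ex e(2) s]
    have "(1 / e) *\<^sub>R (e *\<^sub>R x) \<in> \<sigma> \<inter> \<eta>"
      by (rule convex_cone_scaleR[OF fan_convex_cone[OF RU I], rotated]) (use e(1) in simp)
    then show "x \<in> \<eta>" using e(1) by simp
  qed
qed (use v\<sigma> in blast)

private lemma v_notin_span:
  assumes "\<eta> \<in> Cones F" "\<tau> \<in> Cones F" "\<tau> \<subseteq> \<eta>" "\<sigma> \<subseteq> \<eta>" "\<not> \<sigma> \<subseteq> \<tau>"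
  shows "v \<notin> span \<tau>"
  using fan_span_Int[OF RU assms(1,2,3)] v_mem_iff assms by blast

private lemma Cones_B: "Cones B = {\<eta> \<in> Cones F. \<not> \<sigma> \<subseteq> \<eta>} \<union>
    {join \<tau> | \<tau> \<eta>. \<eta> \<in> Cones F \<and> \<sigma> \<subseteq> \<eta> \<and> \<tau> \<in> Cones F \<and> \<tau> \<subseteq> \<eta> \<and> \<not> \<sigma> \<subseteq> \<tau>}"
proof -
  have eq: "\<eta> \<in> Cones F \<and> \<sigma> \<subseteq> \<eta> \<and> cone_face \<tau> \<eta> \<and> \<not> \<sigma> \<subseteq> \<tau> \<longleftrightarrow>
    \<eta> \<in> Cones F \<and> \<sigma> \<subseteq> \<eta> \<and> \<tau> \<in> Cones F \<and> \<tau> \<subseteq> \<eta> \<and> \<not> \<sigma> \<subseteq> \<tau>" for \<tau> \<eta>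
    using fan_face[OF RU] fan_subset_face[OF RU] cone_face_subset by blast
  show ?thesis unfolding blow_up_def wfan.select_convs eq ..
qed

private lemma Lat_B: "Lat B = Lat F" unfolding blow_up_def by simp

private lemma v\<rho>: "v \<in> \<rho>" "0 \<in> \<rho>"
  unfolding v(2) by (simp add: hull_inc, rule convex_cone_hull_contains_0)

private lemma join_subset:
  assumes "\<eta> \<in> Cones F" "\<tau> \<subseteq> \<eta>" "\<sigma> \<subseteq> \<eta>" shows "join \<tau> \<subseteq> \<eta>"
proof -
  note C = fan_convex_cone[OF RU assms(1)]
  have "\<rho> \<subseteq> \<eta>" unfolding v(2) using v\<sigma> assms(3) C by (intro hull_minimal) auto
  then show ?thesis using assms(2) convex_cone_add[OF C] by blast
qed

private lemma subset_join: "\<tau> \<subseteq> join \<tau>"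
  using v\<rho>(2) by force

private lemma scale_v_join:
  assumes "\<tau> \<in> Cones F" "c \<ge> 0" shows "c *\<^sub>R v \<in> join \<tau>"
proof -
  have "c *\<^sub>R v \<in> \<rho>" unfolding v(2) convex_cone_hull_singleton using assms(2) by blast
  then have "0 + c *\<^sub>R v \<in> join \<tau>" using fan_zero[OF RU assms(1)] by blast
  then show ?thesis by simp
qed

private lemma span_join:
  assumes \<tau>: "\<tau> \<in> Cones F" shows "span (join \<tau>) = span (insert v \<tau>)"
proof
  have "join \<tau> \<subseteq> span (insert v \<tau>)"
  proof
    fix z assume "z \<in> join \<tau>"
    then obtain x c where "x \<in> \<tau>" "z = x + c *\<^sub>R v" unfolding v(2) convex_cone_hull_singleton by blast
    then show "z \<in> span (insert v \<tau>)" by (auto intro!: span_add span_scale intro: span_base)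
  qed
  then show "span (join \<tau>) \<subseteq> span (insert v \<tau>)" by (simp add: span_minimal)
  have "insert v \<tau> \<subseteq> join \<tau>" using subset_join scale_v_join[OF \<tau>, of 1] by auto
  then show "span (insert v \<tau>) \<subseteq> span (join \<tau>)" by (rule span_mono)
qed

private lemma dim_join:
  assumes "\<eta> \<in> Cones F" "\<tau> \<in> Cones F" "\<tau> \<subseteq> \<eta>" "\<sigma> \<subseteq> \<eta>" "\<not> \<sigma> \<subseteq> \<tau>"
  shows "dim (join \<tau>) = dim \<tau> + 1"
proof -
  have "dim (join \<tau>) = dim (insert v \<tau>)" using arg_cong[OF span_join[OF assms(2)], of dim] unfolding dim_span .
  then show ?thesis using dim_insert_fin_gen[OF fan_fin_gen[OF RU assms(2)] v_notin_span[OF assms]] by simp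
qed

private lemma join_in_B:
  assumes "\<eta> \<in> Cones F" "\<tau> \<in> Cones F" "\<tau> \<subseteq> \<eta>" "\<sigma> \<subseteq> \<eta>" "\<not> \<sigma> \<subseteq> \<tau>"
  shows "join \<tau> \<in> Cones B"
  unfolding Cones_B using assms by blast

private lemma B_subset:
  assumes "\<kappa> \<in> Cones B" obtains \<eta> where "\<eta> \<in> Cones F" "\<kappa> \<subseteq> \<eta>"
  using assms join_subset unfolding Cones_B by blast

private lemma fdim_B: "fdim B = fdim F"
proof (rule antisym)
  have le: "dim \<kappa> \<le> fdim F" if \<kappa>: "\<kappa> \<in> Cones B" for \<kappa>
  proof -
    obtain \<eta> where "\<eta> \<in> Cones F" "\<kappa> \<subseteq> \<eta>" using B_subset[OF \<kappa>] .
    then show ?thesis using fan_dim_mono[OF RU] fan_dim_le[OF RU] order_trans by blast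
  qed
  show "fdim B \<le> fdim F"
    unfolding fdim_def[of B] using fan_finite[OF RB] le by simp
  obtain \<eta> where \<eta>: "\<eta> \<in> cones_dim F (fdim F)" "\<sigma> \<subseteq> \<eta>"
    using tropical_facet_above[OF F \<sigma>] .
  then have \<eta>F: "\<eta> \<in> Cones F" "dim \<eta> = fdim F" unfolding cones_dim_def by auto
  obtain \<tau> where \<tau>: "\<tau> \<in> Cones F" "\<tau> \<subseteq> \<eta>" "v \<notin> \<tau>" "dim \<eta> \<le> dim \<tau> + 1"
    using fan_face_avoiding[OF RU \<eta>F(1) _ v(1)] v\<sigma> \<eta>(2) by blast
  have n: "\<not> \<sigma> \<subseteq> \<tau>" using v\<sigma> \<tau>(3) by blast
  have "dim (join \<tau>) \<le> fdim B"
    by (rule fan_dim_le[OF RB join_in_B[OF \<eta>F(1) \<tau>(1,2) \<eta>(2) n]])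
  then show "fdim F \<le> fdim B"
    using dim_join[OF \<eta>F(1) \<tau>(1,2) \<eta>(2) n] \<tau>(4) \<eta>F(2) by simp
qed

private lemma B_facet:
  assumes \<xi>: "\<xi> \<in> cones_dim B (fdim B)" and \<eta>: "\<eta> \<in> Cones F" "\<xi> \<subseteq> \<eta>"
  shows "\<eta> \<in> cones_dim F (fdim F)" "span \<xi> = span \<eta>" "wt B \<xi> = wt F \<eta>"
proof -
  have \<xi>': "dim \<xi> = fdim F" using \<xi> fdim_B unfolding cones_dim_def by simp
  have full: "dim \<zeta> = fdim F" if "\<zeta> \<in> Cones F" "\<xi> \<subseteq> \<zeta>" for \<zeta>
    using fan_dim_mono[OF RU that] fan_dim_le[OF RU that(1)] \<xi>' by simp
  show top: "\<eta> \<in> cones_dim F (fdim F)" using full[OF \<eta>] \<eta>(1) unfolding cones_dim_def by blast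
  show "span \<xi> = span \<eta>"
    using full[OF \<eta>] \<xi>' by (intro span_eq_fin_gen[OF fan_fin_gen[OF RU \<eta>(1)] subset_trans[OF \<eta>(2) span_superset]]) simp
  have "(THE \<eta>. \<eta> \<in> facets F \<and> \<xi> \<subseteq> \<eta>) = \<eta>"
  proof (rule the_equality)
    show "\<eta> \<in> facets F \<and> \<xi> \<subseteq> \<eta>" using top \<eta>(2) tropical_facets[OF F] by blast
    fix \<zeta> assume "\<zeta> \<in> facets F \<and> \<xi> \<subseteq> \<zeta>"
    then have \<zeta>: "\<zeta> \<in> Cones F" "\<xi> \<subseteq> \<zeta>" unfolding facets_def by auto
    have I: "\<zeta> \<inter> \<eta> \<in> Cones F" "\<xi> \<subseteq> \<zeta> \<inter> \<eta>" using fan_Int[OF RU \<zeta>(1) \<eta>(1)] \<zeta>(2) \<eta>(2) by auto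
    have "\<zeta> \<inter> \<eta> = \<zeta>" "\<zeta> \<inter> \<eta> = \<eta>"
      using fan_cone_eqI[OF RU \<zeta>(1) I(1)] fan_cone_eqI[OF RU \<eta>(1) I(1)] full[OF I] full[OF \<zeta>] full[OF \<eta>] by auto
    then show "\<zeta> = \<eta>" by blast
  qed
  then show "wt B \<xi> = wt F \<eta>" unfolding blow_up_def by simp
qed

private lemma B_codim1_in_hyperplane:
  assumes \<kappa>: "\<kappa> \<in> codim1 B" and \<zeta>: "\<zeta> \<in> codim1 F" "\<kappa> \<subseteq> \<zeta>" and na: "normal_at K F \<zeta>" and K: "0 \<in> K"
  shows "normal_at K B \<kappa>"
proof -
  note \<kappa>' = codim1D[OF \<kappa>] and \<zeta>' = codim1D[OF \<zeta>(1)]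
  have dk: "dim \<kappa> = dim \<zeta>" using \<kappa>'(2) \<zeta>'(2) fdim_B by simp
  have sp: "span \<kappa> = span \<zeta>"
    using dk by (intro span_eq_fin_gen[OF fan_fin_gen[OF RU \<zeta>'(1)] subset_trans[OF \<zeta>(2) span_superset]]) simp
  have "\<exists>\<eta>. \<eta> \<in> Cones F \<and> \<xi> \<subseteq> \<eta>" if "\<xi> \<in> top_star B \<kappa>" for \<xi>
    using B_subset top_starD(1)[OF that] by metis
  then obtain \<beta> where \<beta>: "\<And>\<xi>. \<xi> \<in> top_star B \<kappa> \<Longrightarrow> \<beta> \<xi> \<in> Cones F" "\<And>\<xi>. \<xi> \<in> top_star B \<kappa> \<Longrightarrow> \<xi> \<subseteq> \<beta> \<xi>"
    by metis
  note bf = B_facet[OF top_starD(4) \<beta>]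
  have z\<beta>: "\<zeta> \<subseteq> \<beta> \<xi>" if \<xi>: "\<xi> \<in> top_star B \<kappa>" for \<xi>
  proof -
    have I: "\<beta> \<xi> \<inter> \<zeta> \<in> Cones F" "\<kappa> \<subseteq> \<beta> \<xi> \<inter> \<zeta>"
      using fan_Int[OF RU \<beta>(1)[OF \<xi>] \<zeta>'(1)] \<beta>(2)[OF \<xi>] top_starD(3)[OF \<xi>] \<zeta>(2) by auto
    then have "\<beta> \<xi> \<inter> \<zeta> = \<zeta>" using fan_cone_eqI[OF RU \<zeta>'(1) I(1)] fan_dim_mono[OF RU I] dk by auto
    then show ?thesis by blast
  qed
  show ?thesis
  proof (rule normal_at_transfer[OF na _ K, where \<gamma> = \<beta> and p = "\<lambda>x. x" and c = 1])
    show "finite (top_star F \<zeta>)" using finite_top_star[OF fan_finite(1)[OF RU]] .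
    show "\<beta> ` top_star B \<kappa> \<subseteq> top_star F \<zeta>"
      using bf(1) z\<beta> unfolding top_star_def[of F] by blast
    show "\<exists>n. is_normal_vector (Lat F) \<eta> \<zeta> n" if "\<eta> \<in> top_star F \<zeta> - \<beta> ` top_star B \<kappa>" for \<eta>
      using normal_vector_top_star[OF RU \<zeta>(1)] that by blast
    show "linear (\<lambda>x::'a. x)" by (rule linear_ident)
    show "(\<lambda>x. x) ` \<kappa> \<subseteq> span \<zeta>" using \<zeta>(2) by (auto intro: span_base)
    show "inj_on \<beta> (top_star B \<kappa>)"
    proof (rule inj_onI)
      fix \<xi> \<xi>' assume \<xi>: "\<xi> \<in> top_star B \<kappa>" and \<xi>': "\<xi>' \<in> top_star B \<kappa>" and eq: "\<beta> \<xi> = \<beta> \<xi>'"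
      note t = top_starD[OF \<xi>] and t' = top_starD[OF \<xi>'] and \<eta> = \<beta>(1)[OF \<xi>]
      have d: "dim \<xi> = dim \<kappa> + 1" "dim \<xi>' = dim \<kappa> + 1" using t(2) t'(2) \<kappa>'(2) by auto
      obtain x where x: "x \<in> \<xi>" "x \<notin> span \<kappa>"
        using fan_not_subset_span[OF RB t(1) \<kappa>'(1)] d by auto
      obtain x' where x': "x' \<in> \<xi>'" "x' \<notin> span \<kappa>"
        using fan_not_subset_span[OF RB t'(1) \<kappa>'(1)] d by auto
      have x\<eta>: "x \<in> \<beta> \<xi>" "x' \<in> \<beta> \<xi>" using x(1) x'(1) \<beta>(2)[OF \<xi>] \<beta>(2)[OF \<xi>'] eq by auto
      have "insert x \<kappa> \<subseteq> span \<xi>" using x(1) t(3) span_superset[of \<xi>] by blast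
      then have "span (insert x \<kappa>) = span \<xi>"
        using dim_insert_fin_gen[OF fan_fin_gen[OF RB \<kappa>'(1)] x(2)] d(1)
        by (intro span_eq_fin_gen[OF fan_fin_gen[OF RB t(1)]]) simp_all
      then have "x' \<in> span (insert x \<kappa>)" using bf(2)[OF \<xi> \<xi> \<xi>] x\<eta>(2) span_base by blast
      then obtain c where c: "x' - c *\<^sub>R x \<in> span \<kappa>" using span_breakdown_eq by blast
      have "c > 0"
      proof (rule ccontr)
        assume "\<not> c > 0"
        then have cx: "(- c) *\<^sub>R x \<in> \<beta> \<xi>" using x\<eta>(1) by (intro convex_cone_scaleR[OF fan_convex_cone[OF RU \<eta>]]) auto
        have eq': "x' + (- c) *\<^sub>R x = x' - c *\<^sub>R x" by simp
        have "x' + (- c) *\<^sub>R x \<in> \<beta> \<xi>" by (rule convex_cone_add[OF fan_convex_cone[OF RU \<eta>] x\<eta>(2) cx])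
        moreover have "x' + (- c) *\<^sub>R x \<in> span \<zeta>" using c sp eq' by simp
        ultimately have "x' + (- c) *\<^sub>R x \<in> \<zeta>" by (rule fan_span_Int[OF RU \<eta> \<zeta>'(1) z\<beta>[OF \<xi>]])
        then have "x' \<in> \<zeta>"
          by (rule cone_face_summand[OF fan_convex_cone[OF RU \<eta>] fan_subset_face[OF RU \<eta> \<zeta>'(1) z\<beta>[OF \<xi>]] x\<eta>(2) cx])
        then show False using x'(2) sp span_base by blast
      qed
      then show "\<xi> = \<xi>'"
        by (rule fan_same_side[OF RB \<kappa>'(1) t(1) t'(1) t(3) t'(3) d x x'(1) c])
    qed
    fix \<xi> assume \<xi>: "\<xi> \<in> top_star B \<kappa>"
    show "wt B \<xi> = 1 * wt F (\<beta> \<xi>)" using bf(3)[OF \<xi> \<xi> \<xi>] by simp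
    show "is_normal_vector (Lat F) (\<beta> \<xi>) \<zeta> n" if "is_normal_vector (Lat B) \<xi> \<kappa> n" for n
      using is_normal_vector_mono[OF bf(2)[OF \<xi> \<xi> \<xi>, symmetric] sp[symmetric] \<beta>(2)[OF \<xi>]] that Lat_B by simp
  qed auto
qed

text \<open>If \<open>\<kappa>\<close> lies in no codimension one cone of \<open>F\<close>, then all facets of the blow-up around \<open>\<kappa>\<close> lie in
  the same facet of \<open>F\<close>, so that there are at most two of them, on opposite sides of \<open>\<kappa>\<close>.\<close>

private lemma B_codim1_interior:
  assumes \<kappa>: "\<kappa> \<in> codim1 B" and no: "\<And>\<zeta>. \<zeta> \<in> codim1 F \<Longrightarrow> \<not> \<kappa> \<subseteq> \<zeta>"
    and K: "0 \<in> K" "\<And>\<xi> k. \<xi> \<in> cones_dim B (fdim B) \<Longrightarrow> k \<in> K \<Longrightarrow> k / wt B \<xi> \<in> K"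
  shows "normal_at K B \<kappa>"
proof (cases "top_star B \<kappa> = {}")
  case True
  then show ?thesis using K(1) unfolding normal_at_def by blast
next
  case False
  then obtain \<xi>1 where \<xi>1: "\<xi>1 \<in> top_star B \<kappa>" by blast
  let ?T = "top_star B \<kappa>"
  note \<kappa>' = codim1D[OF \<kappa>]
  have spans: "span \<xi> = span \<xi>1" if \<xi>: "\<xi> \<in> ?T" for \<xi>
  proof -
    obtain \<eta>1 where \<eta>1: "\<eta>1 \<in> Cones F" "\<xi>1 \<subseteq> \<eta>1" using B_subset[OF top_starD(1)[OF \<xi>1]] .
    obtain \<eta> where \<eta>: "\<eta> \<in> Cones F" "\<xi> \<subseteq> \<eta>" using B_subset[OF top_starD(1)[OF \<xi>]] .
    note b1 = B_facet[OF top_starD(4)[OF \<xi>1] \<eta>1] and b = B_facet[OF top_starD(4)[OF \<xi>] \<eta>]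
    have I: "\<eta> \<inter> \<eta>1 \<in> Cones F" "\<kappa> \<subseteq> \<eta> \<inter> \<eta>1"
      using fan_Int[OF RU \<eta>(1) \<eta>1(1)] \<eta>(2) \<eta>1(2) top_starD(3)[OF \<xi>] top_starD(3)[OF \<xi>1] by auto
    have "\<eta> \<inter> \<eta>1 \<notin> codim1 F" using no I(2) by blast
    then have "dim (\<eta> \<inter> \<eta>1) + 1 \<noteq> fdim F" using I(1) unfolding codim1_def by blast
    moreover have "fdim F \<le> dim (\<eta> \<inter> \<eta>1) + 1" using fan_dim_mono[OF RU I] \<kappa>'(2) fdim_B by simp
    ultimately have "dim \<eta> \<le> dim (\<eta> \<inter> \<eta>1)" "dim \<eta>1 \<le> dim (\<eta> \<inter> \<eta>1)"
      using b(1) b1(1) unfolding cones_dim_def by auto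
    then have "\<eta> \<inter> \<eta>1 = \<eta>" "\<eta> \<inter> \<eta>1 = \<eta>1"
      using fan_cone_eqI[OF RU \<eta>(1) I(1)] fan_cone_eqI[OF RU \<eta>1(1) I(1)] by auto
    then show ?thesis using b(2) b1(2) by simp
  qed
  show ?thesis
  proof (rule normal_atI)
    fix w n
    assume w: "\<And>\<xi>. \<xi> \<in> ?T \<Longrightarrow> w \<xi> \<in> K"
      and n: "\<And>\<xi>. \<xi> \<in> ?T \<Longrightarrow> is_normal_vector (Lat B) \<xi> \<kappa> (n \<xi>)"
      and s: "(\<Sum>\<xi>\<in>?T. w \<xi> *\<^sub>R n \<xi>) \<in> span \<kappa>"
    have d: "dim \<xi> = dim \<kappa> + 1" if "\<xi> \<in> ?T" for \<xi> using top_starD(2)[OF that] \<kappa>'(2) by simp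
    have out: "n \<xi> \<notin> span \<kappa>" if \<xi>: "\<xi> \<in> ?T" for \<xi>
      using fan_normal_vector_notin_span[OF RB top_starD(1)[OF \<xi>] \<kappa>'(1) _ n[OF \<xi>]] d[OF \<xi>] by simp
    have ins: "n \<xi> \<in> span \<xi>" if "\<xi> \<in> ?T" for \<xi>
      using n[OF that] unfolding is_normal_vector_def sublat_def by blast
    have "\<exists>c. n \<xi> - c *\<^sub>R n \<xi>1 \<in> span \<kappa>" if \<xi>: "\<xi> \<in> ?T" for \<xi>
    proof -
      have "insert (n \<xi>1) \<kappa> \<subseteq> span \<xi>1"
        using ins[OF \<xi>1] top_starD(3)[OF \<xi>1] span_superset[of \<xi>1] by blast
      then have "span (insert (n \<xi>1) \<kappa>) = span \<xi>1"
        using dim_insert_fin_gen[OF fan_fin_gen[OF RB \<kappa>'(1)] out[OF \<xi>1]] d[OF \<xi>1]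
        by (intro span_eq_fin_gen[OF fan_fin_gen[OF RB top_starD(1)[OF \<xi>1]]]) simp_all
      then have "n \<xi> \<in> span (insert (n \<xi>1) \<kappa>)" using ins[OF \<xi>] spans[OF \<xi>] by simp
      then show ?thesis using span_breakdown_eq by blast
    qed
    then obtain c where c: "\<And>\<xi>. \<xi> \<in> ?T \<Longrightarrow> n \<xi> - c \<xi> *\<^sub>R n \<xi>1 \<in> span \<kappa>" by metis
    have c0: "c \<xi> \<noteq> 0" if \<xi>: "\<xi> \<in> ?T" for \<xi> using c[OF \<xi>] out[OF \<xi>] by auto
    have same: "\<xi> = \<xi>'" if \<xi>: "\<xi> \<in> ?T" and \<xi>': "\<xi>' \<in> ?T" and pos: "c \<xi>' / c \<xi> > 0" for \<xi> \<xi>'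
    proof (rule fan_normal_vectors_same_side[OF RB \<kappa>'(1) top_starD(1)[OF \<xi>] top_starD(1)[OF \<xi>'] top_starD(3)[OF \<xi>]
          top_starD(3)[OF \<xi>'] d[OF \<xi>] d[OF \<xi>'] n[OF \<xi>] n[OF \<xi>'] _ pos])
      have "(n \<xi>' - c \<xi>' *\<^sub>R n \<xi>1) - (c \<xi>' / c \<xi>) *\<^sub>R (n \<xi> - c \<xi> *\<^sub>R n \<xi>1) \<in> span \<kappa>"
        by (rule span_diff[OF c[OF \<xi>'] span_scale[OF c[OF \<xi>]]])
      then show "n \<xi>' - (c \<xi>' / c \<xi>) *\<^sub>R n \<xi> \<in> span \<kappa>" using c0[OF \<xi>] by (simp add: scaleR_diff_right)
    qed
    have two: "\<xi> = \<xi>' \<or> \<xi> = \<xi>'' \<or> \<xi>' = \<xi>''" if T: "\<xi> \<in> ?T" "\<xi>' \<in> ?T" "\<xi>'' \<in> ?T" for \<xi> \<xi>' \<xi>''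
    proof -
      have "c \<xi>' / c \<xi> > 0 \<or> c \<xi>'' / c \<xi> > 0 \<or> c \<xi>'' / c \<xi>' > 0"
        using c0[OF T(1)] c0[OF T(2)] c0[OF T(3)] by (auto simp: zero_less_divide_iff)
      then show ?thesis using same T by blast
    qed
    have zero: "(\<Sum>\<xi>\<in>?T. u \<xi> * c \<xi>) = 0" if u: "(\<Sum>\<xi>\<in>?T. u \<xi> *\<^sub>R n \<xi>) \<in> span \<kappa>" for u
    proof (rule ccontr)
      assume ne: "(\<Sum>\<xi>\<in>?T. u \<xi> * c \<xi>) \<noteq> 0"
      have "(\<Sum>\<xi>\<in>?T. u \<xi> *\<^sub>R (c \<xi> *\<^sub>R n \<xi>1)) \<in> span \<kappa>"
        using sum_diff_in_span[of ?T n "\<lambda>\<xi>. c \<xi> *\<^sub>R n \<xi>1" \<kappa> u] c u by blast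
      then have "(\<Sum>\<xi>\<in>?T. u \<xi> * c \<xi>) *\<^sub>R n \<xi>1 \<in> span \<kappa>" by (simp add: scaleR_sum_left)
      then have "inverse (\<Sum>\<xi>\<in>?T. u \<xi> * c \<xi>) *\<^sub>R ((\<Sum>\<xi>\<in>?T. u \<xi> * c \<xi>) *\<^sub>R n \<xi>1) \<in> span \<kappa>" by (rule span_scale)
      then show False using out[OF \<xi>1] unfolding scaleR_scaleR left_inverse[OF ne] scaleR_one by blast
    qed
    have zw: "(\<Sum>\<xi>\<in>?T. w \<xi> * c \<xi>) = 0" by (rule zero[OF s])
    have zb: "(\<Sum>\<xi>\<in>?T. wt B \<xi> * c \<xi>) = 0" by (rule zero[OF tropical_balanced[OF trB \<kappa> n]])
    define k where "k = w \<xi>1 / wt B \<xi>1"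
    have b0: "wt B \<xi>1 \<noteq> 0" using tropical_wt_Ints(2)[OF trB top_starD(4)[OF \<xi>1]] .
    have k: "k \<in> K" unfolding k_def using K(2)[OF top_starD(4)[OF \<xi>1] w[OF \<xi>1]] .
    have k1: "w \<xi>1 = k * wt B \<xi>1" unfolding k_def using b0 by simp
    have "w \<xi> = k * wt B \<xi>" if \<xi>: "\<xi> \<in> ?T" for \<xi>
    proof (cases "\<xi> = \<xi>1")
      case True
      then show ?thesis using k1 by simp
    next
      case False
      then have T: "?T = {\<xi>1, \<xi>}" using two[OF \<xi>1 \<xi>] \<xi> \<xi>1 by blast
      have "w \<xi>1 * c \<xi>1 + w \<xi> * c \<xi> = 0" "wt B \<xi>1 * c \<xi>1 + wt B \<xi> * c \<xi> = 0"
        using zw zb False unfolding T by auto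
      then have "w \<xi> * c \<xi> = - (k * (wt B \<xi>1 * c \<xi>1))" "wt B \<xi>1 * c \<xi>1 = - (wt B \<xi> * c \<xi>)"
        using k1 by (simp_all add: eq_neg_iff_add_eq_0 add.commute)
      then have "w \<xi> * c \<xi> = (k * wt B \<xi>) * c \<xi>" by simp
      then show ?thesis using c0[OF \<xi>] by simp
    qed
    then show "\<exists>k\<in>K. \<forall>\<xi>\<in>?T. w \<xi> = k * wt B \<xi>" using k by blast
  qed
qed

lemma normal_at_blow_up:
  assumes na: "\<forall>\<tau>\<in>codim1 F. normal_at K F \<tau>"
    and K: "0 \<in> K" "\<forall>\<xi>\<in>cones_dim B (fdim B). \<forall>k\<in>K. k / wt B \<xi> \<in> K"
  shows "\<forall>\<kappa>\<in>codim1 B. normal_at K B \<kappa>"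
  using B_codim1_in_hyperplane[OF _ _ _ _ K(1)] B_codim1_interior[OF _ _ K(1)] na K(2) by blast

lemma normal_at_blow_down:
  assumes nB: "\<forall>\<kappa>\<in>codim1 B. normal_at K B \<kappa>"
    and nS: "\<forall>\<kappa>\<in>codim1 (star_fan F \<sigma>). normal_at K (star_fan F \<sigma>) \<kappa>" and K: "0 \<in> K"
  shows "\<forall>\<tau>\<in>codim1 F. normal_at K F \<tau>"
proof
  fix \<tau> assume \<tau>: "\<tau> \<in> codim1 F"
  note \<tau>' = codim1D[OF \<tau>]
  show "normal_at K F \<tau>"
  proof (cases "\<sigma> \<subseteq> \<tau>")
    case True
    have "dim (quot_map (span \<sigma>) ` \<tau>) + 1 = fdim (star_fan F \<sigma>)"
      using star_fan_fdim[OF F \<sigma>] dim_star_cone[OF RU \<sigma> \<tau>'(1) True] \<tau>'(2) by simp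
    then have "quot_map (span \<sigma>) ` \<tau> \<in> codim1 (star_fan F \<sigma>)"
      using \<tau>'(1) True unfolding codim1_def star_fan_Cones[OF RU \<sigma>] by blast
    then show ?thesis using normal_at_of_star_fan[OF F \<sigma> \<tau> True K] nS by blast
  next
    case False
    have \<tau>B: "\<tau> \<in> codim1 B"
      using \<tau>' False fdim_B unfolding codim1_def Cones_B by simp
    define \<gamma> where "\<gamma> \<eta> = (if \<sigma> \<subseteq> \<eta> then join \<tau> else \<eta>)" for \<eta>
    have \<gamma>: "\<gamma> \<eta> \<in> cones_dim B (fdim B)" "\<tau> \<subseteq> \<gamma> \<eta>" "\<gamma> \<eta> \<subseteq> \<eta>" if \<eta>: "\<eta> \<in> top_star F \<tau>" for \<eta>
    proof -
      note t = top_starD[OF \<eta>]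
      have "\<gamma> \<eta> \<in> cones_dim B (fdim B) \<and> \<tau> \<subseteq> \<gamma> \<eta> \<and> \<gamma> \<eta> \<subseteq> \<eta>"
      proof (cases "\<sigma> \<subseteq> \<eta>")
        case True
        note a = t(1) \<tau>'(1) t(3) True False
        have jB: "join \<tau> \<in> cones_dim B (fdim B)"
          using join_in_B[OF a] dim_join[OF a] fdim_B \<tau>'(2) unfolding cones_dim_def by simp
        have eq: "\<gamma> \<eta> = join \<tau>" unfolding \<gamma>_def using True by simp
        show ?thesis unfolding eq by (intro conjI jB subset_join join_subset[OF t(1,3) True])
      next
        case False
        then have "\<gamma> \<eta> = \<eta>" "\<eta> \<in> Cones B" unfolding \<gamma>_def Cones_B using t(1) by auto
        then show ?thesis using t(2,3) fdim_B unfolding cones_dim_def by simp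
      qed
      then show "\<gamma> \<eta> \<in> cones_dim B (fdim B)" "\<tau> \<subseteq> \<gamma> \<eta>" "\<gamma> \<eta> \<subseteq> \<eta>" by blast+
    qed
    have na: "normal_at K B \<tau>" using nB \<tau>B by blast
    show ?thesis
    proof (rule normal_at_transfer[OF na _ K, where \<gamma> = \<gamma> and p = "\<lambda>x. x" and c = 1])
      show "finite (top_star B \<tau>)" using finite_top_star[OF fan_finite(1)[OF RB]] .
      show "\<gamma> ` top_star F \<tau> \<subseteq> top_star B \<tau>" using \<gamma> unfolding top_star_def[of B] by blast
      show "\<exists>n. is_normal_vector (Lat B) \<eta> \<tau> n" if "\<eta> \<in> top_star B \<tau> - \<gamma> ` top_star F \<tau>" for \<eta>
        using normal_vector_top_star[OF RB \<tau>B] that by blast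
      show "linear (\<lambda>x::'a. x)" by (rule linear_ident)
      show "(\<lambda>x. x) ` \<tau> \<subseteq> span \<tau>" by (auto intro: span_base)
      show "inj_on \<gamma> (top_star F \<tau>)"
      proof (rule inj_onI)
        fix \<eta> \<eta>' assume \<eta>: "\<eta> \<in> top_star F \<tau>" and \<eta>': "\<eta>' \<in> top_star F \<tau>" and eq: "\<gamma> \<eta> = \<gamma> \<eta>'"
        have I: "\<eta> \<inter> \<eta>' \<in> Cones F" "\<gamma> \<eta> \<subseteq> \<eta> \<inter> \<eta>'"
          using fan_Int[OF RU top_starD(1)[OF \<eta>] top_starD(1)[OF \<eta>']] \<gamma>(3)[OF \<eta>] \<gamma>(3)[OF \<eta>'] eq by auto
        have "fdim F \<le> dim (\<eta> \<inter> \<eta>')"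
          using fan_dim_mono[OF RU I] \<gamma>(1)[OF \<eta>] fdim_B unfolding cones_dim_def by simp
        then have "\<eta> \<inter> \<eta>' = \<eta>" "\<eta> \<inter> \<eta>' = \<eta>'"
          using fan_cone_eqI[OF RU top_starD(1)[OF \<eta>] I(1)] fan_cone_eqI[OF RU top_starD(1)[OF \<eta>'] I(1)]
            top_starD(2)[OF \<eta>] top_starD(2)[OF \<eta>'] by auto
        then show "\<eta> = \<eta>'" by blast
      qed
      fix \<eta> assume \<eta>: "\<eta> \<in> top_star F \<tau>"
      note t = top_starD[OF \<eta>] and bf = B_facet[OF \<gamma>(1)[OF \<eta>] top_starD(1)[OF \<eta>] \<gamma>(3)[OF \<eta>]]
      show "wt F \<eta> = 1 * wt B (\<gamma> \<eta>)" using bf(3) by simp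
      fix n assume n: "is_normal_vector (Lat F) \<eta> \<tau> n"
      have "n \<in> {x + y | x y. x \<in> \<gamma> \<eta> \<and> y \<in> span \<tau>}"
      proof (cases "\<sigma> \<subseteq> \<eta>")
        case True
        then have g: "\<gamma> \<eta> = join \<tau>" unfolding \<gamma>_def by simp
        obtain x y where xy: "n = x + y" "x \<in> \<eta>" "y \<in> span \<tau>" using n unfolding is_normal_vector_def by blast
        have "x \<in> span (insert v \<tau>)"
          using bf(2) span_base[OF xy(2)] span_join[OF \<tau>'(1)] unfolding g by simp
        then obtain c where c: "x - c *\<^sub>R v \<in> span \<tau>" using span_breakdown_eq by blast
        have "c \<ge> 0"
        proof (rule ccontr)
          assume neg: "\<not> c \<ge> 0"
          note C = fan_convex_cone[OF RU t(1)]
          have cv: "(- c) *\<^sub>R v \<in> \<eta>" using neg v\<sigma> True by (intro convex_cone_scaleR[OF C]) auto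
          have "(- c) *\<^sub>R v + x = x - c *\<^sub>R v" by simp
          then have "(- c) *\<^sub>R v + x \<in> span \<tau>" using c by simp
          then have "(- c) *\<^sub>R v + x \<in> \<tau>"
            by (rule fan_span_Int[OF RU t(1) \<tau>'(1) t(3) convex_cone_add[OF C cv xy(2)]])
          then have "(- c) *\<^sub>R v \<in> \<tau>"
            by (rule cone_face_summand[OF C fan_subset_face[OF RU t(1) \<tau>'(1) t(3)] cv xy(2)])
          then have "(1 / (- c)) *\<^sub>R ((- c) *\<^sub>R v) \<in> \<tau>"
            by (rule convex_cone_scaleR[OF fan_convex_cone[OF RU \<tau>'(1)], rotated]) (use neg in simp)
          then have "v \<in> \<tau>" using neg by simp
          then show False using v_mem_iff[OF \<tau>'(1)] \<open>\<not> \<sigma> \<subseteq> \<tau>\<close> by blast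
        qed
        then have "c *\<^sub>R v \<in> \<gamma> \<eta>" unfolding g by (rule scale_v_join[OF \<tau>'(1)])
        moreover have "n = c *\<^sub>R v + ((x - c *\<^sub>R v) + y)" using xy(1) by simp
        ultimately show ?thesis using span_add[OF c xy(3)] by blast
      next
        case False
        then have g: "\<gamma> \<eta> = \<eta>" unfolding \<gamma>_def by simp
        show ?thesis unfolding g using n unfolding is_normal_vector_def by blast
      qed
      then show "is_normal_vector (Lat B) (\<gamma> \<eta>) \<tau> n"
        using n unfolding is_normal_vector_def sublat_def Lat_B bf(2) by blast
    qed auto
  qed
qed

end


section \<open>Stability\<close>

definition div_closed_fans :: "real set \<Rightarrow> tfan set" where
  "div_closed_fans K = {F. tropical_fan F \<and> (\<forall>\<eta>\<in>cones_dim F (fdim F). \<forall>k\<in>K. k / wt F \<eta> \<in> K)}"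

lemma normal_over_of_fan_iso:
  assumes "fan_iso F G" "tropical_fan G" "\<forall>\<tau>\<in>codim1 F. normal_at K F \<tau>"
    and "0 \<in> K" "\<And>k z. k \<in> K \<Longrightarrow> z \<in> \<int> \<Longrightarrow> k * z \<in> K"
  shows "normal_over K G"
  using normal_at_fan_iso[OF assms(1) tropical_rational_fan[OF assms(2)] assms(3,4)]
    normal_over_iff[OF assms(2,5)] by blast

theorem T_stable_normal_over:
  assumes K: "0 \<in> K" "\<And>k z. k \<in> K \<Longrightarrow> z \<in> \<int> \<Longrightarrow> k * z \<in> K"
  shows "T_stable_property_in (div_closed_fans K) (normal_over K)"
proof -
  let ?C = "div_closed_fans K" and ?S = "{F \<in> div_closed_fans K. normal_over K F}"
  have CD: "tropical_fan F" "rational_fan F" "\<forall>\<eta>\<in>cones_dim F (fdim F). \<forall>k\<in>K. k / wt F \<eta> \<in> K"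
    if "F \<in> ?C" for F
    using that tropical_rational_fan unfolding div_closed_fans_def by blast+
  have no: "normal_over K F \<longleftrightarrow> (\<forall>\<tau>\<in>codim1 F. normal_at K F \<tau>)" if "tropical_fan F" for F :: tfan
    using normal_over_iff[OF that K(2)] .
  have SD: "F \<in> ?C" "tropical_fan F" "\<forall>\<tau>\<in>codim1 F. normal_at K F \<tau>" if F: "F \<in> ?S" for F
  proof -
    show "F \<in> ?C" "tropical_fan F" using F CD(1) by blast+
    then show "\<forall>\<tau>\<in>codim1 F. normal_at K F \<tau>" using F no by blast
  qed
  have Ciso: "G \<in> ?C" if F: "F \<in> ?C" and G: "tropical_fan G" and iso: "fan_iso F G" for F G
  proof -
    have "k / wt G \<eta> \<in> K" if \<eta>: "\<eta> \<in> cones_dim G (fdim G)" and k: "k \<in> K" for \<eta> k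
    proof -
      obtain \<xi> where "\<xi> \<in> cones_dim F (fdim F)" "wt G \<eta> = wt F \<xi>"
        using fan_iso_wt[OF iso tropical_rational_fan[OF G] \<eta>] .
      then show ?thesis using CD(3)[OF F] k by simp
    qed
    then show ?thesis using G unfolding div_closed_fans_def by blast
  qed
  have prod: "G \<in> ?S" if F: "F \<in> ?S" and F': "F' \<in> ?S" and G: "G \<in> ?C" "fan_iso (prod_fan F F') G" for F F' G
    using G(1) normal_over_of_fan_iso[OF G(2) CD(1)[OF G(1)] normal_at_prod[OF SD(2)[OF F] SD(2)[OF F'] SD(3)[OF F]
          SD(3)[OF F'] K(1) CD(3)[OF SD(1)[OF F]] CD(3)[OF SD(1)[OF F']]] K] by blast
  have tmod: "G \<in> ?S" if F: "F \<in> ?S" and f: "meromorphic_fun F f" "div_trivial F f \<or> div_fan F f \<in> ?S"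
    and G: "G \<in> ?C" "fan_iso (trop_mod F f) G" for F f G
  proof -
    have D: "div_trivial F f \<or> (\<forall>\<delta>\<in>codim1 (div_fan F f). normal_at K (div_fan F f) \<delta>)"
      using f(2) SD(3) by blast
    show ?thesis
      using G(1) normal_over_of_fan_iso[OF G(2) CD(1)[OF G(1)] normal_at_trop_mod[OF SD(2)[OF F] f(1) SD(3)[OF F] D K(1)] K]
      by blast
  qed
  have blow: "F \<in> ?S \<longleftrightarrow> blow_up F \<sigma> \<rho> \<in> ?S"
    if F: "F \<in> ?C" and \<sigma>: "\<sigma> \<in> Cones F" and \<rho>: "rational_ray_in F \<sigma> \<rho>"
      and star: "star_fan F \<sigma> \<in> ?S" and B: "blow_up F \<sigma> \<rho> \<in> ?C" for F \<sigma> \<rho>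
  proof -
    obtain v where "v \<noteq> 0" "\<rho> = convex_cone hull {v}" "\<rho> - {0} \<subseteq> rel_interior \<sigma>"
      using \<rho> unfolding rational_ray_in_def by blast
    then have v: "v \<noteq> 0" "\<rho> = convex_cone hull {v}" "v \<in> rel_interior \<sigma>"
      by (auto intro: hull_inc)
    note up = normal_at_blow_up[OF CD(1)[OF F] \<sigma> v CD(1)[OF B] _ K(1) CD(3)[OF B]]
    note down = normal_at_blow_down[OF CD(1)[OF F] \<sigma> v CD(1)[OF B] _ SD(3)[OF star] K(1)]
    show ?thesis
      using F B no[OF CD(1)[OF F]] no[OF CD(1)[OF B]] up down by blast
  qed
  have "fan_class ?C" unfolding fan_class_def using CD(1) Ciso by blast
  moreover have "fan_class ?S" unfolding fan_class_def
  proof (intro conjI ballI allI impI)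
    show "tropical_fan F" if "F \<in> ?S" for F using SD(2)[OF that] .
    fix F G :: tfan assume F: "F \<in> ?S" and G: "tropical_fan G \<and> fan_iso F G"
    then have "G \<in> ?C" using Ciso SD(1) by blast
    then show "G \<in> ?S" using normal_over_of_fan_iso[OF _ _ SD(3)[OF F] K] G by blast
  qed
  ultimately show ?thesis
    unfolding T_stable_property_in_def T_stable_in_def using prod tmod blow by blast
qed

lemma div_closed_fans_Rats: "div_closed_fans \<rat> = {F. tropical_fan F}"
proof -
  have "k / wt F \<eta> \<in> \<rat>" if "tropical_fan F" "\<eta> \<in> cones_dim F (fdim F)" "k \<in> \<rat>" for F :: tfan and \<eta> k
    using tropical_wt_Ints(1)[OF that(1,2)] Ints_subset_Rats that(3) by (blast intro: Rats_divide)
  then show ?thesis unfolding div_closed_fans_def by blast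
qed

lemma div_closed_fans_Ints: "div_closed_fans \<int> = {F. unitary_fan F}"
proof -
  have iff: "(\<forall>k\<in>\<int>. k / x \<in> \<int>) \<longleftrightarrow> x = 1 \<or> x = - 1" if x: "x \<in> \<int>" "x \<noteq> 0" for x :: real
  proof
    assume "\<forall>k\<in>\<int>. k / x \<in> \<int>"
    then have "1 / x \<in> \<int>" by simp
    then obtain a b where ab: "x = of_int a" "1 / x = of_int b" using x(1) by (elim Ints_cases)
    then have "real_of_int (a * b) = 1" using x(2) by (simp flip: ab)
    then have "a * b = 1" unfolding of_int_eq_1_iff .
    then show "x = 1 \<or> x = - 1" using ab(1) by (auto simp: zmult_eq_1_iff)
  qed auto
  have "(\<forall>\<eta>\<in>cones_dim F (fdim F). \<forall>k\<in>\<int>. k / wt F \<eta> \<in> \<int>) \<longleftrightarrow>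
      (\<forall>\<eta>\<in>cones_dim F (fdim F). wt F \<eta> = 1 \<or> wt F \<eta> = - 1)" if "tropical_fan F" for F :: tfan
    by (rule ball_cong[OF refl]) (rule iff[OF tropical_wt_Ints[OF that]])
  then show ?thesis unfolding div_closed_fans_def unitary_fan_def by blast
qed

theorem theorem1p3:
  shows "T_stable_property_in {F. tropical_fan F} Q_normal_fan \<and>
         T_stable_property_in {F. unitary_fan F} normal_fan"
proof
  have "T_stable_property_in (div_closed_fans \<rat>) (normal_over \<rat>)"
    by (rule T_stable_normal_over) (use Ints_subset_Rats in \<open>auto intro: Rats_mult\<close>)
  then show "T_stable_property_in {F. tropical_fan F} Q_normal_fan"
    unfolding div_closed_fans_Rats Q_normal_fan_def T_stable_property_in_def .
  have "T_stable_property_in (div_closed_fans \<int>) (normal_over \<int>)"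
    by (rule T_stable_normal_over) auto
  then show "T_stable_property_in {F. unitary_fan F} normal_fan"
    unfolding div_closed_fans_Ints normal_fan_def T_stable_property_in_def .
qed

end
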